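(* Let $(q_1,b_1,h_1)$ and $(q_2,b_2,h_2)$ be two potentials with $m$-functions $m_1,m_2$, and let $0<a<\min(b_1,b_2)$. If $$q_1(x)=q_2(x)\quad\text{for (a.e.) } x\in(0,a),$$ then as $\kappa\to\infty$ (real $\kappa$), $$m_1(-\kappa^2)-m_2(-\kappa^2)=\tilde O(e^{-2\kappa a}).$$ Conversely, if $m_1(-\kappa^2)-m_2(-\kappa^2)=\tilde O(e^{-2\kappa a})$ as $\kappa\to\infty$, then $q_1(x)=q_2(x)$ for (a.e.) $x\in(0,a)$.
   Context: A potential is a triple $(q,b,h)$ with $0<b\le\infty$ and $q$ a real-valued measurable function on $(0,b)$. If $b<\infty$, assume $\int_0^b|q(x)|\,dx<\infty$ and $h\in\mathbb{R}\cup\{\infty\}$, specifying the boundary condition $u'(b)+hu(b)=0$ ($h=\infty$ means $u(b)=0$). If $b=\infty$, there is no $h$, and assume $\int_y^{y+1}|q(x)|\,dx<\infty$ for all $y\ge0$ and $\sup_{y>0}\int_y^{y+1}\max(-q(x),0)\,dx<\infty$ (so that $-\frac{d^2}{dx^2}+q$ is limit point at infinity). For $z\in\mathbb{C}\setminus[\beta,\infty)$ with $-\beta$ sufficiently large there is, up to a constant multiple, a unique nonzero solution $u(x,z)$ of $-u''+qu=zu$ on $(0,b)$ which satisfies the boundary condition at $b$ if $b<\infty$, or is $L^2$ at infinity if $b=\infty$. The $m$-function is $m(z)=u'(0,z)/u(0,z)$. Notation: if $g\to0$ as $x\to x_0$, then $f=\tilde O(g)$ as $x\to x_0$ means $\lim_{x\to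 x_0}|f(x)|/|g(x)|^{1-\varepsilon}=0$ for every $\varepsilon>0$. *)

theory Defs
  imports "HOL-Analysis.Analysis"
begin

text \<open>
  A potential is a triple \<open>(q, b, h)\<close> with \<open>b\<close> and \<open>h\<close> extended reals. For \<open>b < \<infinity>\<close> the parameter
  \<open>h\<close> ranges over the reals and \<open>\<infinity>\<close>; for \<open>b = \<infinity>\<close> it is ignored by all definitions. Only the
  values of \<open>q\<close> on \<open>(0, b)\<close> matter.
\<close>

definition is_potential :: "(real \<Rightarrow> real) \<Rightarrow> ereal \<Rightarrow> ereal \<Rightarrow> bool" where
  "is_potential q b h \<longleftrightarrow>
     0 < b \<and>
     set_borel_measurable lebesgue {x. 0 < x \<and> ereal x < b} q \<and>
     (if b < \<infinity>
      then set_integrable lebesgue {0<..<real_of_ereal b} q \<and> h \<noteq> -\<infinity>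
      else (\<forall>y\<ge>0. set_integrable lebesgue {y<..<y+1} q) \<and>
           (\<exists>C. \<forall>y>0. (LINT x:{y<..<y+1}|lebesgue. max (- q x) 0) \<le> C))"

text \<open>
  Solutions of \<open>-u'' + q u = z u\<close> are meant in the Caratheodory sense: \<open>u\<close> is continuously
  differentiable with derivative \<open>v\<close>, and \<open>v\<close> is locally absolutely continuous with
  \<open>v' = (q - z) u\<close> almost everywhere, i.e. \<open>v\<close> is the indefinite integral of \<open>(q - z) u\<close>.
  The interval includes the endpoint 0, and also \<open>b\<close> if \<open>b < \<infinity>\<close>, since solutions and their
  derivatives extend continuously to these endpoints.
\<close>

definition schroedinger_solution ::
  "(real \<Rightarrow> real) \<Rightarrow> ereal \<Rightarrow> complex \<Rightarrow> (real \<Rightarrow> complex) \<Rightarrow> (real \<Rightarrow> complex) \<Rightarrow> bool" where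
  "schroedinger_solution q b z u v \<longleftrightarrow>
     (let I = {x. 0 \<le> x \<and> ereal x \<le> b} in
       (\<forall>x\<in>I. (u has_vector_derivative v x) (at x within I)) \<and>
       (\<forall>x\<in>I. v x = v 0 + (LINT t:{0<..<x}|lebesgue. (of_real (q t) - z) * u t)))"

definition condition_at_right_end ::
  "ereal \<Rightarrow> ereal \<Rightarrow> (real \<Rightarrow> complex) \<Rightarrow> (real \<Rightarrow> complex) \<Rightarrow> bool" where
  "condition_at_right_end b h u v \<longleftrightarrow>
     (if b < \<infinity>
      then (if h = \<infinity> then u (real_of_ereal b) = 0
            else v (real_of_ereal b) + of_real (real_of_ereal h) * u (real_of_ereal b) = 0)
      else (\<exists>R\<ge>0. set_integrable lebesgue {R<..} (\<lambda>x. (norm (u x))\<^sup>2)))"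

definition weyl_solution ::
  "(real \<Rightarrow> real) \<Rightarrow> ereal \<Rightarrow> ereal \<Rightarrow> complex \<Rightarrow> (real \<Rightarrow> complex) \<Rightarrow> (real \<Rightarrow> complex) \<Rightarrow> bool" where
  "weyl_solution q b h z u v \<longleftrightarrow>
     schroedinger_solution q b z u v \<and>
     condition_at_right_end b h u v \<and>
     (\<exists>x. 0 < x \<and> ereal x < b \<and> u x \<noteq> 0)"

text \<open>
  The quotient does not depend on the choice of the Weyl solution wherever the latter is unique up
  to a constant multiple, in particular for \<open>z\<close> outside \<open>[\<beta>, \<infinity>)\<close> with \<open>-\<beta>\<close> sufficiently large.
  No meaning is attached to the value at other \<open>z\<close>.
\<close>

definition m_function :: "(real \<Rightarrow> real) \<Rightarrow> ereal \<Rightarrow> ereal \<Rightarrow> complex \<Rightarrow> complex" where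
  "m_function q b h z = (THE w. \<exists>u v. weyl_solution q b h z u v \<and> w = v 0 / u 0)"

definition soft_bigo ::
  "'a filter \<Rightarrow> ('a \<Rightarrow> 'b::real_normed_vector) \<Rightarrow> ('a \<Rightarrow> 'c::real_normed_vector) \<Rightarrow> bool" where
  "soft_bigo F f g \<longleftrightarrow>
     (\<forall>\<epsilon>>0. ((\<lambda>x. norm (f x) / norm (g x) powr (1 - \<epsilon>)) \<longlongrightarrow> 0) F)"

end

theory Submission
  imports Defs
begin

text \<open>
  Let \<open>\<psi>\<^sub>1\<close>, \<open>\<psi>\<^sub>2\<close> be the Weyl solutions at \<open>-\<kappa>\<^sup>2\<close> and \<open>W\<close> their Wronskian, so that
  \<open>m\<^sub>1 - m\<^sub>2 = W(0) / (\<psi>\<^sub>1(0) \<psi>\<^sub>2(0))\<close> and \<open>W' = (q\<^sub>1 - q\<^sub>2) \<psi>\<^sub>1 \<psi>\<^sub>2\<close>. If the potentials agree on \<open>(0, a)\<close>,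
  then \<open>W(0) = W(a)\<close>, and \<open>\<psi>\<^sub>j(a)\<close>, \<open>\<psi>\<^sub>j'(a)\<close> are at most a power of \<open>\<kappa>\<close> times \<open>e\<^bsup>-\<kappa>a\<^esup> \<psi>\<^sub>j(0)\<close>.

  For the converse this estimate allows to cut the potentials off at \<open>a\<close>. The Weyl solutions then are
  multiples of Jost solutions \<open>f\<^sub>j\<close>, which are equal to \<open>e\<^bsup>-\<kappa>x\<^esup>\<close> beyond \<open>a\<close>, whence
  \<open>\<integral>\<^sub>0\<^sup>a (q\<^sub>1 - q\<^sub>2) f\<^sub>1 f\<^sub>2 = - W(0)\<close>. Marchenko's representation of \<open>e\<^bsup>\<kappa>x\<^esup> f\<^sub>j\<close> as one plus a Laplace
  transform with a kernel independent of \<open>\<kappa>\<close> turns the left-hand side into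
  \<open>\<integral>\<^sub>0\<^sup>a P(y) e\<^bsup>-2\<kappa>y\<^esup> dy + O(e\<^bsup>-2\<kappa>a\<^esup>)\<close>, where \<open>P - (q\<^sub>1 - q\<^sub>2)\<close> is a Volterra operator applied to
  \<open>q\<^sub>1 - q\<^sub>2\<close>. A uniqueness theorem for Laplace transforms on the real axis gives \<open>P = 0\<close>, and
  Gronwall's inequality gives \<open>q\<^sub>1 = q\<^sub>2\<close>.
\<close>

section \<open>Absolutely continuous functions with a given density\<close>

text \<open>Potentials are merely integrable, so every differential identity is carried as an
  integral identity (\<open>ac_on\<close>), and differential inequalities become monotonicity
  statements. For infinite b the potential need not be bounded below; only its negative mass per
  unit length is controlled. Instead the growth of one solution is read off from a bounded Riccati
  subsolution, and the recessive solution is obtained from the growing one by reduction of order,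
  with a constant that encodes the condition at the right end. Since z = -\<kappa>^2 is real,
  complex Weyl solutions are treated through their real and imaginary parts. The powers of \<kappa>
  lost in these estimates are absorbed by the \<epsilon> of the soft O. Conversely, the hypothesis
  leaves a factor e^(\<epsilon> \<kappa>) for each \<epsilon>, which the uniqueness theorem for
  Laplace transforms has to tolerate. Marchenko's kernel is built for potentials integrable on the
  whole line, and the Wronskian of two Jost solutions vanishes at a only because both potentials
  vanish beyond a; this is what the truncation buys.\<close>

text \<open>Absolute continuity is encoded by its integral formula, so that Lebesgue's
  differentiation theorem is never invoked and the values of \<open>d\<close> on a null set do not
  matter. For X < 0 the interval is empty and the predicate holds trivially, which makes assumptions
  quantified over all X harmless.\<close>

definition ac_on :: "real \<Rightarrow> (real \<Rightarrow> real) \<Rightarrow> (real \<Rightarrow> real) \<Rightarrow> bool" where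
  "ac_on X F d \<longleftrightarrow> set_integrable lborel {0..X} d \<and> (\<forall>x\<in>{0..X}. F x = F 0 + (LBINT t:{0..x}. d t))"

lemma ac_onI:
  assumes "set_integrable lborel {0..X} d"
    and "\<And>x. x \<in> {0..X} \<Longrightarrow> (LBINT t:{0..x}. d t) = F x - F 0"
  shows "ac_on X F d"
  using assms unfolding ac_on_def by fastforce

lemma ac_onD:
  assumes "ac_on X F d" "x \<in> {0..X}"
  shows "(LBINT t:{0..x}. d t) = F x - F 0"
proof -
  have "F x = F 0 + (LBINT t:{0..x}. d t)"
    using assms unfolding ac_on_def by blast
  thus ?thesis by linarith
qed

lemma set_integrable_mult_continuous:
  fixes f g :: "real \<Rightarrow> real"
  assumes f: "set_integrable lborel {x..y} f" and g: "continuous_on {x..y} g"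
  shows "set_integrable lborel {x..y} (\<lambda>t. f t * g t)"
proof -
  have "bounded (g ` {x..y})"
    using compact_continuous_image[OF g] compact_imp_bounded by blast
  then obtain M where "\<forall>z\<in>g ` {x..y}. norm z \<le> M"
    unfolding bounded_iff by blast
  hence M: "\<And>t. t \<in> {x..y} \<Longrightarrow> \<bar>g t\<bar> \<le> M"
    by auto
  have gm: "(\<lambda>t. indicator {x..y} t * g t) \<in> borel_measurable borel"
    using borel_measurable_continuous_on_indicator[OF _ g] by simp
  have fm: "(\<lambda>t. indicator {x..y} t * f t) \<in> borel_measurable lborel"
    using f by (auto simp: set_integrable_def dest: borel_measurable_integrable)
  have "integrable lborel (\<lambda>t. (indicator {x..y} t * f t) * (indicator {x..y} t * g t))"
  proof (rule Bochner_Integration.integrable_bound)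
    show "integrable lborel (\<lambda>t. M * (indicator {x..y} t * f t))"
      using f by (simp add: set_integrable_def)
    show "(\<lambda>t. (indicator {x..y} t * f t) * (indicator {x..y} t * g t)) \<in> borel_measurable lborel"
      using fm gm by measurable
    show "AE t in lborel. norm ((indicator {x..y} t * f t) * (indicator {x..y} t * g t))
        \<le> norm (M * (indicator {x..y} t * f t))"
    proof (rule AE_I2)
      fix t
      show "norm ((indicator {x..y} t * f t) * (indicator {x..y} t * g t))
        \<le> norm (M * (indicator {x..y} t * f t))"
        using M[of t] mult_right_mono[OF M[of t], of "\<bar>f t\<bar>"]
        by (cases "t \<in> {x..y}") (auto simp: abs_mult mult.commute)
    qed
  qed
  moreover have "(\<lambda>t. (indicator {x..y} t * f t) * (indicator {x..y} t * g t))
      = (\<lambda>t. indicator {x..y} t *\<^sub>R (f t * g t))"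
    by (auto simp: indicator_def)
  ultimately show ?thesis by (simp add: set_integrable_def)
qed

lemma ac_on_integrable: "ac_on X F d \<Longrightarrow> set_integrable lborel {0..X} d"
  by (simp add: ac_on_def)

lemma ac_on_diff_eq:
  assumes "ac_on X F d" "0 \<le> x" "x \<le> y" "y \<le> X"
  shows "F y - F x = (LBINT t:{x..y}. d t)"
proof -
  have s: "set_integrable lborel {u..v} d" if "0 \<le> u" "v \<le> X" for u v
    using set_integrable_subset[OF ac_on_integrable[OF assms(1)], of "{u..v}"] that by auto
  have eq: "(LBINT t:{u..v}. d t) = integral {u..v} d" if "0 \<le> u" "v \<le> X" for u v
    using set_borel_integral_eq_integral(2)[OF s[OF that]] .
  have i: "d integrable_on {0..y}"
    using set_borel_integral_eq_integral(1)[OF s[of 0 y]] assms by auto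
  have "integral {0..x} d + integral {x..y} d = integral {0..y} d"
    using Henstock_Kurzweil_Integration.integral_combine[OF _ _ i] assms by auto
  moreover have "integral {0..x} d = F x - F 0" "integral {0..y} d = F y - F 0"
    using ac_onD[OF assms(1), of x] ac_onD[OF assms(1), of y] assms eq[of 0 x] eq[of 0 y] by auto
  moreover have "(LBINT t:{x..y}. d t) = integral {x..y} d"
    using assms eq by auto
  ultimately show ?thesis by simp
qed

lemma ac_on_eq_integral:
  assumes "ac_on X F d" "x \<in> {0..X}"
  shows "F 0 + integral {0..x} d = F x"
proof -
  have "set_integrable lborel {0..x} d"
    using set_integrable_subset[OF ac_on_integrable[OF assms(1)], of "{0..x}"] assms by auto
  from set_borel_integral_eq_integral(2)[OF this] show ?thesis
    using ac_onD[OF assms] by linarith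
qed

lemma ac_on_continuous:
  assumes "ac_on X F d"
  shows "continuous_on {0..X} F"
proof -
  have "d integrable_on {0..X}"
    using ac_on_integrable[OF assms] set_borel_integral_eq_integral(1) by blast
  hence "continuous_on {0..X} (\<lambda>x. F 0 + integral {0..x} d)"
    by (intro continuous_intros indefinite_integral_continuous_1)
  thus ?thesis
    by (rule continuous_on_eq) (use ac_on_eq_integral[OF assms] in auto)
qed

lemma ac_on_has_derivative:
  assumes "ac_on X F d" "continuous_on {0..X} d" "x \<in> {0..X}"
  shows "(F has_real_derivative d x) (at x within {0..X})"
proof -
  have *: "((\<lambda>x. F 0 + integral {0..x} d) has_real_derivative d x) (at x within {0..X})"
    using integral_has_real_derivative[OF assms(2,3)]
    by (auto intro!: derivative_eq_intros)
  show ?thesis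
    by (rule has_field_derivative_transform_within[OF * zero_less_one assms(3)])
       (rule ac_on_eq_integral[OF assms(1)])
qed

lemma ac_on_C1:
  assumes "\<And>x. x \<in> {0..X} \<Longrightarrow> (F has_real_derivative d x) (at x within {0..X})"
    and c: "continuous_on {0..X} d"
  shows "ac_on X F d"
proof -
  have i: "set_integrable lborel {0..x} d" if "x \<le> X" for x
    using that continuous_on_subset[OF c, of "{0..x}"] by (intro borel_integrable_atLeastAtMost') auto
  have "(LBINT t:{0..x}. d t) = F x - F 0" if x: "x \<in> {0..X}" for x
  proof -
    have "(d has_integral (F x - F 0)) {0..x}"
    proof (rule fundamental_theorem_of_calculus)
      fix y assume "y \<in> {0..x}"
      hence "(F has_real_derivative d y) (at y within {0..x})"
        using assms(1)[of y] x by (rule_tac DERIV_subset[where s = "{0..X}"]) auto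
      thus "(F has_vector_derivative d y) (at y within {0..x})"
        by (simp add: has_real_derivative_iff_has_vector_derivative)
    qed (use x in auto)
    moreover have "(LBINT t:{0..x}. d t) = integral {0..x} d"
      using set_borel_integral_eq_integral(2)[OF i] x by auto
    ultimately show ?thesis by (simp add: integral_unique)
  qed
  thus ?thesis using i[of X] by (intro ac_onI) auto
qed

lemma ac_on_const: "ac_on X (\<lambda>_. c) (\<lambda>_. 0)"
  by (rule ac_on_C1) (auto intro!: derivative_eq_intros)

lemma ac_on_add:
  assumes "ac_on X F d" "ac_on X G e"
  shows "ac_on X (\<lambda>x. F x + G x) (\<lambda>x. d x + e x)"
proof -
  have "set_integrable lborel {0..x} d" "set_integrable lborel {0..x} e" if "x \<le> X" for x
    using set_integrable_subset[OF ac_on_integrable[OF assms(1)], of "{0..x}"]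
      set_integrable_subset[OF ac_on_integrable[OF assms(2)], of "{0..x}"] that by auto
  thus ?thesis
    using ac_onD[OF assms(1)] ac_onD[OF assms(2)] assms
    by (intro ac_onI) (auto simp: set_integral_add dest: ac_on_integrable)
qed

lemma ac_on_cmult:
  assumes "ac_on X F d"
  shows "ac_on X (\<lambda>x. c * F x) (\<lambda>x. c * d x)"
proof -
  have "(LBINT t:{0..x}. c * d t) = c * F x - c * F 0" if "x \<in> {0..X}" for x
    by (simp add: ac_onD[OF assms that] right_diff_distrib)
  thus ?thesis using assms by (intro ac_onI) (auto dest: ac_on_integrable)
qed

lemma ac_on_minus:
  assumes "ac_on X F d" shows "ac_on X (\<lambda>x. - F x) (\<lambda>x. - d x)"
  using ac_on_cmult[OF assms, of "-1"] by simp

lemma ac_on_diff: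
  assumes "ac_on X F d" "ac_on X G e"
  shows "ac_on X (\<lambda>x. F x - G x) (\<lambda>x. d x - e x)"
  using ac_on_add[OF assms(1) ac_on_minus[OF assms(2)]] by simp

lemma ac_on_cong:
  assumes "ac_on X F d" "\<And>x. x \<in> {0..X} \<Longrightarrow> F x = G x" "\<And>x. x \<in> {0..X} \<Longrightarrow> d x = e x"
  shows "ac_on X G e"
proof (cases "0 \<le> X")
  case True
  have "set_integrable lborel {0..X} e"
    using ac_on_integrable[OF assms(1)] assms(3)
      set_integrable_cong[of lborel lborel "{0..X}" "{0..X}" d e] by auto
  moreover have "(LBINT t:{0..x}. d t) = (LBINT t:{0..x}. e t)" if "x \<in> {0..X}" for x
    using that assms(3) by (intro set_lebesgue_integral_cong) auto
  ultimately show ?thesis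
    using ac_onD[OF assms(1)] assms(2) True by (intro ac_onI) auto
qed (auto simp: ac_on_def set_integrable_def)

text \<open>Product rule without derivatives: (F x - F 0) (G x - G 0) is the double integral of d(s)
  e(t) over a square. Cutting the square along the diagonal and integrating first over the inner
  variable of each triangle gives the two terms of the rule, up to the constants F 0 and G
  0.\<close>

lemma ac_on_mult:
  assumes F: "ac_on X F d" and G: "ac_on X G e"
  shows "ac_on X (\<lambda>x. F x * G x) (\<lambda>x. d x * G x + F x * e x)"
proof -
  have i1: "set_integrable lborel {0..X} (\<lambda>x. d x * G x)"
    using set_integrable_mult_continuous[OF ac_on_integrable[OF F] ac_on_continuous[OF G]] .
  have i2: "set_integrable lborel {0..X} (\<lambda>x. F x * e x)"
    using set_integrable_mult_continuous[OF ac_on_integrable[OF G] ac_on_continuous[OF F]]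
    by (simp add: mult.commute)
  have "(LBINT t:{0..x}. d t * G t + F t * e t) = F x * G x - F 0 * G 0" if x: "x \<in> {0..X}" for x
  proof -
    define d' where "d' = (\<lambda>t. indicator {0..x} t * d t)"
    define e' where "e' = (\<lambda>t. indicator {0..x} t * e t)"
    have d': "integrable lborel d'"
      using set_integrable_subset[OF ac_on_integrable[OF F], of "{0..x}"] x
      by (auto simp: d'_def set_integrable_def)
    have e': "integrable lborel e'"
      using set_integrable_subset[OF ac_on_integrable[OF G], of "{0..x}"] x
      by (auto simp: e'_def set_integrable_def)
    have [measurable]: "d' \<in> borel_measurable borel" "e' \<in> borel_measurable borel"
      using d' e' by (auto dest: borel_measurable_integrable)
    have prod: "integrable (lborel \<Otimes>\<^sub>M lborel) (\<lambda>(s,t). d' s * e' t)"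
    proof (rule lborel_pair.Fubini_integrable)
      show "integrable lborel (\<lambda>s. LBINT t. norm (case (s, t) of (s, t) \<Rightarrow> d' s * e' t))"
        using d' by (simp add: abs_mult)
      show "AE s in lborel. integrable lborel (\<lambda>t. case (s, t) of (s, t) \<Rightarrow> d' s * e' t)"
        using e' by simp
    qed measurable
    have le: "integrable (lborel \<Otimes>\<^sub>M lborel) (\<lambda>(s,t). indicator {..t} s * (d' s * e' t))"
      by (rule Bochner_Integration.integrable_bound[OF prod])
         (auto simp: indicator_def case_prod_beta)
    have gt: "integrable (lborel \<Otimes>\<^sub>M lborel) (\<lambda>(s,t). indicator {..<s} t * (d' s * e' t))"
      by (rule Bochner_Integration.integrable_bound[OF prod])
         (auto simp: indicator_def case_prod_beta)
    have dF: "(LBINT t:{0..y}. d t) = F y - F 0" if "y \<in> {0..x}" for y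
      using ac_onD[OF F] x that by auto
    have eG: "(LBINT t:{0..y}. e t) = G y - G 0" if "y \<in> {0..x}" for y
      using ac_onD[OF G] x that by auto
    have "(LBINT t:{0..x}. d t) * (LBINT t:{0..x}. e t) = (LBINT s. d' s) * (LBINT t. e' t)"
      by (simp add: d'_def e'_def set_lebesgue_integral_def)
    also have "\<dots> = (LBINT s. LBINT t. d' s * e' t)"
      by simp
    also have "\<dots> = (\<integral>(s,t). d' s * e' t \<partial>(lborel \<Otimes>\<^sub>M lborel))"
      using lborel_pair.integral_fst'[OF prod] by simp
    also have "\<dots> = (\<integral>z. (case z of (s,t) \<Rightarrow> indicator {..t} s * (d' s * e' t))
        + (case z of (s,t) \<Rightarrow> indicator {..<s} t * (d' s * e' t)) \<partial>(lborel \<Otimes>\<^sub>M lborel))"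
      by (intro Bochner_Integration.integral_cong) (auto simp: indicator_def)
    also have "\<dots> = (\<integral>(s,t). indicator {..t} s * (d' s * e' t) \<partial>(lborel \<Otimes>\<^sub>M lborel))
        + (\<integral>(s,t). indicator {..<s} t * (d' s * e' t) \<partial>(lborel \<Otimes>\<^sub>M lborel))"
      by (rule Bochner_Integration.integral_add[OF le gt])
    also have "(\<integral>(s,t). indicator {..t} s * (d' s * e' t) \<partial>(lborel \<Otimes>\<^sub>M lborel))
        = (LBINT t. LBINT s. indicator {..t} s * (d' s * e' t))"
      using lborel_pair.integral_snd[OF le] by simp
    also have "\<dots> = (LBINT t. indicator {0..x} t * ((F t - F 0) * e t))"
    proof (rule Bochner_Integration.integral_cong)
      fix t :: real
      have "(LBINT s. indicator {..t} s * (d' s * e' t)) = (LBINT s. indicator {0..t} s * d s) * e' t"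
        unfolding Bochner_Integration.integral_mult_left_zero[symmetric]
        by (intro Bochner_Integration.integral_cong) (auto simp: d'_def e'_def indicator_def)
      also have "\<dots> = indicator {0..x} t * ((F t - F 0) * e t)"
        using dF[of t] by (auto simp: e'_def set_lebesgue_integral_def indicator_def)
      finally show "(LBINT s. indicator {..t} s * (d' s * e' t)) = indicator {0..x} t * ((F t - F 0) * e t)" .
    qed simp
    also have "\<dots> = (LBINT t:{0..x}. (F t - F 0) * e t)"
      by (simp add: set_lebesgue_integral_def)
    also have "(\<integral>(s,t). indicator {..<s} t * (d' s * e' t) \<partial>(lborel \<Otimes>\<^sub>M lborel))
        = (LBINT s. LBINT t. indicator {..<s} t * (d' s * e' t))"
      using lborel_pair.integral_fst'[OF gt] by simp
    also have "\<dots> = (LBINT s. indicator {0..x} s * (d s * (G s - G 0)))"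
    proof (rule Bochner_Integration.integral_cong)
      fix s :: real
      have "(LBINT t. indicator {..<s} t * (d' s * e' t)) = (LBINT t. indicator {..<s} t * e' t) * d' s"
        unfolding Bochner_Integration.integral_mult_left_zero[symmetric]
        by (intro Bochner_Integration.integral_cong) (auto simp: d'_def e'_def indicator_def)
      \<comment> \<open>The diagonal was assigned to the other triangle; here it is added back, at
        the cost of a single point.\<close>
      also have "(LBINT t. indicator {..<s} t * e' t) = (LBINT t. indicator {..s} t * e' t)"
      proof (rule integral_cong_AE)
        show "AE t in lborel. indicator {..<s} t * e' t = indicator {..s} t * e' t"
          using AE_lborel_singleton[of s] by eventually_elim (auto simp: indicator_def)
      qed measurable
      also have "\<dots> * d' s = (LBINT t. indicator {0..s} t * e t) * d' s"
      proof (cases "s \<in> {0..x}")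
        case True
        hence "(\<lambda>t. indicator {..s} t * e' t) = (\<lambda>t. indicator {0..s} t * e t)"
          by (auto simp: e'_def indicator_def)
        thus ?thesis by simp
      qed (simp add: d'_def)
      also have "\<dots> = indicator {0..x} s * (d s * (G s - G 0))"
        using eG[of s] by (auto simp: d'_def set_lebesgue_integral_def indicator_def)
      finally show "(LBINT t. indicator {..<s} t * (d' s * e' t)) = indicator {0..x} s * (d s * (G s - G 0))" .
    qed simp
    also have "\<dots> = (LBINT s:{0..x}. d s * (G s - G 0))"
      by (simp add: set_lebesgue_integral_def)
    finally have main: "(F x - F 0) * (G x - G 0) = (LBINT t:{0..x}. (F t - F 0) * e t) + (LBINT s:{0..x}. d s * (G s - G 0))"
      using dF[of x] eG[of x] x by auto
    have s: "set_integrable lborel {0..x} h" if "set_integrable lborel {0..X} h" for h :: "real \<Rightarrow> real"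
      using set_integrable_subset[OF that, of "{0..x}"] x by auto
    have "(LBINT t:{0..x}. (F t - F 0) * e t) = (LBINT t:{0..x}. F t * e t) - F 0 * (G x - G 0)"
      using s[OF i2] s[OF ac_on_integrable[OF G]] eG[of x] x by (simp add: left_diff_distrib)
    moreover have "(LBINT t:{0..x}. d t * (G t - G 0)) = (LBINT t:{0..x}. d t * G t) - G 0 * (F x - F 0)"
      using s[OF i1] s[OF ac_on_integrable[OF F]] dF[of x] x by (simp add: right_diff_distrib) (simp add: algebra_simps)
    moreover have "(LBINT t:{0..x}. d t * G t + F t * e t) = (LBINT t:{0..x}. d t * G t) + (LBINT t:{0..x}. F t * e t)"
      using s[OF i1] s[OF i2] by (rule set_integral_add)
    ultimately show ?thesis using main by (simp add: algebra_simps)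
  qed
  moreover have "set_integrable lborel {0..X} (\<lambda>x. d x * G x + F x * e x)"
    using i1 i2 by (rule set_integral_add)
  ultimately show ?thesis by (intro ac_onI) auto
qed

text \<open>All comparison arguments below end here: an auxiliary function, typically a solution
  times an integrating factor, is shown to have a nonnegative density. The sign is asked for at
  every point, so an inequality known only almost everywhere has to be integrated once before it is
  used.\<close>

lemma ac_on_mono:
  assumes F: "ac_on X F d" and xy: "0 \<le> x" "x \<le> y" "y \<le> X"
    and d: "\<And>t. t \<in> {x..y} \<Longrightarrow> 0 \<le> d t"
  shows "F x \<le> F y"
proof -
  have "0 \<le> (LBINT t:{x..y}. d t)"
    using d by (auto simp: set_lebesgue_integral_def indicator_def intro!: integral_nonneg_AE)
  thus ?thesis using ac_on_diff_eq[OF F xy] by simp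
qed

lemma ac_on_zero_density:
  assumes "ac_on X F (\<lambda>_. 0)" "x \<in> {0..X}"
  shows "F x = F 0"
  using ac_onD[OF assms] by (simp add: set_lebesgue_integral_def)

lemma ac_on_power:
  assumes "ac_on X F d"
  shows "ac_on X (\<lambda>x. F x ^ Suc n) (\<lambda>x. real (Suc n) * d x * F x ^ n)"
proof (induction n)
  case 0
  show ?case using assms by simp
next
  case (Suc n)
  show ?case
    by (rule ac_on_cong[OF ac_on_mult[OF assms Suc]]) (auto simp: algebra_simps)
qed

section \<open>Volterra integral equations\<close>

text \<open>Neumann series: by \<open>bound\<close> the n-th iterate is at most c w^n / n!, so the
  series is dominated by c e^w. Stating this over an arbitrary sigma-finite measure lets it serve
  both the initial value problem on the line and the Marchenko equation in the plane.\<close>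

lemma volterra_solution:
  fixes k :: "'a \<Rightarrow> 'a \<Rightarrow> real"
  assumes "sigma_finite_measure M"
    and [measurable]: "case_prod k \<in> borel_measurable (M \<Otimes>\<^sub>M M)"
      "f0 \<in> borel_measurable M" "c \<in> borel_measurable M" "w \<in> borel_measurable M"
    and c: "\<And>x. x \<in> space M \<Longrightarrow> 0 \<le> c x" and w: "\<And>x. x \<in> space M \<Longrightarrow> 0 \<le> w x"
    and f0: "\<And>x. x \<in> space M \<Longrightarrow> \<bar>f0 x\<bar> \<le> c x"
    and int: "\<And>x. x \<in> space M \<Longrightarrow> integrable M (\<lambda>t. k x t * (c t * exp (w t)))"
    and bound: "\<And>n x. x \<in> space M \<Longrightarrow>
      (\<integral>t. \<bar>k x t\<bar> * (c t * w t ^ n) \<partial>M) \<le> c x * w x ^ Suc n / real (Suc n)"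
  obtains f where "f \<in> borel_measurable M"
    and "\<And>x. x \<in> space M \<Longrightarrow> \<bar>f x\<bar> \<le> c x * exp (w x)"
    and "\<And>x. x \<in> space M \<Longrightarrow> integrable M (\<lambda>t. k x t * f t)"
    and "\<And>x. x \<in> space M \<Longrightarrow> f x = f0 x + (\<integral>t. k x t * f t \<partial>M)"
proof -
  interpret sigma_finite_measure M by fact
  define F where "F = rec_nat f0 (\<lambda>_ g x. \<integral>t. k x t * g t \<partial>M)"
  have F0: "F 0 = f0" and FS: "F (Suc n) = (\<lambda>x. \<integral>t. k x t * F n t \<partial>M)" for n
    by (simp_all add: F_def)
  have Fm [measurable]: "F n \<in> borel_measurable M" for n
    by (induction n) (simp_all add: F0 FS)
  \<comment> \<open>This makes the single integrability assumption \<open>int\<close>, with weight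
    e^w, cover all the powers w^n.\<close>
  have exp_ge: "y ^ n / fact n \<le> exp y" if "0 \<le> y" for y :: real and n
    using sum_le_suminf[OF summable_exp_generic[of y], of "{n}"] that
    by (auto simp: exp_def scaleR_conv_of_real divide_inverse mult.commute)
  have intn: "integrable M (\<lambda>t. \<bar>k x t\<bar> * (c t * w t ^ n))" if x: "x \<in> space M" for x n
  proof (rule Bochner_Integration.integrable_bound)
    show "integrable M (\<lambda>t. fact n * (k x t * (c t * exp (w t))))"
      using int[OF x] by simp
    show "(\<lambda>t. \<bar>k x t\<bar> * (c t * w t ^ n)) \<in> borel_measurable M"
      using x by measurable
    show "AE t in M. norm (\<bar>k x t\<bar> * (c t * w t ^ n)) \<le> norm (fact n * (k x t * (c t * exp (w t))))"
    proof (rule AE_I2)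
      fix t assume t: "t \<in> space M"
      have "w t ^ n \<le> fact n * exp (w t)"
        using exp_ge[OF w[OF t], of n] by (simp add: field_simps)
      hence "\<bar>k x t\<bar> * c t * w t ^ n \<le> \<bar>k x t\<bar> * c t * (fact n * exp (w t))"
        using c[OF t] by (intro mult_left_mono) auto
      thus "norm (\<bar>k x t\<bar> * (c t * w t ^ n)) \<le> norm (fact n * (k x t * (c t * exp (w t))))"
        using c[OF t] w[OF t] by (simp add: abs_mult mult_ac)
    qed
  qed
  have Fb: "\<bar>F n x\<bar> \<le> c x * w x ^ n / fact n" if "x \<in> space M" for n x
    using that
  proof (induction n arbitrary: x)
    case 0
    thus ?case using f0 by (simp add: F0)
  next
    case (Suc n)
    have b: "\<bar>k x t * F n t\<bar> \<le> \<bar>k x t\<bar> * (c t * w t ^ n) / fact n" if "t \<in> space M" for t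
      using mult_left_mono[OF Suc.IH[OF that], of "\<bar>k x t\<bar>"] by (simp add: abs_mult)
    have int_n: "integrable M (\<lambda>t. \<bar>k x t\<bar> * (c t * w t ^ n) / fact n)"
      using intn[OF Suc.prems, of n] by simp
    have kint: "integrable M (\<lambda>t. k x t * F n t)"
      by (rule Bochner_Integration.integrable_bound[OF int_n])
         (use b Suc.prems c w in \<open>auto simp: abs_mult\<close>)
    have "\<bar>F (Suc n) x\<bar> \<le> (\<integral>t. \<bar>k x t * F n t\<bar> \<partial>M)"
      unfolding FS using integral_norm_bound[of M "\<lambda>t. k x t * F n t"] by simp
    also have "\<dots> \<le> (\<integral>t. \<bar>k x t\<bar> * (c t * w t ^ n) / fact n \<partial>M)"
      using kint int_n b by (intro integral_mono) auto
    also have "\<dots> \<le> (c x * w x ^ Suc n / real (Suc n)) / fact n"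
      using divide_right_mono[OF bound[OF Suc.prems, of n], of "fact n"] by simp
    finally show ?case by (simp add: field_simps)
  qed
  have kF: "integrable M (\<lambda>t. k x t * F n t)" if "x \<in> space M" for n x
  proof (rule Bochner_Integration.integrable_bound[OF integrable_divide[OF intn[OF that, of n], of "fact n"]])
    show "AE t in M. norm (k x t * F n t) \<le> norm (\<bar>k x t\<bar> * (c t * w t ^ n) / fact n)"
    proof (rule AE_I2)
      fix t assume "t \<in> space M"
      thus "norm (k x t * F n t) \<le> norm (\<bar>k x t\<bar> * (c t * w t ^ n) / fact n)"
        using mult_left_mono[OF Fb[of t n], of "\<bar>k x t\<bar>"] c w by (auto simp: abs_mult)
    qed
  qed (use that in measurable)
  have expsum: "(\<lambda>n. y * z ^ n / fact n) sums (y * exp z)" for y z :: real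
    using sums_mult[OF exp_converges[of z], of y] by (simp add: divide_inverse mult_ac)
  have sumF: "summable (\<lambda>n. \<bar>F n x\<bar>)" if "x \<in> space M" for x
    by (rule summable_comparison_test'[OF sums_summable[OF expsum[of "c x" "w x"]], of 0])
       (use Fb[OF that] in auto)
  define f where "f x = (\<Sum>n. F n x)" for x
  have fm [measurable]: "f \<in> borel_measurable M"
    unfolding f_def by measurable
  have fb: "\<bar>f x\<bar> \<le> c x * exp (w x)" if "x \<in> space M" for x
  proof -
    have "\<bar>f x\<bar> \<le> (\<Sum>n. \<bar>F n x\<bar>)"
      unfolding f_def by (rule summable_rabs[OF sumF[OF that]])
    also have "\<dots> \<le> (\<Sum>n. c x * w x ^ n / fact n)"
      by (rule suminf_le[OF Fb[OF that] sumF[OF that] sums_summable[OF expsum]])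
    finally show ?thesis using sums_unique[OF expsum] by simp
  qed
  have kf: "integrable M (\<lambda>t. k x t * f t)" if x: "x \<in> space M" for x
  proof (rule Bochner_Integration.integrable_bound[OF int[OF x]])
    show "AE t in M. norm (k x t * f t) \<le> norm (k x t * (c t * exp (w t)))"
    proof (rule AE_I2)
      fix t assume "t \<in> space M"
      thus "norm (k x t * f t) \<le> norm (k x t * (c t * exp (w t)))"
        using mult_left_mono[OF fb[of t], of "\<bar>k x t\<bar>"] c by (auto simp: abs_mult)
    qed
  qed (use x in measurable)
  have "f x = f0 x + (\<integral>t. k x t * f t \<partial>M)" if x: "x \<in> space M" for x
  proof -
    have "(\<integral>t. k x t * f t \<partial>M) = (\<integral>t. (\<Sum>n. k x t * F n t) \<partial>M)"
      using sumF by (intro Bochner_Integration.integral_cong)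
        (auto simp: f_def suminf_mult summable_rabs_cancel)
    \<comment> \<open>Sum and integral may be exchanged because the L1 norms of the terms are again
      dominated by the shifted exponential series.\<close>
    also have "\<dots> = (\<Sum>n. \<integral>t. k x t * F n t \<partial>M)"
    proof (rule integral_suminf)
      show "integrable M (\<lambda>t. k x t * F n t)" for n by (rule kF[OF x])
      show "AE t in M. summable (\<lambda>n. norm (k x t * F n t))"
        using sumF by (intro AE_I2) (auto simp: abs_mult intro!: summable_mult)
      show "summable (\<lambda>n. \<integral>t. norm (k x t * F n t) \<partial>M)"
      proof (rule summable_comparison_test'[of _ 0])
        show "summable (\<lambda>n. c x * w x ^ Suc n / fact (Suc n))"
          using sums_summable[OF expsum[of "c x" "w x"]] by (subst summable_Suc_iff)
        fix n :: nat
        have "(\<integral>t. norm (k x t * F n t) \<partial>M) \<le> (\<integral>t. \<bar>k x t\<bar> * (c t * w t ^ n) / fact n \<partial>M)"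
        proof (rule integral_mono)
          show "norm (k x t * F n t) \<le> \<bar>k x t\<bar> * (c t * w t ^ n) / fact n" if "t \<in> space M" for t
            using mult_left_mono[OF Fb[OF that, of n], of "\<bar>k x t\<bar>"] by (simp add: abs_mult)
        qed (use kF[OF x] intn[OF x] in auto)
        also have "\<dots> \<le> (c x * w x ^ Suc n / real (Suc n)) / fact n"
          using divide_right_mono[OF bound[OF x, of n], of "fact n"] by simp
        finally show "norm (\<integral>t. norm (k x t * F n t) \<partial>M) \<le> c x * w x ^ Suc n / fact (Suc n)"
          by (simp add: field_simps)
      qed
    qed
    also have "\<dots> = (\<Sum>n. F (Suc n) x)" by (simp add: FS)
    also have "\<dots> = f x - f0 x"
      using suminf_minus_initial_segment[OF summable_rabs_cancel[OF sumF[OF x]], of 1]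
      by (simp add: f_def F0)
    finally show ?thesis by simp
  qed
  with fm fb kf show ?thesis by (rule that)
qed

section \<open>Initial value problems for u'' = p u\<close>

lemma set_integral_at_point:
  fixes f :: "real \<Rightarrow> real"
  shows "(LBINT t:{x}. f t) = 0"
proof -
  have "(LBINT t:{x}. f t) = (LBINT t::real. (0::real))"
    unfolding set_lebesgue_integral_def
  proof (rule integral_cong_AE)
    have "(\<lambda>t. indicator {x} t *\<^sub>R f t) = (\<lambda>t. if t = x then f x else 0)"
      by auto
    thus "(\<lambda>t. indicator {x} t *\<^sub>R f t) \<in> borel_measurable lborel"
      by simp
    show "AE t in lborel. indicator {x} t *\<^sub>R f t = 0"
      using AE_lborel_singleton[of x] by eventually_elim (auto simp: indicator_def)
  qed auto
  thus ?thesis by simp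
qed

lemma ac_on_primitive:
  assumes "set_integrable lborel {0..X} d"
  shows "ac_on X (\<lambda>x. c + (LBINT t:{0..x}. d t)) d"
  using assms by (intro ac_onI) (auto simp: set_integral_at_point)

lemma set_integrable_bounded:
  fixes f g :: "real \<Rightarrow> real"
  assumes "set_integrable lborel A f" "f \<in> borel_measurable borel" "g \<in> borel_measurable borel" "A \<in> sets borel"
    and "\<And>t. t \<in> A \<Longrightarrow> \<bar>g t\<bar> \<le> M"
  shows "set_integrable lborel A (\<lambda>t. f t * g t)"
  unfolding set_integrable_def
proof (rule Bochner_Integration.integrable_bound)
  show "integrable lborel (\<lambda>t. M * (indicator A t *\<^sub>R f t))"
    using assms(1) by (intro integrable_mult_right) (simp add: set_integrable_def)
  show "(\<lambda>t. indicator A t *\<^sub>R (f t * g t)) \<in> borel_measurable lborel"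
    using assms(2-4) by measurable
  show "AE t in lborel. norm (indicator A t *\<^sub>R (f t * g t)) \<le> norm (M * (indicator A t *\<^sub>R f t))"
  proof (rule AE_I2)
    fix t
    show "norm (indicator A t *\<^sub>R (f t * g t)) \<le> norm (M * (indicator A t *\<^sub>R f t))"
      using mult_right_mono[OF assms(5)[of t], of "\<bar>f t\<bar>"] assms(5)[of t]
      by (cases "t \<in> A") (auto simp: abs_mult mult.commute)
  qed
qed

lemma set_integral_nonneg_mono:
  fixes d :: "real \<Rightarrow> real"
  assumes "\<And>X. set_integrable lborel {0..X} d" "\<And>t. 0 \<le> d t" "x \<le> y"
  shows "(LBINT t:{0..x}. d t) \<le> (LBINT t:{0..y}. d t)"
  unfolding set_lebesgue_integral_def
  by (rule integral_mono)
     (use assms in \<open>auto simp: set_integrable_def indicator_def intro: order_trans\<close>)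

text \<open>The equation is integrated twice: u(x) = \<alpha> + \<beta> x + integral_0^x (x - t)
  p(t) u(t) dt. The explicit bound comes out of the series, and its exponent x times the integral of
  |p| matters later: for p = q + \<kappa>^2 it stays bounded at x = 1/\<kappa>.\<close>

lemma ivp_exists:
  fixes p :: "real \<Rightarrow> real"
  assumes [measurable]: "p \<in> borel_measurable borel"
    and p: "\<And>X. set_integrable lborel {0..X} p"
  obtains u v where "\<And>X. ac_on X u v" "\<And>X. ac_on X v (\<lambda>x. p x * u x)"
    "u 0 = \<alpha>" "v 0 = \<beta>"
    "\<And>x. 0 \<le> x \<Longrightarrow> \<bar>u x\<bar> \<le> (\<bar>\<alpha>\<bar> + \<bar>\<beta>\<bar> * x) * exp (x * (LBINT t:{0..x}. \<bar>p t\<bar>))"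
proof -
  define P where "P x = (LBINT t:{0..x}. \<bar>p t\<bar>)" for x
  \<comment> \<open>The Volterra lemma works on all of the line; \<open>m\<close> freezes the data
    at their value at 0 for negative arguments, where the kernel vanishes.\<close>
  define m where "m x = max x (0::real)" for x
  define w where "w x = m x * P x" for x
  define c where "c x = \<bar>\<alpha>\<bar> + \<bar>\<beta>\<bar> * m x" for x
  define k where "k x t = (if 0 \<le> t \<and> t \<le> x then (x - t) * p t else 0)" for x t
  have ap: "set_integrable lborel {0..X} (\<lambda>t. \<bar>p t\<bar>)" for X
    using set_integrable_abs[OF p[of X]] .
  have Pmono: "P x \<le> P y" if "x \<le> y" for x y
    unfolding P_def by (rule set_integral_nonneg_mono) (use ap that in auto)
  have P0: "0 \<le> P x" for x
    unfolding P_def set_lebesgue_integral_def by (intro integral_nonneg_AE) auto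
  have [measurable]: "P \<in> borel_measurable borel"
    by (rule borel_measurable_mono) (auto simp: mono_def Pmono)
  have [measurable]: "m \<in> borel_measurable borel"
    unfolding m_def by measurable
  have [measurable]: "w \<in> borel_measurable borel" "c \<in> borel_measurable borel"
    unfolding w_def c_def by measurable
  have m0: "0 \<le> m x" and m_mono: "x \<le> y \<Longrightarrow> m x \<le> m y" for x y
    by (auto simp: m_def)
  have c0: "0 \<le> c x" and c_mono: "x \<le> y \<Longrightarrow> c x \<le> c y" for x y
    using m0 m_mono by (auto simp: c_def intro!: mult_left_mono)
  have w0: "0 \<le> w x" and w_mono: "x \<le> y \<Longrightarrow> w x \<le> w y" for x y
    using m0 m_mono P0 Pmono by (auto simp: w_def intro!: mult_mono)
  have [measurable]: "case_prod k \<in> borel_measurable (lborel \<Otimes>\<^sub>M lborel)"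
    unfolding k_def by measurable
  obtain u where um: "u \<in> borel_measurable lborel"
    and ub: "\<And>x. \<bar>u x\<bar> \<le> c x * exp (w x)"
    and uk: "\<And>x. integrable lborel (\<lambda>t. k x t * u t)"
    and ueq: "\<And>x. u x = (\<alpha> + \<beta> * m x) + (LBINT t. k x t * u t)"
  proof (rule volterra_solution[of lborel k "\<lambda>x. \<alpha> + \<beta> * m x" c w])
    show "\<bar>\<alpha> + \<beta> * m x\<bar> \<le> c x" for x
      using m0[of x] abs_triangle_ineq[of \<alpha> "\<beta> * m x"] by (simp add: c_def abs_mult)
    show "integrable lborel (\<lambda>t. k x t * (c t * exp (w t)))" for x
    proof -
      have "set_integrable lborel {0..x} (\<lambda>t. p t * ((x - t) * (c t * exp (w t))))"
      proof (rule set_integrable_bounded[OF p])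
        fix t assume t: "t \<in> {0..x}"
        have "(x - t) * (c t * exp (w t)) \<le> x * (c x * exp (w x))"
          using t c_mono[of t x] w_mono[of t x] c0 by (intro mult_mono) auto
        moreover have "0 \<le> (x - t) * (c t * exp (w t))"
          using t c0 by auto
        ultimately show "\<bar>(x - t) * (c t * exp (w t))\<bar> \<le> x * (c x * exp (w x))" by simp
      qed auto
      thus ?thesis
        unfolding set_integrable_def
        by (rule back_subst[of "integrable lborel"]) (auto simp: k_def indicator_def mult_ac)
    qed
    show "(LBINT t. \<bar>k x t\<bar> * (c t * w t ^ n)) \<le> c x * w x ^ Suc n / real (Suc n)" for n x
    proof (cases "0 \<le> x")
      case False
      hence "(\<lambda>t. \<bar>k x t\<bar> * (c t * w t ^ n)) = (\<lambda>t. 0)"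
        by (auto simp: k_def)
      thus ?thesis using c0 w0 by simp
    next
      case x: True
      have ac: "ac_on x P (\<lambda>t. \<bar>p t\<bar>)"
        using ac_on_primitive[OF ap, of x 0] by (simp add: P_def[abs_def])
      \<comment> \<open>Bounding the factors x - t, c(t) and t^n by their values at the right end
        leaves |p| P^n, which is the density of P^(n+1) / (n+1); this is the source of the
        factorials.\<close>
      have acn: "ac_on x (\<lambda>t. P t ^ Suc n) (\<lambda>t. real (Suc n) * \<bar>p t\<bar> * P t ^ n)"
        by (rule ac_on_power[OF ac])
      have "P 0 = 0" by (simp add: P_def set_integral_at_point)
      hence eq: "(LBINT t:{0..x}. real (Suc n) * \<bar>p t\<bar> * P t ^ n) = P x ^ Suc n"
        using ac_onD[OF acn, of x] x by simp
      have i1: "integrable lborel (\<lambda>t. indicator {0..x} t *\<^sub>R (real (Suc n) * \<bar>p t\<bar> * P t ^ n))"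
        using ac_on_integrable[OF acn] by (simp add: set_integrable_def)
      have b: "\<bar>k x t\<bar> * (c t * w t ^ n)
          \<le> (c x * x ^ Suc n / real (Suc n)) * (indicator {0..x} t *\<^sub>R (real (Suc n) * \<bar>p t\<bar> * P t ^ n))" for t
      proof (cases "t \<in> {0..x}")
        case t: True
        have "\<bar>k x t\<bar> * (c t * w t ^ n) = ((x - t) * c t * t ^ n) * (\<bar>p t\<bar> * P t ^ n)"
          using t by (simp add: k_def w_def m_def abs_mult power_mult_distrib)
        also have "\<dots> \<le> (x * c x * x ^ n) * (\<bar>p t\<bar> * P t ^ n)"
          using t c0 c_mono[of t x] P0 by (intro mult_right_mono mult_mono power_mono) auto
        finally show ?thesis using t by (simp add: mult_ac)
      qed (auto simp: k_def)
      have "(LBINT t. \<bar>k x t\<bar> * (c t * w t ^ n))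
          \<le> (LBINT t. (c x * x ^ Suc n / real (Suc n)) * (indicator {0..x} t *\<^sub>R (real (Suc n) * \<bar>p t\<bar> * P t ^ n)))"
      proof (rule integral_mono')
        show "0 \<le> (c x * x ^ Suc n / real (Suc n)) * (indicator {0..x} t *\<^sub>R (real (Suc n) * \<bar>p t\<bar> * P t ^ n))" for t
          using c0 x P0 by (auto intro!: mult_nonneg_nonneg)
        show "integrable lborel (\<lambda>t. (c x * x ^ Suc n / real (Suc n)) * (indicator {0..x} t *\<^sub>R (real (Suc n) * \<bar>p t\<bar> * P t ^ n)))"
          by (rule integrable_mult_right[OF i1])
      qed (rule b)
      also have "\<dots> = (c x * x ^ Suc n / real (Suc n)) * P x ^ Suc n"
        unfolding integral_mult_right_zero eq[unfolded set_lebesgue_integral_def] ..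
      also have "\<dots> = c x * w x ^ Suc n / real (Suc n)"
        using x by (simp add: w_def m_def power_mult_distrib)
      finally show ?thesis .
    qed
    fix f
    assume f: "f \<in> borel_measurable lborel"
      "\<And>x. x \<in> space lborel \<Longrightarrow> \<bar>f x\<bar> \<le> c x * exp (w x)"
      "\<And>x. x \<in> space lborel \<Longrightarrow> integrable lborel (\<lambda>t. k x t * f t)"
      "\<And>x. x \<in> space lborel \<Longrightarrow> f x = (\<alpha> + \<beta> * m x) + (LBINT t. k x t * f t)"
    have sp: "x \<in> space lborel" for x :: real by simp
    show thesis
      by (rule that[OF f(1) f(2)[OF sp] f(3)[OF sp] f(4)[OF sp]])
  next
    show "sigma_finite_measure (lborel :: real measure)"
      by (rule lborel.sigma_finite_measure_axioms)
    show "case_prod k \<in> borel_measurable (lborel \<Otimes>\<^sub>M lborel)" by fact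
    show "(\<lambda>x. \<alpha> + \<beta> * m x) \<in> borel_measurable lborel" by measurable
    show "c \<in> borel_measurable lborel" "w \<in> borel_measurable lborel" by measurable
    show "0 \<le> c x" "0 \<le> w x" for x by (fact c0 w0)+
  qed
  have [measurable]: "u \<in> borel_measurable borel" using um by simp
  have pu: "set_integrable lborel {0..X} (\<lambda>t. p t * u t)" for X
  proof (rule set_integrable_bounded[OF p])
    fix t assume "t \<in> {0..X}"
    hence "c t * exp (w t) \<le> c X * exp (w X)"
      using c0 c_mono w_mono by (intro mult_mono) auto
    thus "\<bar>u t\<bar> \<le> c X * exp (w X)" using ub[of t] by simp
  qed auto
  define H where "H x = (LBINT t:{0..x}. p t * u t)" for x
  define v where "v x = \<beta> + H x" for x
  have acH: "ac_on X H (\<lambda>x. p x * u x)" for X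
    using ac_on_primitive[OF pu, of X 0] by (simp add: H_def[abs_def])
  have tpu: "set_integrable lborel {0..X} (\<lambda>t. t * (p t * u t))" for X
    using set_integrable_mult_continuous[OF pu[of X] continuous_on_id] by (simp add: mult_ac)
  have id: "ac_on X (\<lambda>x. x) (\<lambda>_. 1)" for X
    by (rule ac_on_C1) (auto intro!: derivative_eq_intros)
  \<comment> \<open>The kernel x - t depends on x. Splitting the integral into x H(x) minus the
    integral of t p u makes the product rule applicable, and the two terms x p u cancel.\<close>
  have "ac_on X u v" for X
  proof (rule ac_on_cong)
    show "ac_on X (\<lambda>x. (\<alpha> + \<beta> * x) + (x * H x - (0 + (LBINT t:{0..x}. t * (p t * u t)))))
       (\<lambda>x. (0 + \<beta> * 1) + ((1 * H x + x * (p x * u x)) - x * (p x * u x)))"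
      by (intro ac_on_add ac_on_diff ac_on_mult ac_on_cmult ac_on_const id acH ac_on_primitive tpu)
    fix x assume x: "x \<in> {0..X}"
    show "(\<alpha> + \<beta> * x) + (x * H x - (0 + (LBINT t:{0..x}. t * (p t * u t)))) = u x"
    proof -
      have "(LBINT t. k x t * u t) = (LBINT t:{0..x}. x * (p t * u t) - t * (p t * u t))"
        unfolding set_lebesgue_integral_def
        by (intro Bochner_Integration.integral_cong) (auto simp: k_def indicator_def algebra_simps)
      also have "\<dots> = x * H x - (LBINT t:{0..x}. t * (p t * u t))"
        using pu[of x] tpu[of x] by (subst set_integral_diff) (auto simp: H_def)
      finally show ?thesis using ueq[of x] x by (simp add: m_def)
    qed
  qed (auto simp: v_def)
  moreover have "ac_on X v (\<lambda>x. p x * u x)" for X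
    using ac_on_add[OF ac_on_const acH, of X \<beta>] by (simp add: v_def[abs_def])
  moreover have "u 0 = \<alpha>"
  proof -
    have "(\<lambda>t. k 0 t * u t) = (\<lambda>t. 0)"
      by (auto simp: k_def)
    thus ?thesis using ueq[of 0] by (simp add: m_def)
  qed
  moreover have "v 0 = \<beta>" by (simp add: v_def H_def set_integral_at_point)
  moreover have "\<bar>u x\<bar> \<le> (\<bar>\<alpha>\<bar> + \<bar>\<beta>\<bar> * x) * exp (x * (LBINT t:{0..x}. \<bar>p t\<bar>))" if "0 \<le> x" for x
    using ub[of x] that by (simp add: c_def w_def m_def P_def)
  ultimately show ?thesis by (rule that)
qed

section \<open>Uniqueness for finite Laplace transforms\<close>

text \<open>The positive and the negative part of R are densities of finite measures. If all
  primitives vanish, these measures agree on every half-line, hence are equal, and densities are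
  unique almost everywhere.\<close>

lemma density_zero_of_primitive_zero:
  fixes R :: "real \<Rightarrow> real"
  assumes [measurable]: "R \<in> borel_measurable borel" and R: "set_integrable lborel {0..a} R"
    and zero: "\<And>x. x \<in> {0..a} \<Longrightarrow> (LBINT t:{0..x}. R t) = 0"
  shows "AE x in lborel. x \<in> {0..a} \<longrightarrow> R x = 0"
proof (cases "0 \<le> a")
  case a: True
  \<comment> \<open>For s = 1 and s = -1 these are the positive and the negative part of R on
    [0, a].\<close>
  define f where "f s x = indicator {0..a} x * max (s * R x) 0" for s x :: real
  have [measurable]: "f s \<in> borel_measurable borel" for s
    unfolding f_def by measurable
  have fnn: "0 \<le> f s x" for s x by (simp add: f_def)
  have fint: "integrable lborel (f s)" for s
  proof (rule Bochner_Integration.integrable_bound)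
    show "integrable lborel (\<lambda>x. s * (indicator {0..a} x *\<^sub>R R x))"
      using R by (intro integrable_mult_right) (simp add: set_integrable_def)
  qed (auto simp: f_def indicator_def)
  have fint': "integrable lborel (\<lambda>x. indicator {y<..} x * f s x)" for y s
    by (rule Bochner_Integration.integrable_bound[OF fint[of s]]) (auto simp: indicator_def)
  have em: "emeasure (density lborel (f s)) {y<..} = ennreal (LBINT x. indicator {y<..} x * f s x)" for s y
  proof -
    have "emeasure (density lborel (f s)) {y<..} = (\<integral>\<^sup>+x. ennreal (f s x) * indicator {y<..} x \<partial>lborel)"
      by (intro emeasure_density) auto
    also have "\<dots> = (\<integral>\<^sup>+x. ennreal (indicator {y<..} x * f s x) \<partial>lborel)"
      by (intro nn_integral_cong) (auto simp: indicator_def)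
    also have "\<dots> = ennreal (LBINT x. indicator {y<..} x * f s x)"
      by (intro nn_integral_eq_integral fint') (simp add: fnn)
    finally show ?thesis .
  qed
  have Rint: "set_integrable lborel A R" if "A \<subseteq> {0..a}" "A \<in> sets borel" for A
    using set_integrable_subset[OF R _ that(1)] that(2) by simp
  have tail: "(LBINT x. indicator ({y<..} \<inter> {0..a}) x * R x) = 0" for y
  proof -
    consider "y < 0" | "0 \<le> y" "y < a" | "a \<le> y" by linarith
    thus ?thesis
    proof cases
      case 1
      hence "{y<..} \<inter> {0..a} = {0..a}" by auto
      thus ?thesis using zero[of a] a by (simp add: set_lebesgue_integral_def)
    next
      case 2
      have "(LBINT t:{0..y} \<union> {y<..a}. R t) = (LBINT t:{0..y}. R t) + (LBINT t:{y<..a}. R t)"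
      proof (rule set_integral_Un)
        show "set_integrable lborel {0..y} R" by (rule Rint) (use 2 in auto)
        show "set_integrable lborel {y<..a} R" by (rule Rint) (use 2 in auto)
      qed (use 2 in auto)
      moreover have "{0..y} \<union> {y<..a} = {0..a}" "{y<..} \<inter> {0..a} = {y<..a}" using 2 by auto
      ultimately show ?thesis using zero[of a] zero[of y] 2 by (simp add: set_lebesgue_integral_def)
    next
      case 3
      hence "{y<..} \<inter> {0..a} = {}" by auto
      thus ?thesis by simp
    qed
  qed
  have "density lborel (f 1) = density lborel (f (-1))"
  proof (rule measure_eqI_lessThan)
    fix y :: real
    have "(LBINT x. indicator {y<..} x * f 1 x) - (LBINT x. indicator {y<..} x * f (-1) x)
        = (LBINT x. indicator {y<..} x * f 1 x - indicator {y<..} x * f (-1) x)"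
      by (rule Bochner_Integration.integral_diff[symmetric, OF fint' fint'])
    also have "\<dots> = (LBINT x. indicator ({y<..} \<inter> {0..a}) x * R x)"
      by (intro Bochner_Integration.integral_cong) (auto simp: f_def indicator_def)
    finally show "emeasure (density lborel (f 1)) {y<..} = emeasure (density lborel (f (-1))) {y<..}"
      using tail[of y] unfolding em by simp
    show "emeasure (density lborel (f 1)) {y<..} < \<infinity>"
      unfolding em by simp
  qed auto
  hence "AE x in lborel. ennreal (f 1 x) = ennreal (f (-1) x)"
    using sigma_finite_measure.density_unique_iff[OF lborel.sigma_finite_measure_axioms,
      of "\<lambda>x. ennreal (f 1 x)" "\<lambda>x. ennreal (f (-1) x)"] by simp
  thus ?thesis
  proof eventually_elim
    case (elim x)
    hence "f 1 x = f (-1) x" using fnn by (simp add: ennreal_inj)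
    thus ?case by (auto simp: f_def max_def split: if_splits)
  qed
qed auto

lemma exp_minus_one_sums: "(\<lambda>k. x ^ Suc k / fact (Suc k)) sums (exp x - 1)" for x :: real
  using exp_converges[of x] by (subst sums_Suc_iff) (simp add: divide_inverse mult.commute)

text \<open>
  The functions \<open>1 - exp (- exp (2 n (a - y - t)))\<close> approximate the indicator of \<open>{..a - t}\<close> and
  their power series only involves the Laplace transform of \<open>P\<close> at the points \<open>n, 2 n, 3 n, \<dots>\<close>.
\<close>

lemma laplace_uniqueness:
  fixes P :: "real \<Rightarrow> real"
  assumes Pm [measurable]: "P \<in> borel_measurable borel" and P: "set_integrable lborel {0..a} P"
    and bound: "\<And>\<epsilon>. 0 < \<epsilon> \<Longrightarrow>
      \<exists>C \<kappa>0. \<forall>\<kappa>\<ge>\<kappa>0. \<bar>LBINT y:{0..a}. P y * exp (2 * \<kappa> * (a - y))\<bar> \<le> C * exp (\<epsilon> * \<kappa>)"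
  shows "AE y in lborel. y \<in> {0..a} \<longrightarrow> P y = 0"
proof (rule density_zero_of_primitive_zero[OF Pm P])
  have inner: "(LBINT y:{0..a - t}. P y) = 0" if t: "0 < t" "t < a" for t
  proof -
    \<comment> \<open>The rate is taken to be t itself. At the point (k+1) n the bound grows like
      e^(t n (k+1)), while the coefficient of the series contributes e^(-2 t n (k+1)); so the k-th
      term is at most C e^(-t n (k+1)) / (k+1)!, and the sum tends to 0.\<close>
    obtain C \<kappa>0 where C: "\<And>\<kappa>. \<kappa>0 \<le> \<kappa> \<Longrightarrow> \<bar>LBINT y:{0..a}. P y * exp (2 * \<kappa> * (a - y))\<bar> \<le> C * exp (t * \<kappa>)"
      using bound[OF t(1)] by auto
    define E where "E n y = exp (2 * real n * (a - y - t))" for n y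
    define D where "D n = (LBINT y. indicator {0..a} y * P y * (exp (- E n y) - 1))" for n
    have Ebound: "E n y \<le> exp (2 * real n * a)" if "y \<in> {0..a}" for n y
      using that t by (auto simp: E_def intro!: mult_left_mono)
    have Pint: "integrable lborel (\<lambda>y. indicator {0..a} y * \<bar>P y\<bar>)"
      using set_integrable_abs[OF P] by (simp add: set_integrable_def)
    have Dbound: "\<bar>D n\<bar> \<le> C * (exp (exp (- real n * t)) - 1)" if n: "max \<kappa>0 1 \<le> real n" for n
    proof -
      \<comment> \<open>Terms of the power series of e^(-E) - 1. Subtracting 1 removes the constant
        term, so that only positive multiples of n occur as arguments of the transform.\<close>
      define g where "g k y = indicator {0..a} y * P y * ((- E n y) ^ Suc k / fact (Suc k))" for k y
      have gint: "integrable lborel (g k)" for k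
      proof -
        have "set_integrable lborel {0..a} (\<lambda>y. P y * ((- E n y) ^ Suc k / fact (Suc k)))"
          unfolding E_def by (intro set_integrable_mult_continuous P continuous_intros) auto
        thus ?thesis by (simp add: set_integrable_def g_def[abs_def] mult.assoc)
      qed
      have gval: "(LBINT y. g k y) = (- exp (- 2 * (real n * t))) ^ Suc k / fact (Suc k)
          * (LBINT y:{0..a}. P y * exp (2 * (real (Suc k) * real n) * (a - y)))" for k
        unfolding set_lebesgue_integral_def integral_mult_right_zero[symmetric]
      proof (rule Bochner_Integration.integral_cong)
        fix y
        have "E n y = exp (- 2 * (real n * t)) * exp (2 * real n * (a - y))"
          by (simp add: E_def exp_add[symmetric] algebra_simps)
        hence "(- E n y) ^ Suc k = (- exp (- 2 * (real n * t))) ^ Suc k * exp (2 * real n * (a - y)) ^ Suc k"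
          by (simp only: power_mult_distrib[symmetric] mult_minus_left)
        also have "exp (2 * real n * (a - y)) ^ Suc k = exp (2 * (real (Suc k) * real n) * (a - y))"
          unfolding exp_of_nat_mult[symmetric] by (simp add: algebra_simps)
        finally show "g k y = (- exp (- 2 * (real n * t))) ^ Suc k / fact (Suc k)
            * indicator {0..a} y *\<^sub>R (P y * exp (2 * (real (Suc k) * real n) * (a - y)))"
          by (simp add: g_def mult_ac)
      qed simp
      have gle: "\<bar>LBINT y. g k y\<bar> \<le> C * (exp (- real n * t) ^ Suc k / fact (Suc k))" for k
      proof -
        have "1 * real n \<le> real (Suc k) * real n" by (intro mult_right_mono) auto
        hence "\<kappa>0 \<le> real (Suc k) * real n" using n by linarith
        from C[OF this]
        have "\<bar>LBINT y. g k y\<bar> \<le> exp (- 2 * (real n * t)) ^ Suc k / fact (Suc k) * (C * exp (t * (real (Suc k) * real n)))"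
          unfolding gval abs_mult by (intro mult_mono) (auto simp: power_abs abs_mult)
        also have "exp (t * (real (Suc k) * real n)) = exp (real n * t) ^ Suc k"
          unfolding exp_of_nat_mult[symmetric] by (simp add: mult_ac)
        also have "exp (- 2 * (real n * t)) ^ Suc k / fact (Suc k) * (C * exp (real n * t) ^ Suc k)
            = C * ((exp (- 2 * (real n * t)) * exp (real n * t)) ^ Suc k / fact (Suc k))"
          unfolding power_mult_distrib by (simp add: mult_ac)
        also have "exp (- 2 * (real n * t)) * exp (real n * t) = exp (- real n * t)"
          by (simp add: exp_add[symmetric])
        finally show ?thesis .
      qed
      have "D n = (LBINT y. \<Sum>k. g k y)"
        unfolding D_def g_def using exp_minus_one_sums
        by (intro Bochner_Integration.integral_cong refl) (metis sums_mult sums_unique)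
      also have "\<dots> = (\<Sum>k. LBINT y. g k y)"
      proof (rule integral_suminf[OF gint])
        show "AE y in lborel. summable (\<lambda>k. norm (g k y))"
        proof (rule AE_I2)
          fix y
          have "norm (g k y) = indicator {0..a} y * \<bar>P y\<bar> * (E n y ^ Suc k / fact (Suc k))" for k
            by (simp add: g_def abs_mult power_abs E_def)
          thus "summable (\<lambda>k. norm (g k y))"
            using summable_mult[OF sums_summable[OF exp_minus_one_sums]] by presburger
        qed
        show "summable (\<lambda>k. LBINT y. norm (g k y))"
        proof (rule summable_comparison_test'[of _ 0])
          show "summable (\<lambda>k. (LBINT y. indicator {0..a} y * \<bar>P y\<bar>) * (exp (2 * real n * a) ^ Suc k / fact (Suc k)))"
            by (rule summable_mult[OF sums_summable[OF exp_minus_one_sums]])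
          fix k :: nat
          have "(LBINT y. norm (g k y)) \<le> (LBINT y. (indicator {0..a} y * \<bar>P y\<bar>) * (exp (2 * real n * a) ^ Suc k / fact (Suc k)))"
          proof (rule integral_mono)
            show "integrable lborel (\<lambda>y. norm (g k y))" using gint by simp
            show "integrable lborel (\<lambda>y. (indicator {0..a} y * \<bar>P y\<bar>) * (exp (2 * real n * a) ^ Suc k / fact (Suc k)))"
              by (rule integrable_mult_left[OF Pint])
            fix y
            have "norm (g k y) = indicator {0..a} y * \<bar>P y\<bar> * (E n y ^ Suc k / fact (Suc k))"
              by (simp add: g_def abs_mult power_abs E_def)
            also have "\<dots> \<le> (indicator {0..a} y * \<bar>P y\<bar>) * (exp (2 * real n * a) ^ Suc k / fact (Suc k))"
            proof (cases "y \<in> {0..a}")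
              case True
              have "E n y ^ Suc k \<le> exp (2 * real n * a) ^ Suc k"
                by (rule power_mono[OF Ebound[OF True]]) (simp add: E_def)
              thus ?thesis by (intro mult_left_mono divide_right_mono) auto
            qed simp
            finally show "norm (g k y) \<le> (indicator {0..a} y * \<bar>P y\<bar>) * (exp (2 * real n * a) ^ Suc k / fact (Suc k))" .
          qed
          also have "\<dots> = (LBINT y. indicator {0..a} y * \<bar>P y\<bar>) * (exp (2 * real n * a) ^ Suc k / fact (Suc k))"
            by (rule integral_mult_left_zero)
          finally show "norm (LBINT y. norm (g k y)) \<le> (LBINT y. indicator {0..a} y * \<bar>P y\<bar>) * (exp (2 * real n * a) ^ Suc k / fact (Suc k))"
            by simp
        qed
      qed
      finally have D: "D n = (\<Sum>k. LBINT y. g k y)" .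
      have S: "(\<lambda>k. C * (exp (- real n * t) ^ Suc k / fact (Suc k))) sums (C * (exp (exp (- real n * t)) - 1))"
        by (rule sums_mult[OF exp_minus_one_sums])
      have "summable (\<lambda>k. \<bar>LBINT y. g k y\<bar>)"
        by (rule summable_comparison_test'[OF sums_summable[OF S], of 0]) (use gle in auto)
      hence "\<bar>D n\<bar> \<le> (\<Sum>k. \<bar>LBINT y. g k y\<bar>)"
        unfolding D by (rule summable_rabs)
      also have "\<dots> \<le> (\<Sum>k. C * (exp (- real n * t) ^ Suc k / fact (Suc k)))"
        by (rule suminf_le[OF gle \<open>summable (\<lambda>k. \<bar>LBINT y. g k y\<bar>)\<close> sums_summable[OF S]])
      finally show ?thesis using sums_unique[OF S] by simp
    qed
    have "filterlim (\<lambda>n. - t * real n) at_bot sequentially"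
      using t by (intro filterlim_tendsto_neg_mult_at_bot[OF tendsto_const] filterlim_real_sequentially) auto
    hence mt: "filterlim (\<lambda>n. - real n * t) at_bot sequentially"
      by (simp add: mult.commute)
    have "(\<lambda>n. C * (exp (exp (- real n * t)) - 1)) \<longlonglongrightarrow> C * (exp 0 - 1)"
      by (intro tendsto_intros filterlim_compose[OF exp_at_bot mt])
    hence lim: "(\<lambda>n. C * (exp (exp (- real n * t)) - 1)) \<longlonglongrightarrow> 0" by simp
    have "D \<longlonglongrightarrow> 0"
    proof (rule Lim_null_comparison[OF _ lim])
      show "\<forall>\<^sub>F n in sequentially. norm (D n) \<le> C * (exp (exp (- real n * t)) - 1)"
        using eventually_ge_at_top[of "nat \<lceil>max \<kappa>0 1\<rceil>"]
      proof eventually_elim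
        case (elim n)
        hence "max \<kappa>0 1 \<le> real n" by linarith
        thus ?case using Dbound[of n] by simp
      qed
    qed
    \<comment> \<open>For y < a - t the argument E tends to infinity and the factor e^(-E) - 1 to
      -1; for y > a - t both E and the factor tend to 0. The point y = a - t is null, and |P| is a
      dominating function.\<close>
    moreover have "D \<longlonglongrightarrow> (LBINT y. - (indicator {0..a - t} y * P y))"
      unfolding D_def
    proof (rule integral_dominated_convergence)
      show "integrable lborel (\<lambda>y. indicator {0..a} y * \<bar>P y\<bar>)" by (rule Pint)
      show "AE y in lborel. (\<lambda>n. indicator {0..a} y * P y * (exp (- E n y) - 1)) \<longlonglongrightarrow> - (indicator {0..a - t} y * P y)"
        using AE_lborel_singleton[of "a - t"]
      proof eventually_elim
        case (elim y)
        consider "y < a - t" | "a - t < y" using elim by linarith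
        thus ?case
        proof cases
          case 1
          have "filterlim (\<lambda>n. (2 * (a - y - t)) * real n) at_top sequentially"
            using 1 by (intro filterlim_tendsto_pos_mult_at_top[OF tendsto_const] filterlim_real_sequentially) auto
          hence "filterlim (\<lambda>n. 2 * real n * (a - y - t)) at_top sequentially"
            by (simp add: mult_ac)
          hence "filterlim (\<lambda>n. E n y) at_top sequentially"
            unfolding E_def by (rule filterlim_compose[OF exp_at_top])
          hence "(\<lambda>n. exp (- E n y)) \<longlonglongrightarrow> 0"
            by (intro filterlim_compose[OF exp_at_bot]) (simp add: filterlim_uminus_at_top)
          hence "(\<lambda>n. indicator {0..a} y * P y * (exp (- E n y) - 1)) \<longlonglongrightarrow> indicator {0..a} y * P y * (0 - 1)"
            by (intro tendsto_intros)
          thus ?thesis using 1 t by (auto simp: indicator_def)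
        next
          case 2
          have "filterlim (\<lambda>n. (2 * (a - y - t)) * real n) at_bot sequentially"
            using 2 by (intro filterlim_tendsto_neg_mult_at_bot[OF tendsto_const] filterlim_real_sequentially) auto
          hence "filterlim (\<lambda>n. 2 * real n * (a - y - t)) at_bot sequentially"
            by (simp add: mult_ac)
          hence "(\<lambda>n. E n y) \<longlonglongrightarrow> 0"
            unfolding E_def by (rule filterlim_compose[OF exp_at_bot])
          hence "(\<lambda>n. indicator {0..a} y * P y * (exp (- E n y) - 1)) \<longlonglongrightarrow> indicator {0..a} y * P y * (exp (- 0) - 1)"
            by (intro tendsto_intros)
          thus ?thesis using 2 by (simp add: indicator_def)
        qed
      qed
      show "AE y in lborel. norm (indicator {0..a} y * P y * (exp (- E n y) - 1)) \<le> indicator {0..a} y * \<bar>P y\<bar>" for n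
      proof (rule AE_I2)
        fix y
        have "\<bar>exp (- E n y) - 1\<bar> \<le> 1"
          by (simp add: E_def abs_le_iff)
        hence "\<bar>P y\<bar> * \<bar>exp (- E n y) - 1\<bar> \<le> \<bar>P y\<bar> * 1"
          by (intro mult_left_mono) auto
        thus "norm (indicator {0..a} y * P y * (exp (- E n y) - 1)) \<le> indicator {0..a} y * \<bar>P y\<bar>"
          by (auto simp: indicator_def abs_mult)
      qed
    qed (auto simp: E_def)
    ultimately have "(LBINT y. - (indicator {0..a - t} y * P y)) = 0"
      using LIMSEQ_unique by blast
    thus ?thesis by (simp add: set_lebesgue_integral_def)
  qed
  fix x assume x: "x \<in> {0..a}"
  define F where "F x = (LBINT y:{0..x}. P y)" for x
  have Fcont: "continuous_on {0..a} F"
    using ac_on_continuous[OF ac_on_primitive[OF P, of 0]] by (simp add: F_def[abs_def])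
  show "(LBINT t:{0..x}. P t) = 0"
  proof (cases "0 < a")
    case True
    \<comment> \<open>The previous step needs 0 < t < a, hence gives the primitive only in the
      interior; continuity adds the endpoints.\<close>
    have "F x = 0"
    proof (rule continuous_constant_on_closure[where S = "{0<..<a}" and f = F and a = 0 and x = x])
      show "continuous_on (closure {0<..<a}) F" using Fcont True by simp
      show "F y = 0" if "y \<in> {0<..<a}" for y
        using inner[of "a - y"] that by (simp add: F_def)
      show "x \<in> closure {0<..<a}" using x True by simp
    qed
    thus ?thesis by (simp add: F_def)
  next
    case False
    with x have "{0..x} = {0}" by auto
    thus ?thesis by (simp add: set_integral_at_point)
  qed
qed

section \<open>Growing and recessive solutions\<close>

lemma ac_on_wronskian:
  assumes "ac_on X u1 v1" "ac_on X v1 (\<lambda>x. p1 x * u1 x)"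
    and "ac_on X u2 v2" "ac_on X v2 (\<lambda>x. p2 x * u2 x)"
  shows "ac_on X (\<lambda>x. v1 x * u2 x - u1 x * v2 x) (\<lambda>x. (p1 x - p2 x) * u1 x * u2 x)"
  by (rule ac_on_cong[OF ac_on_diff[OF ac_on_mult[OF assms(2,3)] ac_on_mult[OF assms(1,4)]]])
     (auto simp: algebra_simps)

lemma ac_on_exp:
  assumes "ac_on X F d" "continuous_on {0..X} d"
  shows "ac_on X (\<lambda>x. exp (F x)) (\<lambda>x. d x * exp (F x))"
proof (rule ac_on_C1)
  show "((\<lambda>x. exp (F x)) has_real_derivative d x * exp (F x)) (at x within {0..X})"
    if "x \<in> {0..X}" for x
    using ac_on_has_derivative[OF assms that] by (auto intro!: derivative_eq_intros)
  show "continuous_on {0..X} (\<lambda>x. d x * exp (F x))"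
    by (intro continuous_intros assms(2) ac_on_continuous[OF assms(1)])
qed

lemma ac_on_id: "ac_on X (\<lambda>x. x) (\<lambda>_. 1)"
  by (rule ac_on_C1) (auto intro!: derivative_eq_intros)

lemma ac_on_exp_linear: "ac_on X (\<lambda>x. exp (c * x)) (\<lambda>x. c * exp (c * x))"
  by (rule ac_on_C1) (auto intro!: derivative_eq_intros continuous_intros)

lemma ac_on_inverse:
  assumes "ac_on X F d" "continuous_on {0..X} d" "\<And>x. x \<in> {0..X} \<Longrightarrow> F x \<noteq> 0"
  shows "ac_on X (\<lambda>x. 1 / F x) (\<lambda>x. - d x / (F x)\<^sup>2)"
proof (rule ac_on_C1)
  show "((\<lambda>x. 1 / F x) has_real_derivative - d x / (F x)\<^sup>2) (at x within {0..X})"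
    if "x \<in> {0..X}" for x
    using ac_on_has_derivative[OF assms(1,2) that] assms(3)[OF that]
    by (auto intro!: derivative_eq_intros simp: power2_eq_square)
  show "continuous_on {0..X} (\<lambda>x. - d x / (F x)\<^sup>2)"
    using assms(3) by (intro continuous_intros assms(2) ac_on_continuous[OF assms(1)]) auto
qed

text \<open>The smallest point of the compact set where u <= 0. By the intermediate value theorem u
  cannot be negative there, as an earlier zero would contradict minimality.\<close>

lemma first_zero:
  fixes u :: "real \<Rightarrow> real"
  assumes c: "continuous_on {0..X} u" and "0 < u 0" "u X \<le> 0" "0 \<le> X"
  obtains z where "z \<in> {0..X}" "u z = 0" "\<And>t. t \<in> {0..z} \<Longrightarrow> 0 \<le> u t"
proof -
  define Z where "Z = {0..X} \<inter> u -` {..0}"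
  have "closed Z"
    unfolding Z_def using c by (intro continuous_closed_preimage) auto
  hence "compact Z"
    using bounded_subset[OF bounded_closed_interval[of 0 X], of Z]
    by (auto simp: compact_eq_bounded_closed Z_def)
  moreover have "X \<in> Z" using assms by (auto simp: Z_def)
  ultimately obtain z where z: "z \<in> Z" and zmin: "\<And>t. t \<in> Z \<Longrightarrow> z \<le> t"
    using compact_attains_inf[of Z] by blast
  have pos: "0 < u t" if "t \<in> {0..<z}" for t
    using zmin[of t] z that by (force simp: Z_def)
  have "u z = 0"
  proof (rule ccontr)
    assume "u z \<noteq> 0"
    hence "u z < 0" using z by (auto simp: Z_def)
    moreover have "continuous_on {0..z} u"
      using continuous_on_subset[OF c, of "{0..z}"] z by (auto simp: Z_def)
    ultimately obtain t where t: "0 \<le> t" "t \<le> z" "u t = 0"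
      using IVT2'[of u z 0 0] assms(2) z by (auto simp: Z_def)
    hence "z \<le> t" using z by (intro zmin) (auto simp: Z_def)
    with t \<open>u z < 0\<close> show False by auto
  qed
  moreover have "0 \<le> u t" if "t \<in> {0..z}" for t
    using pos[of t] \<open>u z = 0\<close> that by (cases "t = z") auto
  ultimately show ?thesis using z by (intro that[of z]) (auto simp: Z_def)
qed

text \<open>A common setting for finite and infinite b: a potential on a bounded interval is
  continued by zero. Solutions then live on the whole half-line, and b enters only through the
  condition at the right end.\<close>

locale halfline_potential =
  fixes q :: "real \<Rightarrow> real" and C :: real
  assumes q_measurable [measurable]: "q \<in> borel_measurable borel"
    and q_integrable: "\<And>X. set_integrable lborel {0..X} q"
    and q_neg: "\<And>x. 0 \<le> x \<Longrightarrow> (LBINT t:{x..x+1}. max (- q t) 0) \<le> C"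
begin

lemma C_nonneg: "0 \<le> C"
proof -
  have "0 \<le> (LBINT t:{0..0+1}. max (- q t) 0)"
    unfolding set_lebesgue_integral_def by (intro integral_nonneg_AE) auto
  with q_neg[of 0] show ?thesis by simp
qed

lemma q_plus_const_integrable: "set_integrable lborel {0..X} (\<lambda>x. q x + c)"
  by (intro set_integral_add q_integrable borel_integrable_atLeastAtMost' continuous_on_const)

lemma neg_integrable: "set_integrable lborel {0..X} (\<lambda>t. max (- q t) 0)"
  unfolding set_integrable_def
proof (rule Bochner_Integration.integrable_bound)
  show "integrable lborel (\<lambda>t. indicator {0..X} t *\<^sub>R q t)"
    using q_integrable[of X] by (simp add: set_integrable_def)
qed (auto simp: indicator_def)

text \<open>
  The function \<open>\<eta>\<close> is the logarithmic derivative of a subsolution: averaging the primitive \<open>S\<close> of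
  the negative part of \<open>q\<close> over unit intervals keeps \<open>\<eta>\<close> bounded although \<open>S\<close> need not be.
\<close>

lemma riccati_subsolution:
  assumes \<kappa>: "C + 1 \<le> \<kappa>"
  obtains \<eta> e where "\<And>X. ac_on X \<eta> e" "\<And>x. 0 \<le> x \<Longrightarrow> \<kappa> - C - 1 \<le> \<eta> x" "\<And>x. 0 \<le> x \<Longrightarrow> \<eta> x \<le> \<kappa> - 1"
    "\<And>x. 0 \<le> x \<Longrightarrow> e x + (\<eta> x)\<^sup>2 \<le> q x + \<kappa>\<^sup>2"
proof -
  define N where "N t = max (- q t) 0" for t
  define S where "S x = (LBINT t:{0..x}. N t)" for x
  have S: "ac_on X S N" for X
    using ac_on_primitive[OF neg_integrable, of X 0] by (simp add: S_def[abs_def] N_def[abs_def])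
  have Scont: "continuous_on {0..X} S" for X
    by (rule ac_on_continuous[OF S])
  have Sint: "set_integrable lborel {0..X} S" for X
    by (rule borel_integrable_atLeastAtMost'[OF Scont])
  define R where "R x = 0 + (LBINT t:{0..x}. S t)" for x
  have R: "ac_on X R S" for X
    unfolding R_def by (rule ac_on_primitive[OF Sint])
  have Smono: "S x \<le> S y" if "0 \<le> x" "x \<le> y" for x y
    by (rule ac_on_mono[OF S[of y]]) (use that in \<open>auto simp: N_def\<close>)
  have S1: "S (x + 1) \<le> S x + C" if "0 \<le> x" for x
    using ac_on_diff_eq[OF S[of "x+1"], of x "x+1"] q_neg[OF that] that by (simp add: N_def)
  have Rlo: "S x \<le> R (x + 1) - R x" if "0 \<le> x" for x
  proof -
    have "R x - S x * x \<le> R (x + 1) - S x * (x + 1)"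
      by (rule ac_on_mono[OF ac_on_diff[OF R[of "x+1"] ac_on_cmult[OF ac_on_id]]])
         (use that Smono in auto)
    thus ?thesis by (simp add: algebra_simps)
  qed
  have Rhi: "R (x + 1) - R x \<le> S x + C" if "0 \<le> x" for x
  proof -
    have "S (x + 1) * x - R x \<le> S (x + 1) * (x + 1) - R (x + 1)"
      by (rule ac_on_mono[OF ac_on_diff[OF ac_on_cmult[OF ac_on_id] R[of "x+1"]]])
         (use that Smono in auto)
    thus ?thesis using S1[OF that] by (simp add: algebra_simps)
  qed
  have Rshift: "ac_on X (\<lambda>x. R (x + 1)) (\<lambda>x. S (x + 1))" for X
  proof (rule ac_on_C1)
    fix x assume x: "x \<in> {0..X}"
    have "(R has_real_derivative S (x + 1)) (at (x + 1) within {0..X+1})"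
      using ac_on_has_derivative[OF R Scont] x by auto
    hence "(R has_real_derivative S (x + 1)) (at (x + 1) within (\<lambda>x. x + 1) ` {0..X})"
      by (rule DERIV_subset) auto
    moreover have "((\<lambda>x. x + 1) has_real_derivative 1) (at x within {0..X})"
      by (auto intro!: derivative_eq_intros)
    ultimately show "((\<lambda>x. R (x + 1)) has_real_derivative S (x + 1)) (at x within {0..X})"
      using DERIV_image_chain[of R "S (x + 1)" "\<lambda>x. x + 1" x "{0..X}" 1] by (simp add: o_def)
  next
    show "continuous_on {0..X} (\<lambda>x. S (x + 1))"
      by (rule continuous_on_compose2[OF Scont[of "X + 1"]]) (auto intro!: continuous_intros)
  qed
  \<comment> \<open>R(x+1) - R(x) is the mean of S over a unit interval, so its excess over S(x)
    lies between 0 and C; this gives both bounds for \<eta>. In the derivative, -N is at most q, and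
    the increment of S is at most C.\<close>
  define \<eta> where "\<eta> x = (\<kappa> - C - 1) + ((R (x + 1) - R x) - S x)" for x
  define e where "e x = 0 + ((S (x + 1) - S x) - N x)" for x
  have "ac_on X \<eta> e" for X
    unfolding \<eta>_def e_def by (intro ac_on_add ac_on_diff ac_on_const R S Rshift)
  moreover have lo: "\<kappa> - C - 1 \<le> \<eta> x" and hi: "\<eta> x \<le> \<kappa> - 1" if "0 \<le> x" for x
    using Rlo[OF that] Rhi[OF that] by (auto simp: \<eta>_def)
  moreover have "e x + (\<eta> x)\<^sup>2 \<le> q x + \<kappa>\<^sup>2" if "0 \<le> x" for x
  proof -
    have "(\<eta> x)\<^sup>2 \<le> (\<kappa> - 1)\<^sup>2"
      using lo[OF that] hi[OF that] \<kappa> by (intro power_mono) auto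
    moreover have "e x \<le> C + q x"
      using S1[OF that] by (auto simp: e_def N_def)
    \<comment> \<open>Amounts to C + 1 <= 2 \<kappa>. The room between (\<kappa> - 1)^2 and
      \<kappa>^2 pays for the increment C of S.\<close>
    moreover have "C + (\<kappa> - 1)\<^sup>2 \<le> \<kappa>\<^sup>2"
      using \<kappa> C_nonneg by (simp add: power2_eq_square algebra_simps)
    ultimately show ?thesis by simp
  qed
  ultimately show ?thesis by (rule that)
qed

text \<open>With I the primitive of \<eta>, the function D = (v - \<eta> u) e^I has density (q +
  \<kappa>^2 - e - \<eta>^2) u e^I, which is nonnegative as long as u is. Starting from v(0) =
  \<kappa> > \<eta>(0) this gives v >= \<eta> u, and the lower bound for \<eta> becomes one for the
  logarithmic derivative of u.\<close>

lemma growing_solution: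
  assumes \<kappa>: "C + 1 \<le> \<kappa>"
  obtains u v where "\<And>X. ac_on X u v" "\<And>X. ac_on X v (\<lambda>x. (q x + \<kappa>\<^sup>2) * u x)"
    "u 0 = 1" "v 0 = \<kappa>" "\<And>x. 0 \<le> x \<Longrightarrow> 0 < u x"
    "\<And>x. 0 \<le> x \<Longrightarrow> (\<kappa> - C - 1) * u x \<le> v x"
    "\<And>x. 0 \<le> x \<Longrightarrow> u x \<le> (1 + \<kappa> * x) * exp (x * (LBINT t:{0..x}. \<bar>q t + \<kappa>\<^sup>2\<bar>))"
proof -
  obtain u v where u: "\<And>X. ac_on X u v" and v: "\<And>X. ac_on X v (\<lambda>x. (q x + \<kappa>\<^sup>2) * u x)"
    and u0: "u 0 = 1" and v0: "v 0 = \<kappa>"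
    and ub: "\<And>x. 0 \<le> x \<Longrightarrow> \<bar>u x\<bar> \<le> (\<bar>1\<bar> + \<bar>\<kappa>\<bar> * x) * exp (x * (LBINT t:{0..x}. \<bar>q t + \<kappa>\<^sup>2\<bar>))"
    using ivp_exists[of "\<lambda>x. q x + \<kappa>\<^sup>2" 1 \<kappa>] q_plus_const_integrable by auto
  obtain \<eta> e where \<eta>: "\<And>X. ac_on X \<eta> e" and lo: "\<And>x. 0 \<le> x \<Longrightarrow> \<kappa> - C - 1 \<le> \<eta> x"
    and hi: "\<And>x. 0 \<le> x \<Longrightarrow> \<eta> x \<le> \<kappa> - 1"
    and sub: "\<And>x. 0 \<le> x \<Longrightarrow> e x + (\<eta> x)\<^sup>2 \<le> q x + \<kappa>\<^sup>2"
    using riccati_subsolution[OF \<kappa>] by blast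
  have \<eta>c: "continuous_on {0..X} \<eta>" for X by (rule ac_on_continuous[OF \<eta>])
  define I where "I x = 0 + (LBINT t:{0..x}. \<eta> t)" for x
  have I: "ac_on X I \<eta>" for X
    unfolding I_def by (rule ac_on_primitive[OF borel_integrable_atLeastAtMost'[OF \<eta>c]])
  have I0: "I 0 = 0" by (simp add: I_def set_integral_at_point)
  define D where "D x = (v x - \<eta> x * u x) * exp (I x)" for x
  have D: "ac_on X D (\<lambda>x. (q x + \<kappa>\<^sup>2 - e x - (\<eta> x)\<^sup>2) * u x * exp (I x))" for X
    by (rule ac_on_cong[OF ac_on_mult[OF ac_on_diff[OF v ac_on_mult[OF \<eta> u]] ac_on_exp[OF I \<eta>c]]])
       (auto simp: D_def algebra_simps power2_eq_square)
  have D0: "0 \<le> D 0"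
    using hi[of 0] by (simp add: D_def u0 v0 I0)
  have Dnn: "0 \<le> D x" if "0 \<le> x" "\<And>t. t \<in> {0..x} \<Longrightarrow> 0 \<le> u t" for x
  proof -
    have "D 0 \<le> D x"
    proof (rule ac_on_mono[OF D[of x]])
      fix t assume t: "t \<in> {0..x}"
      have "0 \<le> q t + \<kappa>\<^sup>2 - e t - (\<eta> t)\<^sup>2"
        using sub[of t] t by auto
      thus "0 \<le> (q t + \<kappa>\<^sup>2 - e t - (\<eta> t)\<^sup>2) * u t * exp (I t)"
        using that(2)[OF t] by simp
    qed (use that in auto)
    with D0 show ?thesis by simp
  qed
  have Dv: "0 \<le> v x - \<eta> x * u x" if "0 \<le> D x" for x
    using that by (simp add: D_def zero_le_mult_iff)
  \<comment> \<open>Positivity of u and the sign of D need each other. Up to a first zero u is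
    nonnegative, so D is too, and u e^(-I) is nondecreasing from the value 1; hence it cannot reach
    0.\<close>
  have upos: "0 < u x" if x: "0 \<le> x" for x
  proof (rule ccontr)
    assume "\<not> 0 < u x"
    then obtain z where z: "z \<in> {0..x}" "u z = 0" "\<And>t. t \<in> {0..z} \<Longrightarrow> 0 \<le> u t"
      using first_zero[OF ac_on_continuous[OF u[of x]]] u0 x by (auto simp: not_less)
    have "u 0 * exp (- I 0) \<le> u z * exp (- I z)"
    proof (rule ac_on_mono[OF ac_on_mult[OF u ac_on_exp[OF ac_on_minus[OF I]]]])
      fix t assume t: "t \<in> {0..z}"
      have "0 \<le> v t - \<eta> t * u t"
        by (rule Dv[OF Dnn]) (use t z in auto)
      hence "0 \<le> (v t - \<eta> t * u t) * exp (- I t)" by simp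
      thus "0 \<le> v t * exp (- I t) + u t * (- \<eta> t * exp (- I t))"
        by (simp add: algebra_simps)
    qed (use z \<eta>c in \<open>auto intro!: continuous_intros\<close>)
    thus False using z u0 I0 by simp
  qed
  have "(\<kappa> - C - 1) * u x \<le> v x" if x: "0 \<le> x" for x
  proof -
    have "0 \<le> v x - \<eta> x * u x"
      by (rule Dv[OF Dnn[OF x]]) (use upos in \<open>auto intro: less_imp_le\<close>)
    moreover have "(\<kappa> - C - 1) * u x \<le> \<eta> x * u x"
      using lo[OF x] upos[OF x] by (intro mult_right_mono) auto
    ultimately show ?thesis by simp
  qed
  moreover have "u x \<le> (1 + \<kappa> * x) * exp (x * (LBINT t:{0..x}. \<bar>q t + \<kappa>\<^sup>2\<bar>))" if "0 \<le> x" for x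
    using ub[OF that] \<kappa> C_nonneg by auto
  ultimately show ?thesis using u v u0 v0 upos by (intro that)
qed

end

text \<open>Over [a, X] the mean slope of u is at most 2 B / (X - a) in absolute value, while v
  deviates from v(a) by at most B times the integral of |p|.\<close>

lemma ac_on_derivative_bound:
  assumes u: "ac_on X u v" and v: "ac_on X v (\<lambda>x. p x * u x)"
    and p: "set_integrable lborel {0..X} p" and a: "0 \<le> a" "a < X"
    and bound: "\<And>t. t \<in> {a..X} \<Longrightarrow> \<bar>u t\<bar> \<le> B"
  shows "\<bar>v a\<bar> \<le> 2 * B / (X - a) + B * (LBINT t:{0..X}. \<bar>p t\<bar>)"
proof -
  define P where "P = (LBINT t:{0..X}. \<bar>p t\<bar>)"
  have pa: "set_integrable lborel {0..X} (\<lambda>t. \<bar>p t\<bar>)"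
    using p by (rule set_integrable_abs)
  have B: "0 \<le> B" using bound[of a] a by force
  define Q where "Q x = 0 + (LBINT t:{0..x}. \<bar>p t\<bar>)" for x
  have Q: "ac_on X Q (\<lambda>t. \<bar>p t\<bar>)"
    unfolding Q_def by (rule ac_on_primitive[OF pa])
  have Qb: "Q t - Q a \<le> P" if "t \<in> {a..X}" for t
  proof -
    have "Q 0 \<le> Q a" "Q t \<le> Q X"
      using a that by (auto intro!: ac_on_mono[OF Q])
    thus ?thesis by (simp add: Q_def P_def set_integral_at_point)
  qed
  have vt: "\<bar>v t - v a\<bar> \<le> B * P" if t: "t \<in> {a..X}" for t
  proof -
    have pu: "\<bar>p s * u s\<bar> \<le> B * \<bar>p s\<bar>" if "s \<in> {a..t}" for s
      using mult_left_mono[OF bound[of s], of "\<bar>p s\<bar>"] that t by (auto simp: abs_mult mult.commute)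
    have "B * Q a - v a \<le> B * Q t - v t"
      by (rule ac_on_mono[OF ac_on_diff[OF ac_on_cmult[OF Q] v]]) (use t a pu in \<open>force simp: abs_le_iff\<close>)+
    moreover have "B * Q a + v a \<le> B * Q t + v t"
      by (rule ac_on_mono[OF ac_on_add[OF ac_on_cmult[OF Q] v]]) (use t a pu in \<open>force simp: abs_le_iff\<close>)+
    moreover have "B * (Q t - Q a) \<le> B * P"
      by (rule mult_left_mono[OF Qb[OF t] B])
    ultimately show ?thesis by (auto simp: right_diff_distrib)
  qed
  have "u X - (v a + B * P) * X \<le> u a - (v a + B * P) * a"
  proof -
    have "(v a + B * P) * a - u a \<le> (v a + B * P) * X - u X"
      by (rule ac_on_mono[OF ac_on_diff[OF ac_on_cmult[OF ac_on_id] u]]) (use a vt in \<open>force simp: abs_le_iff\<close>)+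
    thus ?thesis by simp
  qed
  hence "u X - u a \<le> (v a + B * P) * (X - a)" by (simp add: algebra_simps)
  moreover have "u a - (v a - B * P) * a \<le> u X - (v a - B * P) * X"
    by (rule ac_on_mono[OF ac_on_diff[OF u ac_on_cmult[OF ac_on_id]]]) (use a vt in \<open>force simp: abs_le_iff\<close>)+
  hence "(v a - B * P) * (X - a) \<le> u X - u a" by (simp add: algebra_simps)
  moreover have "\<bar>u X - u a\<bar> \<le> 2 * B" using bound[of X] bound[of a] a by force
  ultimately have "v a - B * P \<le> 2 * B / (X - a)" "- (2 * B / (X - a)) \<le> v a + B * P"
    using a by (auto simp: pos_le_divide_eq pos_divide_le_eq minus_divide_left simp del: minus_divide_left[symmetric])
  thus ?thesis by (auto simp: P_def abs_le_iff)
qed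

text \<open>Reduction of order: J' = -1/u^2 makes u J a second solution of the same equation. Only J
  is free, up to a constant, and this constant will select the recessive solution.\<close>

lemma ac_on_reduction_of_order:
  assumes u: "\<And>X. ac_on X u v" and v: "\<And>X. ac_on X v (\<lambda>x. p x * u x)"
    and pos: "\<And>x. 0 \<le> x \<Longrightarrow> 0 < u x" and J: "\<And>X. ac_on X J (\<lambda>x. - 1 / (u x)\<^sup>2)"
  shows "ac_on X (\<lambda>x. u x * J x) (\<lambda>x. v x * J x - 1 / u x)"
    and "ac_on X (\<lambda>x. v x * J x - 1 / u x) (\<lambda>x. p x * (u x * J x))"
proof -
  have nz: "u x \<noteq> 0" if "x \<in> {0..X}" for x X using pos[of x] that by auto
  show "ac_on X (\<lambda>x. u x * J x) (\<lambda>x. v x * J x - 1 / u x)"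
    by (rule ac_on_cong[OF ac_on_mult[OF u J]]) (use nz in \<open>auto simp: power2_eq_square\<close>)
  show "ac_on X (\<lambda>x. v x * J x - 1 / u x) (\<lambda>x. p x * (u x * J x))"
    by (rule ac_on_cong[OF ac_on_diff[OF ac_on_mult[OF v J] ac_on_inverse[OF u ac_on_continuous[OF v] nz]]])
       auto
qed

context halfline_potential
begin

text \<open>\<psi> = u (J0 - K) with K the primitive of 1/u^2. The constant J0 is the supremum of K
  if b is infinite, K(b) for a Dirichlet condition, and slightly larger than K(b) otherwise. Since u
  grows at least like an exponential with rate at least 1, J0 - K(x) is at most 2 / u(x)^2, hence
  \<psi> <= 2/u.\<close>

lemma recessive_solution:
  fixes b h :: ereal
  assumes b: "0 < b" and h: "b < \<infinity> \<Longrightarrow> h \<noteq> -\<infinity>" and \<kappa>: "C + 2 \<le> \<kappa>"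
    and hk: "b < \<infinity> \<Longrightarrow> h \<noteq> \<infinity> \<Longrightarrow> C + 2 - real_of_ereal h \<le> \<kappa>"
  obtains u v \<psi> \<psi>' where "\<And>X. ac_on X u v" "\<And>X. ac_on X v (\<lambda>x. (q x + \<kappa>\<^sup>2) * u x)"
    "\<And>X. ac_on X \<psi> \<psi>'" "\<And>X. ac_on X \<psi>' (\<lambda>x. (q x + \<kappa>\<^sup>2) * \<psi> x)"
    "\<And>x. 0 \<le> x \<Longrightarrow> 1 \<le> u x" "\<And>x. 0 \<le> x \<Longrightarrow> exp ((\<kappa> - C - 1) * x) \<le> u x"
    "\<And>x. 0 \<le> x \<Longrightarrow> u x \<le> (1 + \<kappa> * x) * exp (x * (LBINT t:{0..x}. \<bar>q t + \<kappa>\<^sup>2\<bar>))"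
    "\<And>x. 0 \<le> x \<Longrightarrow> \<psi>' x * u x - \<psi> x * v x = -1"
    "\<And>x. 0 \<le> x \<Longrightarrow> ereal x < b \<Longrightarrow> 0 < \<psi> x" "\<And>x. 0 \<le> x \<Longrightarrow> ereal x < b \<Longrightarrow> \<psi> x \<le> 2 / u x"
    "\<And>x. 0 \<le> x \<Longrightarrow> ereal x < b \<Longrightarrow> x / (u x)\<^sup>2 \<le> \<psi> 0"
    "b < \<infinity> \<Longrightarrow> h = \<infinity> \<Longrightarrow> \<psi> (real_of_ereal b) = 0"
    "b < \<infinity> \<Longrightarrow> h \<noteq> \<infinity> \<Longrightarrow> \<psi>' (real_of_ereal b) + real_of_ereal h * \<psi> (real_of_ereal b) = 0"
proof -
  define \<mu> where "\<mu> = \<kappa> - C - 1"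
  have \<mu>: "1 \<le> \<mu>" using \<kappa> by (simp add: \<mu>_def)
  have \<kappa>1: "C + 1 \<le> \<kappa>" using \<kappa> by simp
  obtain u v where u: "\<And>X. ac_on X u v" and v: "\<And>X. ac_on X v (\<lambda>x. (q x + \<kappa>\<^sup>2) * u x)"
    and u0: "u 0 = 1" and v0: "v 0 = \<kappa>" and upos: "\<And>x. 0 \<le> x \<Longrightarrow> 0 < u x"
    and vlo: "\<And>x. 0 \<le> x \<Longrightarrow> \<mu> * u x \<le> v x"
    and uhi: "\<And>x. 0 \<le> x \<Longrightarrow> u x \<le> (1 + \<kappa> * x) * exp (x * (LBINT t:{0..x}. \<bar>q t + \<kappa>\<^sup>2\<bar>))"
    by (rule growing_solution[OF \<kappa>1, folded \<mu>_def], rule that)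
  have grow: "u x * exp (\<mu> * (y - x)) \<le> u y" if xy: "0 \<le> x" "x \<le> y" for x y
  proof -
    have "u x * exp (- \<mu> * x) \<le> u y * exp (- \<mu> * y)"
    proof (rule ac_on_mono[OF ac_on_mult[OF u ac_on_exp_linear]])
      fix t assume t: "t \<in> {x..y}"
      have "0 \<le> (v t - \<mu> * u t) * exp (- \<mu> * t)"
        using vlo[of t] t xy by simp
      thus "0 \<le> v t * exp (- \<mu> * t) + u t * (- \<mu> * exp (- \<mu> * t))"
        by (simp add: algebra_simps)
    qed (use xy in auto)
    hence "u x * exp (- \<mu> * x) * exp (\<mu> * y) \<le> u y * exp (- \<mu> * y) * exp (\<mu> * y)"
      by (rule mult_right_mono) simp
    thus ?thesis by (simp add: mult.assoc exp_add[symmetric] algebra_simps)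
  qed
  have uexp: "exp (\<mu> * x) \<le> u x" if "0 \<le> x" for x
    using grow[of 0 x] that u0 by simp
  have u1: "1 \<le> u x" if "0 \<le> x" for x
    using uexp[OF that] \<mu> that by (smt (verit) one_le_exp_iff mult_nonneg_nonneg)
  have umono: "u x \<le> u y" if "0 \<le> x" "x \<le> y" for x y
  proof -
    have "u x * 1 \<le> u x * exp (\<mu> * (y - x))"
      using upos[of x] that \<mu> by (intro mult_left_mono) auto
    with grow[OF that] show ?thesis by simp
  qed
  have ucont: "continuous_on {0..X} u" for X by (rule ac_on_continuous[OF u])
  have u2cont: "continuous_on {0..X} (\<lambda>x. 1 / (u x)\<^sup>2)" for X
    using upos by (intro continuous_intros ucont) (auto simp: less_imp_neq[symmetric] dest: less_imp_neq)
  define K where "K x = 0 + (LBINT t:{0..x}. 1 / (u t)\<^sup>2)" for x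
  have K: "ac_on X K (\<lambda>x. 1 / (u x)\<^sup>2)" for X
    unfolding K_def by (rule ac_on_primitive[OF borel_integrable_atLeastAtMost'[OF u2cont]])
  have K0: "K 0 = 0" by (simp add: K_def set_integral_at_point)
  have Klo: "(y - x) / (u y)\<^sup>2 \<le> K y - K x" if xy: "0 \<le> x" "x \<le> y" for x y
  proof -
    have "K x - (1 / (u y)\<^sup>2) * x \<le> K y - (1 / (u y)\<^sup>2) * y"
    proof (rule ac_on_mono[OF ac_on_diff[OF K ac_on_cmult[OF ac_on_id]]])
      fix t assume t: "t \<in> {x..y}"
      have "1 / (u y)\<^sup>2 \<le> 1 / (u t)\<^sup>2"
        using umono[of t y] upos[of t] t xy by (intro divide_left_mono power_mono mult_pos_pos) auto
      thus "0 \<le> 1 / (u t)\<^sup>2 - 1 / (u y)\<^sup>2 * 1" by simp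
    qed (use xy in auto)
    thus ?thesis by (simp add: diff_divide_distrib)
  qed
  have Khi: "K y - K x \<le> 1 / (u x)\<^sup>2" if xy: "0 \<le> x" "x \<le> y" for x y
  proof -
    \<comment> \<open>\<open>c * exp (- (2 * \<mu>) * t)\<close> majorizes 1/u(t)^2 beyond x by the
      growth of u. Its integral from x on is at most 1 / (2 \<mu> u(x)^2), and 2 \<mu> >= 1.\<close>
    define c where "c = exp (2 * \<mu> * x) / (u x)\<^sup>2"
    have "c * (- 1 / (2 * \<mu>)) * exp (- (2 * \<mu>) * x) - K x \<le> c * (- 1 / (2 * \<mu>)) * exp (- (2 * \<mu>) * y) - K y"
    proof (rule ac_on_mono[OF ac_on_diff[OF ac_on_cmult[OF ac_on_exp_linear] K]])
      fix t assume t: "t \<in> {x..y}"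
      have "u x * exp (\<mu> * (t - x)) \<le> u t" using grow t xy by auto
      hence "(u x * exp (\<mu> * (t - x)))\<^sup>2 \<le> (u t)\<^sup>2"
        using upos[of x] xy by (intro power_mono) auto
      hence "1 / (u t)\<^sup>2 \<le> 1 / (u x * exp (\<mu> * (t - x)))\<^sup>2"
        using upos[of x] upos[of t] t xy by (intro divide_left_mono) auto
      also have "\<dots> = c * exp (- (2 * \<mu>) * t)"
        by (simp add: c_def power_mult_distrib exp_double[symmetric] exp_minus exp_diff right_diff_distrib field_simps)
      finally show "0 \<le> c * (- 1 / (2 * \<mu>)) * (- (2 * \<mu>) * exp (- (2 * \<mu>) * t)) - 1 / (u t)\<^sup>2"
        using \<mu> by simp
    qed (use xy in auto)
    hence "K y - K x \<le> c * exp (- (2 * \<mu>) * x) / (2 * \<mu>) - c * exp (- (2 * \<mu>) * y) / (2 * \<mu>)"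
      by simp
    also have "\<dots> \<le> c * exp (- (2 * \<mu>) * x) / (2 * \<mu>)"
      using \<mu> by (simp add: c_def)
    also have "\<dots> = 1 / (u x)\<^sup>2 / (2 * \<mu>)"
      by (simp add: c_def exp_minus)
    also have "\<dots> \<le> 1 / (u x)\<^sup>2 / 1"
      using \<mu> by (intro divide_left_mono) auto
    finally show ?thesis by simp
  qed
  have two: "2 / (u x)\<^sup>2 = 1 / (u x)\<^sup>2 + 1 / (u x)\<^sup>2" for x
    by (simp add: add_divide_distrib[symmetric])
  have inv_nn: "0 \<le> 1 / (u x)\<^sup>2" for x by simp
  \<comment> \<open>The factor 2 leaves room for the additional constant of the boundary condition
    with real h; the integral of 1/u^2 alone uses only half of it.\<close>
  obtain J0 where J0lo: "\<And>x. 0 \<le> x \<Longrightarrow> ereal x < b \<Longrightarrow> K x < J0"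
    and J0hi: "\<And>x. 0 \<le> x \<Longrightarrow> ereal x < b \<Longrightarrow> J0 \<le> K x + 2 / (u x)\<^sup>2"
    and bc1: "b < \<infinity> \<Longrightarrow> h = \<infinity> \<Longrightarrow> J0 = K (real_of_ereal b)"
    and bc2: "b < \<infinity> \<Longrightarrow> h \<noteq> \<infinity> \<Longrightarrow> v (real_of_ereal b) * (J0 - K (real_of_ereal b)) - 1 / u (real_of_ereal b)
        + real_of_ereal h * (u (real_of_ereal b) * (J0 - K (real_of_ereal b))) = 0"
  proof (cases "b < \<infinity>")
    case True
    then obtain r where br: "b = ereal r" using b by (cases b) auto
    have r: "0 < r" using b br by simp
    have lt: "K x < K r" if "0 \<le> x" "x < r" for x
      using Klo[of x r] that upos[of r] r by (smt (verit) divide_pos_pos zero_less_power)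
    show ?thesis
    proof (cases "h = \<infinity>")
      case True
      show ?thesis
      proof (rule that[of "K r"])
        fix x assume x: "0 \<le> x" "ereal x < b"
        hence xr: "x < r" by (simp add: br)
        show "K x < K r" by (rule lt[OF x(1) xr])
        show "K r \<le> K x + 2 / (u x)\<^sup>2"
          using Khi[of x r] x xr inv_nn[of x] unfolding two by linarith
      qed (use br True in auto)
    next
      case False
      \<comment> \<open>Inserting \<psi> = u (J0 - K) into the boundary condition at r gives (J0 -
        K(r)) g = 1/u(r), which determines \<open>k\<close>. The assumption \<kappa> >= C + 2 - h
        gives g >= u(r) > 0, so that \<open>k\<close> is positive and at most 1/u(r)^2.\<close>
      define g where "g = v r + real_of_ereal h * u r"
      have "\<mu> * u r + real_of_ereal h * u r \<le> g" using vlo[of r] r by (simp add: g_def)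
      moreover have "1 * u r \<le> (\<mu> + real_of_ereal h) * u r"
        using hk[OF \<open>b < \<infinity>\<close> False] upos[of r] r by (intro mult_right_mono) (auto simp: \<mu>_def)
      ultimately have g: "u r \<le> g" by (simp add: distrib_right)
      have ur: "0 < u r" using upos r by auto
      define k where "k = 1 / (u r * g)"
      have k0: "0 < k" using g ur by (simp add: k_def)
      have k1: "k \<le> 1 / (u r)\<^sup>2"
        unfolding k_def power2_eq_square using g ur by (intro divide_left_mono mult_left_mono) auto
      show ?thesis
      proof (rule that[of "K r + k"])
        fix x assume x: "0 \<le> x" "ereal x < b"
        hence xr: "x < r" by (simp add: br)
        show "K x < K r + k" using lt[OF x(1) xr] k0 by simp
        have "1 / (u r)\<^sup>2 \<le> 1 / (u x)\<^sup>2"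
          using umono[of x r] upos[of x] x xr by (intro divide_left_mono power_mono mult_pos_pos) auto
        thus "K r + k \<le> K x + 2 / (u x)\<^sup>2"
          using Khi[of x r] x xr k1 unfolding two by linarith
      next
        have "k * g = 1 / u r" using g ur by (simp add: k_def field_simps)
        thus "v (real_of_ereal b) * (K r + k - K (real_of_ereal b)) - 1 / u (real_of_ereal b)
          + real_of_ereal h * (u (real_of_ereal b) * (K r + k - K (real_of_ereal b))) = 0"
          by (simp add: br g_def algebra_simps)
      qed (use False in auto)
    qed
  next
    case False
    have bdd: "bdd_above (K ` {0..})"
      using Khi[of 0] K0 by (intro bdd_aboveI2[of _ _ "1 / (u 0)\<^sup>2"]) auto
    show ?thesis
    proof (rule that[of "SUP x\<in>{0..}. K x"])
      fix x :: real assume x: "0 \<le> x"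
      have "0 < 1 / (u (x + 1))\<^sup>2" using upos[of "x+1"] x by simp
      moreover have "1 / (u (x + 1))\<^sup>2 \<le> K (x + 1) - K x" using Klo[of x "x + 1"] x by simp
      ultimately have "K x < K (x + 1)" by linarith
      also have "\<dots> \<le> (SUP x\<in>{0..}. K x)" using x by (intro cSUP_upper bdd) auto
      finally show "K x < (SUP x\<in>{0..}. K x)" .
      have "K y \<le> K x + 2 / (u x)\<^sup>2" if "0 \<le> y" for y
      proof (cases "x \<le> y")
        case True
        thus ?thesis using Khi[OF x True] inv_nn[of x] unfolding two by linarith
      next
        case False
        have "K y \<le> K x" by (rule ac_on_mono[OF K[of x]]) (use False that in auto)
        moreover have "0 \<le> 2 / (u x)\<^sup>2" by simp
        ultimately show ?thesis by linarith
      qed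
      thus "(SUP x\<in>{0..}. K x) \<le> K x + 2 / (u x)\<^sup>2"
        by (intro cSUP_least) auto
    qed (use False in auto)
  qed
  define J where "J x = J0 - K x" for x
  have J: "ac_on X J (\<lambda>x. - 1 / (u x)\<^sup>2)" for X
    by (rule ac_on_cong[OF ac_on_diff[OF ac_on_const[of X J0] K]]) (auto simp: J_def)
  define \<psi> where "\<psi> x = u x * J x" for x
  define \<psi>' where "\<psi>' x = v x * J x - 1 / u x" for x
  show ?thesis
  proof (rule that[of u v \<psi> \<psi>'])
    show "ac_on X \<psi> \<psi>'" "ac_on X \<psi>' (\<lambda>x. (q x + \<kappa>\<^sup>2) * \<psi> x)" for X
      using ac_on_reduction_of_order[OF u v upos J, of X] by (simp_all add: \<psi>_def[abs_def] \<psi>'_def[abs_def])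
    fix x :: real assume x: "0 \<le> x"
    show "\<psi>' x * u x - \<psi> x * v x = -1"
      using upos[OF x] by (simp add: \<psi>_def \<psi>'_def left_diff_distrib)
    assume xb: "ereal x < b"
    show "0 < \<psi> x" using J0lo[OF x xb] upos[OF x] by (simp add: \<psi>_def J_def)
    have "\<psi> x \<le> u x * (2 / (u x)\<^sup>2)"
      unfolding \<psi>_def J_def using J0hi[OF x xb] upos[OF x] by (intro mult_left_mono) auto
    thus "\<psi> x \<le> 2 / u x" using upos[OF x] by (simp add: power2_eq_square)
    show "x / (u x)\<^sup>2 \<le> \<psi> 0"
      using Klo[of 0 x] J0lo[OF x xb] x K0 u0 by (simp add: \<psi>_def J_def)
  next
    show "exp ((\<kappa> - C - 1) * x) \<le> u x" if "0 \<le> x" for x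
      using uexp[OF that] by (simp add: \<mu>_def)
    show "\<psi> (real_of_ereal b) = 0" if "b < \<infinity>" "h = \<infinity>"
      using bc1[OF that] by (simp add: \<psi>_def J_def)
    show "\<psi>' (real_of_ereal b) + real_of_ereal h * \<psi> (real_of_ereal b) = 0" if "b < \<infinity>" "h \<noteq> \<infinity>"
      using bc2[OF that] by (simp add: \<psi>_def \<psi>'_def J_def)
  qed (fact u v u1 uhi)+
qed

end

section \<open>Weyl solutions and the m-function\<close>

text \<open>Solutions are defined by integrals over open intervals against \<open>lebesgue\<close>,
  while \<open>ac_on\<close> uses closed intervals and \<open>lborel\<close>.\<close>

lemma lebesgue_integral_open_interval:
  fixes f :: "real \<Rightarrow> 'a::{banach, second_countable_topology}"
  assumes "set_integrable lborel {y..x} f"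
  shows "(LINT t:{y<..<x}|lebesgue. f t) = (LBINT t:{y..x}. f t)"
proof -
  have o: "set_integrable lborel {y<..<x} f"
    by (rule set_integrable_subset[OF assms]) auto
  have "(LINT t:{y<..<x}|lebesgue. f t) = (LBINT t:{y<..<x}. f t)"
    using o unfolding set_lebesgue_integral_def set_integrable_def
    by (intro integral_completion) (rule borel_measurable_integrable)
  also have "\<dots> = (LBINT t:{y..x}. f t)"
    unfolding set_lebesgue_integral_def
  proof (rule integral_cong_AE)
    show "AE t in lborel. indicator {y<..<x} t *\<^sub>R f t = indicator {y..x} t *\<^sub>R f t"
      using AE_lborel_singleton[of y] AE_lborel_singleton[of x]
      by eventually_elim (auto simp: indicator_def)
  qed (use o assms in \<open>auto simp: set_integrable_def dest: borel_measurable_integrable\<close>)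
  finally show ?thesis .
qed

lemma schroedinger_solution_of_real:
  assumes u: "\<And>X. ac_on X u v" and v: "\<And>X. ac_on X v (\<lambda>x. (q x + \<kappa>\<^sup>2) * u x)"
  shows "schroedinger_solution q b (of_real (- (\<kappa>\<^sup>2))) (\<lambda>x. of_real (u x)) (\<lambda>x. of_real (v x))"
proof -
  define I where "I = {x. 0 \<le> x \<and> ereal x \<le> b}"
  have "(u has_real_derivative v x) (at x within {0..})" if "0 \<le> x" for x
  proof -
    have "(u has_real_derivative v x) (at x within {0..x+1})"
      using ac_on_has_derivative[OF u ac_on_continuous[OF v], of x "x+1"] that by simp
    moreover have "at x within {0..x+1} = at x within {0..}"
      by (rule at_within_nhd[of x "{..<x+1}"]) auto
    ultimately show ?thesis by simp
  qed
  hence "(u has_real_derivative v x) (at x within I)" if "x \<in> I" for x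
    using that by (intro DERIV_subset[of u "v x" x "{0..}" I]) (auto simp: I_def)
  hence "((\<lambda>x. complex_of_real (u x)) has_vector_derivative of_real (v x)) (at x within I)" if "x \<in> I" for x
    using that by (intro has_vector_derivative_of_real)
      (auto simp: has_real_derivative_iff_has_vector_derivative)
  moreover have "complex_of_real (v x) = of_real (v 0) +
      (LINT t:{0<..<x}|lebesgue. (of_real (q t) - of_real (- (\<kappa>\<^sup>2))) * of_real (u t))" if "x \<in> I" for x
  proof -
    have x: "0 \<le> x" using that by (simp add: I_def)
    have "set_integrable lborel {0..x} (\<lambda>t. complex_of_real ((q t + \<kappa>\<^sup>2) * u t))"
      using ac_on_integrable[OF v, of x] unfolding set_integrable_def
      by (subst of_real_mult[symmetric] scaleR_conv_of_real)+ (simp add: scaleR_conv_of_real flip: of_real_mult)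
    hence "(LINT t:{0<..<x}|lebesgue. complex_of_real ((q t + \<kappa>\<^sup>2) * u t)) = of_real (v x - v 0)"
      using ac_onD[OF v, of x x] x
      by (subst lebesgue_integral_open_interval) (simp_all only: set_integral_complex_of_real, auto)
    moreover have "(\<lambda>t. complex_of_real ((q t + \<kappa>\<^sup>2) * u t))
        = (\<lambda>t. (of_real (q t) - of_real (- (\<kappa>\<^sup>2))) * of_real (u t))"
      by simp
    ultimately show ?thesis by simp
  qed
  ultimately show ?thesis
    by (simp add: schroedinger_solution_def I_def Let_def)
qed

text \<open>L will be the real or the imaginary part. As q and \<kappa>^2 are real, a real-linear
  functional maps the complex equation to the real one, so that all real comparison arguments apply
  to an arbitrary Weyl solution.\<close>

lemma ac_on_schroedinger_solution:
  assumes q: "\<And>X. set_integrable lborel {0..X} q"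
    and sol: "schroedinger_solution q b (of_real (- (\<kappa>\<^sup>2))) U V" and X: "0 \<le> X" "ereal X \<le> b"
    and L: "bounded_linear L"
  shows "ac_on X (\<lambda>x. L (U x)) (\<lambda>x. L (V x))" "ac_on X (\<lambda>x. L (V x)) (\<lambda>x. (q x + \<kappa>\<^sup>2) * L (U x))"
proof -
  interpret L: bounded_linear L by fact
  define p where "p x = q x + \<kappa>\<^sup>2" for x
  define I where "I = {x. 0 \<le> x \<and> ereal x \<le> b}"
  have sub: "{0..X} \<subseteq> I"
    by (auto simp: I_def intro: order_trans[OF _ X(2)])
  have dU: "(U has_vector_derivative V x) (at x within {0..X})" if "x \<in> {0..X}" for x
    using sol that sub by (intro has_vector_derivative_within_subset[OF _ sub])
      (auto simp: schroedinger_solution_def I_def Let_def)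
  have Ucont: "continuous_on {0..X} U"
    unfolding continuous_on_eq_continuous_within using has_vector_derivative_continuous[OF dU] by blast
  have pint: "set_integrable lborel {0..X} p"
    unfolding p_def by (intro set_integral_add q borel_integrable_atLeastAtMost' continuous_on_const)
  have Re: "set_integrable lborel {0..X} (\<lambda>t. p t * Re (U t))"
    and Im: "set_integrable lborel {0..X} (\<lambda>t. p t * Im (U t))"
    by (intro set_integrable_mult_continuous pint continuous_intros Ucont)+
  have pU: "set_integrable lborel {0..X} (\<lambda>t. p t *\<^sub>R U t)"
  proof -
    have "integrable lborel (\<lambda>t. (indicator {0..X} t *\<^sub>R (p t * Re (U t))) *\<^sub>R (1::complex)
        + (indicator {0..X} t *\<^sub>R (p t * Im (U t))) *\<^sub>R \<i>)"
      using Re Im unfolding set_integrable_def by (intro Bochner_Integration.integrable_add integrable_scaleR_left)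
    moreover have "(\<lambda>t. (indicator {0..X} t *\<^sub>R (p t * Re (U t))) *\<^sub>R (1::complex)
        + (indicator {0..X} t *\<^sub>R (p t * Im (U t))) *\<^sub>R \<i>) = (\<lambda>t. indicator {0..X} t *\<^sub>R (p t *\<^sub>R U t))"
      by (auto simp: fun_eq_iff complex_eq_iff indicator_def)
    ultimately show ?thesis by (simp add: set_integrable_def)
  qed
  have V: "V x = V 0 + (LBINT t:{0..x}. p t *\<^sub>R U t)" if x: "x \<in> {0..X}" for x
  proof -
    have "V x = V 0 + (LINT t:{0<..<x}|lebesgue. (of_real (q t) - of_real (- (\<kappa>\<^sup>2))) * U t)"
      using sol sub x by (auto simp: schroedinger_solution_def I_def Let_def)
    also have "(\<lambda>t. (of_real (q t) - of_real (- (\<kappa>\<^sup>2))) * U t) = (\<lambda>t. p t *\<^sub>R U t)"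
      by (auto simp: p_def scaleR_conv_of_real)
    also have "(LINT t:{0<..<x}|lebesgue. p t *\<^sub>R U t) = (LBINT t:{0..x}. p t *\<^sub>R U t)"
      using set_integrable_subset[OF pU, of "{0..x}"] x by (intro lebesgue_integral_open_interval) auto
    finally show ?thesis .
  qed
  have LpU: "set_integrable lborel {0..x} (\<lambda>t. p t * L (U t))"
    "L (LBINT t:{0..x}. p t *\<^sub>R U t) = (LBINT t:{0..x}. p t * L (U t))" if x: "x \<in> {0..X}" for x
  proof -
    have i: "integrable lborel (\<lambda>t. indicator {0..x} t *\<^sub>R (p t *\<^sub>R U t))"
      using set_integrable_subset[OF pU, of "{0..x}"] x by (auto simp: set_integrable_def)
    have eq: "(\<lambda>t. L (indicator {0..x} t *\<^sub>R (p t *\<^sub>R U t))) = (\<lambda>t. indicator {0..x} t *\<^sub>R (p t * L (U t)))"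
      by (simp add: L.scaleR mult.assoc)
    show "set_integrable lborel {0..x} (\<lambda>t. p t * L (U t))"
      using integrable_bounded_linear[OF L i] by (simp only: eq set_integrable_def)
    show "L (LBINT t:{0..x}. p t *\<^sub>R U t) = (LBINT t:{0..x}. p t * L (U t))"
      using integral_bounded_linear[OF L i] by (simp only: eq set_lebesgue_integral_def)
  qed
  show ac2: "ac_on X (\<lambda>x. L (V x)) (\<lambda>x. (q x + \<kappa>\<^sup>2) * L (U x))"
  proof (rule ac_onI)
    show "set_integrable lborel {0..X} (\<lambda>x. (q x + \<kappa>\<^sup>2) * L (U x))"
      using LpU(1)[of X] X by (simp add: p_def)
    fix x assume x: "x \<in> {0..X}"
    have "L (V x) = L (V 0) + L (LBINT t:{0..x}. p t *\<^sub>R U t)"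
      unfolding L.add[symmetric] using V[OF x] by (rule arg_cong)
    thus "(LBINT t:{0..x}. (q t + \<kappa>\<^sup>2) * L (U t)) = L (V x) - L (V 0)"
      using LpU(2)[OF x] by (simp add: p_def)
  qed
  show "ac_on X (\<lambda>x. L (U x)) (\<lambda>x. L (V x))"
  proof (rule ac_on_C1)
    show "((\<lambda>x. L (U x)) has_real_derivative L (V x)) (at x within {0..X})" if "x \<in> {0..X}" for x
      using L.has_vector_derivative[OF dU[OF that]] by (simp add: has_real_derivative_iff_has_vector_derivative)
  qed (rule ac_on_continuous[OF ac2])
qed

context halfline_potential
begin

text \<open>Uniqueness of the Weyl solution. The Wronskians c and A of L(U) with \<psi> and with u
  are constant, and L(U) = c u - A \<psi>. The condition at the right end forces c = 0, so U is a
  multiple of \<psi>; if U(0) were 0, then A = 0 as \<psi>(0) is not 0, and U would vanish on (0,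
  b).\<close>

lemma weyl_solution_quotient:
  fixes b h :: ereal
  assumes b: "0 < b"
    and u: "\<And>X. ac_on X u v" and v: "\<And>X. ac_on X v (\<lambda>x. (q x + \<kappa>\<^sup>2) * u x)"
    and \<psi>: "\<And>X. ac_on X \<psi> \<psi>'" and \<psi>': "\<And>X. ac_on X \<psi>' (\<lambda>x. (q x + \<kappa>\<^sup>2) * \<psi> x)"
    and \<psi>0: "\<psi> 0 \<noteq> 0" and u1: "\<And>x. 0 \<le> x \<Longrightarrow> 1 \<le> u x"
    and wr: "\<And>x. 0 \<le> x \<Longrightarrow> \<psi>' x * u x - \<psi> x * v x = -1"
    and bc1: "b < \<infinity> \<Longrightarrow> h = \<infinity> \<Longrightarrow> \<psi> (real_of_ereal b) = 0"
    and bc2: "b < \<infinity> \<Longrightarrow> h \<noteq> \<infinity> \<Longrightarrow> \<psi>' (real_of_ereal b) + real_of_ereal h * \<psi> (real_of_ereal b) = 0"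
    and l2: "b = \<infinity> \<Longrightarrow> set_integrable lebesgue {0<..} (\<lambda>x. (\<psi> x)\<^sup>2)"
    and weyl: "weyl_solution q b h (of_real (- (\<kappa>\<^sup>2))) U V"
  shows "U 0 \<noteq> 0" "V 0 * of_real (\<psi> 0) = of_real (\<psi>' 0) * U 0"
proof -
  have sol: "schroedinger_solution q b (of_real (- (\<kappa>\<^sup>2))) U V"
    and cond: "condition_at_right_end b h U V" and nz: "\<exists>x. 0 < x \<and> ereal x < b \<and> U x \<noteq> 0"
    using weyl by (auto simp: weyl_solution_def)
  define c where "c L = L (V 0) * \<psi> 0 - L (U 0) * \<psi>' 0" for L :: "complex \<Rightarrow> real"
  define A where "A L = L (V 0) * u 0 - L (U 0) * v 0" for L :: "complex \<Rightarrow> real"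
  have wronskians: "c L = L (V x) * \<psi> x - L (U x) * \<psi>' x" "A L = L (V x) * u x - L (U x) * v x"
    and expand: "L (U x) = c L * u x - A L * \<psi> x"
    if L: "bounded_linear L" and x: "0 \<le> x" "ereal x \<le> b" for L x
  proof -
    note LU = ac_on_schroedinger_solution[OF q_integrable sol x L]
    have "ac_on x (\<lambda>t. L (V t) * \<psi> t - L (U t) * \<psi>' t) (\<lambda>_. 0)"
      by (rule ac_on_cong[OF ac_on_wronskian[OF LU \<psi> \<psi>']]) auto
    from ac_on_zero_density[OF this, of x]
    show 1: "c L = L (V x) * \<psi> x - L (U x) * \<psi>' x" using x by (simp add: c_def)
    have "ac_on x (\<lambda>t. L (V t) * u t - L (U t) * v t) (\<lambda>_. 0)"
      by (rule ac_on_cong[OF ac_on_wronskian[OF LU u v]]) auto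
    from ac_on_zero_density[OF this, of x]
    show 2: "A L = L (V x) * u x - L (U x) * v x" using x by (simp add: A_def)
    have "c L * u x - A L * \<psi> x = - (L (U x) * (\<psi>' x * u x - \<psi> x * v x))"
      unfolding 1 2 by (simp add: algebra_simps)
    thus "L (U x) = c L * u x - A L * \<psi> x" using wr[OF x(1)] by simp
  qed
  \<comment> \<open>For finite b both solutions satisfy the same condition at b, so their Wronskian
    vanishes there. For infinite b the growing part c u would contradict square
    integrability.\<close>
  have c0: "c L = 0" if L: "bounded_linear L" and Lle: "\<And>z. \<bar>L z\<bar> \<le> norm z" for L
  proof (cases "b < \<infinity>")
    case True
    then obtain r where br: "b = ereal r" using b by (cases b) auto
    hence r: "0 \<le> r" "ereal r \<le> b" using b by auto
    interpret L: bounded_linear L by fact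
    show ?thesis
    proof (cases "h = \<infinity>")
      case h: True
      have "U r = 0" using cond True h by (simp add: condition_at_right_end_def br)
      thus ?thesis using wronskians(1)[OF L r] bc1[OF True h] by (simp add: br L.zero)
    next
      case h: False
      have "V r + real_of_ereal h *\<^sub>R U r = 0"
        using cond True h by (simp add: condition_at_right_end_def br scaleR_conv_of_real)
      hence "L (V r) + real_of_ereal h * L (U r) = 0"
        unfolding L.scaleR[symmetric, simplified] L.add[symmetric] by (simp add: L.zero)
      hence "L (V r) = - real_of_ereal h * L (U r)" by simp
      moreover have "\<psi>' r = - real_of_ereal h * \<psi> r" using bc2[OF True h] by (simp add: br)
      ultimately show ?thesis using wronskians(1)[OF L r] by simp
    qed
  next
    case False
    hence binf: "b = \<infinity>" by simp
    show ?thesis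
    proof (rule ccontr)
      assume c: "c L \<noteq> 0"
      obtain R where R: "0 \<le> R" "set_integrable lebesgue {R<..} (\<lambda>x. (norm (U x))\<^sup>2)"
        using cond binf by (auto simp: condition_at_right_end_def)
      have "set_integrable lebesgue {R<..} (\<lambda>x. (\<psi> x)\<^sup>2)"
        by (rule set_integrable_subset[OF l2[OF binf]]) (use R in auto)
      hence int: "set_integrable lebesgue {R<..} (\<lambda>x. (2 / (c L)\<^sup>2) * ((A L)\<^sup>2 * (\<psi> x)\<^sup>2 + (norm (U x))\<^sup>2))"
        using R by (intro set_integrable_mult_right set_integral_add) auto
      \<comment> \<open>From u >= 1 follows c^2 <= (L(U) + A \<psi>)^2 <= 2 (A^2 \<psi>^2 + |U|^2).
        If c were nonzero, the constant 1 would be integrable on a ray.\<close>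
      have ge1: "1 \<le> (2 / (c L)\<^sup>2) * ((A L)\<^sup>2 * (\<psi> x)\<^sup>2 + (norm (U x))\<^sup>2)" if x: "R < x" for x
      proof -
        have x0: "0 \<le> x" using R x by simp
        have "(c L)\<^sup>2 * 1 \<le> (c L)\<^sup>2 * (u x)\<^sup>2"
          using u1[OF x0] by (intro mult_left_mono) (auto simp: one_le_power)
        also have "\<dots> = (L (U x) + A L * \<psi> x)\<^sup>2"
          using expand[OF L x0] binf by (simp add: power_mult_distrib)
        also have "\<dots> \<le> 2 * ((A L * \<psi> x)\<^sup>2 + (L (U x))\<^sup>2)"
          using sum_squares_bound[of "L (U x)" "A L * \<psi> x"] by (simp add: power2_sum)
        also have "(L (U x))\<^sup>2 \<le> (norm (U x))\<^sup>2"
          using Lle[of "U x"] by (metis abs_ge_zero power2_abs power_mono)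
        finally show ?thesis using c by (simp add: field_simps power_mult_distrib)
      qed
      have "integrable lebesgue (indicator {R<..} :: real \<Rightarrow> real)"
      proof (rule Bochner_Integration.integrable_bound[OF int[unfolded set_integrable_def]])
        show "AE x in lebesgue. norm (indicator {R<..} x :: real)
            \<le> norm (indicator {R<..} x *\<^sub>R ((2 / (c L)\<^sup>2) * ((A L)\<^sup>2 * (\<psi> x)\<^sup>2 + (norm (U x))\<^sup>2)))"
          using ge1 by (intro AE_I2) (auto simp: indicator_def intro: order_trans[OF _ abs_ge_self])
        show "(indicator {R<..} :: real \<Rightarrow> real) \<in> borel_measurable lebesgue"
          by (rule borel_measurable_indicator) (rule sets_completionI_sets, simp)
      qed
      hence "emeasure lebesgue {R<..} < \<infinity>"
        by (simp add: integrable_indicator_iff)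
      then obtain n :: nat where n: "emeasure lborel {R<..} < of_nat n"
        using ennreal_Ex_less_of_nat[of "emeasure lborel {R<..}"] by auto
      have "emeasure lborel {R<..R + real n} \<le> emeasure lborel {R<..}"
        by (intro emeasure_mono) auto
      with n show False by (simp add: ennreal_of_nat_eq_real_of_nat)
    qed
  qed
  have Re: "c Re = 0" and Im: "c Im = 0"
    using c0[OF bounded_linear_Re abs_Re_le_cmod] c0[OF bounded_linear_Im abs_Im_le_cmod] by auto
  thus "V 0 * of_real (\<psi> 0) = of_real (\<psi>' 0) * U 0"
    by (auto simp: complex_eq_iff c_def mult.commute)
  show "U 0 \<noteq> 0"
  proof
    assume U0: "U 0 = 0"
    obtain x where x: "0 < x" "ereal x < b" "U x \<noteq> 0" using nz by auto
    have "L (U x) = 0" if L: "bounded_linear L" and c: "c L = 0" for L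
    proof -
      interpret L: bounded_linear L by fact
      have "ereal 0 \<le> b" using b by (simp add: zero_ereal_def[symmetric] less_imp_le)
      have "A L * \<psi> 0 = 0"
        using expand[OF L order_refl \<open>ereal 0 \<le> b\<close>] U0 c by (simp add: L.zero)
      with \<psi>0 have "A L = 0" by simp
      thus ?thesis using expand[OF L, of x] x c by simp
    qed
    with Re Im x show False
      by (auto simp: complex_eq_iff bounded_linear_Re bounded_linear_Im)
  qed
qed

end

section \<open>Decay of the Weyl solution relative to its value at 0\<close>

lemma ac_on_continuous_halfline:
  assumes "\<And>X. ac_on X F d"
  shows "continuous_on {0..} F"
  unfolding continuous_on_eq_continuous_within
proof
  fix x :: real assume "x \<in> {0..}"
  hence "continuous (at x within {0..x+1}) F"
    using ac_on_continuous[OF assms, of "x+1"] by (auto simp: continuous_on_eq_continuous_within)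
  moreover have "at x within {0..x+1} = at x within {0..}"
    by (rule at_within_nhd[of x "{..<x+1}"]) auto
  ultimately show "continuous (at x within {0..}) F" by simp
qed

lemma square_integrable_of_exp_decay:
  fixes f :: "real \<Rightarrow> real"
  assumes c: "continuous_on {0..} f" and b: "\<And>x. 0 \<le> x \<Longrightarrow> \<bar>f x\<bar> \<le> K * exp (- x)"
  shows "set_integrable lebesgue {0<..} (\<lambda>x. (f x)\<^sup>2)"
proof -
  have "(\<lambda>x. (f x)\<^sup>2) absolutely_integrable_on {0..}"
  proof (rule measurable_bounded_by_integrable_imp_absolutely_integrable)
    show "(\<lambda>x. (f x)\<^sup>2) \<in> borel_measurable (lebesgue_on {0..})"
      by (intro continuous_imp_measurable_on_sets_lebesgue continuous_intros c) auto
    show "(\<lambda>x. K\<^sup>2 * exp (- 2 * x)) integrable_on {0..}"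
      using integrable_on_exp_minus_to_infinity[of 2 0] by (intro integrable_on_mult_right) simp
    fix x :: real assume "x \<in> {0..}"
    hence "\<bar>f x\<bar>\<^sup>2 \<le> (K * exp (- x))\<^sup>2"
      using b by (intro power_mono) auto
    thus "norm ((f x)\<^sup>2) \<le> K\<^sup>2 * exp (- 2 * x)"
      by (simp add: power_mult_distrib exp_double[symmetric])
  qed auto
  thus ?thesis by (rule set_integrable_subset) (auto intro!: sets_completionI_sets)
qed

context halfline_potential
begin

lemma integral_abs_q_plus_const:
  assumes "0 \<le> X" "0 \<le> c"
  shows "(LBINT t:{0..X}. \<bar>q t + c\<bar>) \<le> (LBINT t:{0..X}. \<bar>q t\<bar>) + c * X"
proof -
  have i: "set_integrable lborel {0..X} (\<lambda>t. \<bar>q t\<bar>)" by (rule set_integrable_abs[OF q_integrable])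
  have c: "set_integrable lborel {0..X} (\<lambda>t. c)"
    by (intro borel_integrable_atLeastAtMost' continuous_on_const)
  have "(LBINT t:{0..X}. \<bar>q t + c\<bar>) \<le> (LBINT t:{0..X}. \<bar>q t\<bar> + c)"
    using assms by (intro set_integral_mono set_integrable_abs[OF q_plus_const_integrable] set_integral_add i c) auto
  also have "\<dots> = (LBINT t:{0..X}. \<bar>q t\<bar>) + (LBINT t:{0..X}. c)"
    by (rule set_integral_add[OF i c])
  also have "(LBINT t:{0..X}. c) = c * X"
    using assms by (simp add: set_lebesgue_integral_def)
  finally show ?thesis .
qed

text \<open>Evaluated at x = 1/\<kappa>, the lower bound x / u(x)^2 <= \<psi>(0) shows that
  \<psi>(0) is at least of order 1/\<kappa>, since u(1/\<kappa>) is bounded independently of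
  \<kappa>. Together with \<psi> <= 2/u this bounds \<psi>(a) by \<kappa> e^(-\<kappa> a) \<psi>(0)
  up to a constant; passing to the derivative costs \<kappa>^2 more. The last conclusion allows m to
  be computed from any Weyl solution, in particular from a Jost solution.\<close>

lemma m_function_asymptotics:
  fixes b h :: ereal
  assumes b: "0 < b" and h: "b < \<infinity> \<Longrightarrow> h \<noteq> -\<infinity>" and a: "0 < a" "ereal a < b"
  obtains A \<kappa>0 where "0 \<le> A" "\<And>\<kappa>. \<kappa>0 \<le> \<kappa> \<Longrightarrow> \<exists>\<psi> \<psi>'. (\<forall>X. ac_on X \<psi> \<psi>') \<and>
      (\<forall>X. ac_on X \<psi>' (\<lambda>x. (q x + \<kappa>\<^sup>2) * \<psi> x)) \<and> 0 < \<psi> 0 \<and>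
      m_function q b h (of_real (- (\<kappa>\<^sup>2))) = of_real (\<psi>' 0 / \<psi> 0) \<and>
      \<bar>\<psi> a\<bar> \<le> A * \<kappa> ^ 3 * exp (- \<kappa> * a) * \<psi> 0 \<and> \<bar>\<psi>' a\<bar> \<le> A * \<kappa> ^ 3 * exp (- \<kappa> * a) * \<psi> 0"
    "\<And>\<kappa> U V. \<kappa>0 \<le> \<kappa> \<Longrightarrow> weyl_solution q b h (of_real (- (\<kappa>\<^sup>2))) U V \<Longrightarrow>
      U 0 \<noteq> 0 \<and> m_function q b h (of_real (- (\<kappa>\<^sup>2))) = V 0 / U 0"
proof -
  \<comment> \<open>Bounding the derivative at a requires control of \<psi> on an interval to the
    right of a, still inside (0, b).\<close>
  obtain X where X: "a < X" "ereal X < b"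
    using ereal_dense2[OF a(2)] by auto
  have X0: "0 < X" using X a by simp
  define Q where "Q Y = (LBINT t:{0..Y}. \<bar>q t\<bar>)" for Y
  have Q: "0 \<le> Q Y" for Y
    unfolding Q_def set_lebesgue_integral_def by (intro integral_nonneg_AE) auto
  \<comment> \<open>Bounds u(1/\<kappa>): there 1 + \<kappa> x equals 2, and x times the integral of
    |q + \<kappa>^2| over [0, x] is at most Q(1) + 1.\<close>
  define M where "M = 2 * exp (Q 1 + 1)"
  have M: "0 < M" by (simp add: M_def)
  define A0 where "A0 = 2 * exp ((C + 1) * a) * M\<^sup>2"
  define A where "A = A0 * (1 + 2 / (X - a) + Q X + X)"
  have A0: "0 < A0" using M by (simp add: A0_def)
  have A: "0 \<le> A" "A0 \<le> A" "A0 * (2 / (X - a) + Q X + X) \<le> A"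
    using A0 Q X X0 by (auto simp: A_def distrib_left)
  \<comment> \<open>The entries provide the growth rate, a nondegenerate boundary condition, and
    1/\<kappa> < X < b. For infinite h the value \<open>real_of_ereal h\<close> is 0, and the second
    entry repeats the first.\<close>
  define \<kappa>0 where "\<kappa>0 = max (C + 2) (max (C + 2 - real_of_ereal h) (2 / X))"
  have main: "\<exists>\<psi> \<psi>'. (\<forall>X. ac_on X \<psi> \<psi>') \<and> (\<forall>X. ac_on X \<psi>' (\<lambda>x. (q x + \<kappa>\<^sup>2) * \<psi> x)) \<and> 0 < \<psi> 0 \<and>
      m_function q b h (of_real (- (\<kappa>\<^sup>2))) = of_real (\<psi>' 0 / \<psi> 0) \<and>
      \<bar>\<psi> a\<bar> \<le> A * \<kappa> ^ 3 * exp (- \<kappa> * a) * \<psi> 0 \<and> \<bar>\<psi>' a\<bar> \<le> A * \<kappa> ^ 3 * exp (- \<kappa> * a) * \<psi> 0"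
    "\<forall>U V. weyl_solution q b h (of_real (- (\<kappa>\<^sup>2))) U V \<longrightarrow>
      U 0 \<noteq> 0 \<and> m_function q b h (of_real (- (\<kappa>\<^sup>2))) = V 0 / U 0"
    if k0: "\<kappa>0 \<le> \<kappa>" for \<kappa>
  proof -
    have k: "C + 2 \<le> \<kappa>" "C + 2 - real_of_ereal h \<le> \<kappa>" "2 / X \<le> \<kappa>"
      using k0 by (auto simp: \<kappa>0_def)
    have k1: "1 \<le> \<kappa>" using k C_nonneg by simp
    obtain u v \<psi> \<psi>' where u: "\<And>X. ac_on X u v" and v: "\<And>X. ac_on X v (\<lambda>x. (q x + \<kappa>\<^sup>2) * u x)"
      and \<psi>: "\<And>X. ac_on X \<psi> \<psi>'" and \<psi>': "\<And>X. ac_on X \<psi>' (\<lambda>x. (q x + \<kappa>\<^sup>2) * \<psi> x)"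
      and u1: "\<And>x. 0 \<le> x \<Longrightarrow> 1 \<le> u x" and uexp: "\<And>x. 0 \<le> x \<Longrightarrow> exp ((\<kappa> - C - 1) * x) \<le> u x"
      and uhi: "\<And>x. 0 \<le> x \<Longrightarrow> u x \<le> (1 + \<kappa> * x) * exp (x * (LBINT t:{0..x}. \<bar>q t + \<kappa>\<^sup>2\<bar>))"
      and wr: "\<And>x. 0 \<le> x \<Longrightarrow> \<psi>' x * u x - \<psi> x * v x = -1"
      and pos: "\<And>x. 0 \<le> x \<Longrightarrow> ereal x < b \<Longrightarrow> 0 < \<psi> x"
      and hi: "\<And>x. 0 \<le> x \<Longrightarrow> ereal x < b \<Longrightarrow> \<psi> x \<le> 2 / u x"
      and lo: "\<And>x. 0 \<le> x \<Longrightarrow> ereal x < b \<Longrightarrow> x / (u x)\<^sup>2 \<le> \<psi> 0"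
      and bc1: "b < \<infinity> \<Longrightarrow> h = \<infinity> \<Longrightarrow> \<psi> (real_of_ereal b) = 0"
      and bc2: "b < \<infinity> \<Longrightarrow> h \<noteq> \<infinity> \<Longrightarrow> \<psi>' (real_of_ereal b) + real_of_ereal h * \<psi> (real_of_ereal b) = 0"
    proof (rule recessive_solution[OF b _ k(1)])
      show "h \<noteq> -\<infinity>" if "b < \<infinity>" by (rule h[OF that])
      show "C + 2 - real_of_ereal h \<le> \<kappa>" by (rule k(2))
    qed (rule that)
    have \<psi>0: "0 < \<psi> 0" using pos[of 0] b by (simp add: zero_ereal_def)
    have decay: "\<psi> x \<le> 2 * exp (- (\<kappa> - C - 1) * x)" if "0 \<le> x" "ereal x < b" for x
    proof -
      have "2 / u x \<le> 2 / exp ((\<kappa> - C - 1) * x)"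
        using uexp[OF that(1)] u1[OF that(1)] by (intro divide_left_mono) auto
      also have "\<dots> = 2 * exp (- (\<kappa> - C - 1) * x)"
        by (simp only: mult_minus_left exp_minus divide_inverse)
      finally show ?thesis using hi[OF that] by simp
    qed
    have l2: "set_integrable lebesgue {0<..} (\<lambda>x. (\<psi> x)\<^sup>2)" if binf: "b = \<infinity>"
    proof (rule square_integrable_of_exp_decay[OF ac_on_continuous_halfline[OF \<psi>]])
      fix x :: real assume x: "0 \<le> x"
      have "- (\<kappa> - C - 1) * x \<le> - 1 * x"
        using k x by (intro mult_right_mono) auto
      hence "exp (- (\<kappa> - C - 1) * x) \<le> exp (- x)" by simp
      moreover have "\<psi> x \<le> 2 * exp (- (\<kappa> - C - 1) * x)" using x binf by (intro decay) auto
      ultimately have "\<psi> x \<le> 2 * exp (- x)" by linarith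
      thus "\<bar>\<psi> x\<bar> \<le> 2 * exp (- x)" using pos[of x] x binf by simp
    qed
    have quot: "U 0 \<noteq> 0" "V 0 * of_real (\<psi> 0) = of_real (\<psi>' 0) * U 0"
      if "weyl_solution q b h (of_real (- (\<kappa>\<^sup>2))) U V" for U V
      by (rule weyl_solution_quotient[OF b u v \<psi> \<psi>' less_imp_neq[OF \<psi>0, symmetric] u1 wr bc1 bc2 l2 that];
          assumption)+
    have "condition_at_right_end b h (\<lambda>x. of_real (\<psi> x)) (\<lambda>x. of_real (\<psi>' x))"
    proof (cases "b < \<infinity>")
      case True
      have "complex_of_real (\<psi>' (real_of_ereal b)) + of_real (real_of_ereal h) * of_real (\<psi> (real_of_ereal b)) = 0" if "h \<noteq> \<infinity>"
        using bc2[OF True that] by (simp flip: of_real_mult of_real_add)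
      thus ?thesis using bc1[OF True] True by (auto simp: condition_at_right_end_def)
    next
      case False
      thus ?thesis using l2 by (auto simp: condition_at_right_end_def intro!: exI[of _ 0])
    qed
    moreover have "\<exists>x. 0 < x \<and> ereal x < b \<and> complex_of_real (\<psi> x) \<noteq> 0"
      using pos[of a] a by (intro exI[of _ a]) auto
    ultimately have weyl: "weyl_solution q b h (of_real (- (\<kappa>\<^sup>2))) (\<lambda>x. of_real (\<psi> x)) (\<lambda>x. of_real (\<psi>' x))"
      using schroedinger_solution_of_real[OF \<psi> \<psi>'] by (simp add: weyl_solution_def)
    have quot': "V 0 / U 0 = of_real (\<psi>' 0 / \<psi> 0)"
      if "weyl_solution q b h (of_real (- (\<kappa>\<^sup>2))) U V" for U V
      using quot[OF that] \<psi>0 by (simp add: field_simps)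
    have m: "m_function q b h (of_real (- (\<kappa>\<^sup>2))) = of_real (\<psi>' 0 / \<psi> 0)"
      unfolding m_function_def
    proof (rule the_equality)
      show "\<exists>u v. weyl_solution q b h (of_real (- (\<kappa>\<^sup>2))) u v \<and> of_real (\<psi>' 0 / \<psi> 0) = v 0 / u 0"
        using weyl quot'[OF weyl] by metis
    qed (use quot' in metis)
    show "\<forall>U V. weyl_solution q b h (of_real (- (\<kappa>\<^sup>2))) U V \<longrightarrow>
      U 0 \<noteq> 0 \<and> m_function q b h (of_real (- (\<kappa>\<^sup>2))) = V 0 / U 0"
      using quot(1) quot' m by simp
    define B where "B = A0 * \<kappa> * exp (- \<kappa> * a) * \<psi> 0"
    have \<psi>b: "\<bar>\<psi> t\<bar> \<le> B" if t: "t \<in> {a..X}" for t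
    proof -
      have t0: "0 \<le> t" and tb: "ereal t < b"
        using t a X by (auto intro: le_less_trans[of "ereal t" "ereal X"])
      have "1 / \<kappa> \<le> X / 2" using k(3) X0 k1 by (simp add: field_simps)
      hence kb: "ereal (1 / \<kappa>) < b" using X X0 by (intro le_less_trans[OF _ X(2)]) simp
      have "(LBINT t:{0..1/\<kappa>}. \<bar>q t + \<kappa>\<^sup>2\<bar>) \<le> Q (1 / \<kappa>) + \<kappa>"
        using integral_abs_q_plus_const[of "1/\<kappa>" "\<kappa>\<^sup>2"] k1 by (simp add: Q_def power2_eq_square)
      also have "Q (1 / \<kappa>) \<le> Q 1"
        unfolding Q_def using k1 by (intro set_integral_nonneg_mono set_integrable_abs q_integrable) auto
      finally have "(1 / \<kappa>) * (LBINT t:{0..1/\<kappa>}. \<bar>q t + \<kappa>\<^sup>2\<bar>) \<le> (1 / \<kappa>) * (Q 1 + \<kappa>)"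
        using k1 by (intro mult_left_mono) auto
      also have "\<dots> \<le> Q 1 + 1"
        using k1 Q[of 1] mult_left_mono[OF k1 Q[of 1]] by (simp add: field_simps)
      finally have "exp ((1 / \<kappa>) * (LBINT t:{0..1/\<kappa>}. \<bar>q t + \<kappa>\<^sup>2\<bar>)) \<le> exp (Q 1 + 1)" by simp
      moreover have "u (1 / \<kappa>) \<le> 2 * exp ((1 / \<kappa>) * (LBINT t:{0..1/\<kappa>}. \<bar>q t + \<kappa>\<^sup>2\<bar>))"
        using uhi[of "1 / \<kappa>"] k1 by simp
      ultimately have "u (1 / \<kappa>) \<le> M" unfolding M_def by linarith
      hence "(1 / \<kappa>) / M\<^sup>2 \<le> (1 / \<kappa>) / (u (1 / \<kappa>))\<^sup>2"
        using u1[of "1 / \<kappa>"] k1 M by (intro divide_left_mono power_mono mult_pos_pos) auto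
      also have "\<dots> \<le> \<psi> 0" using lo[OF _ kb] k1 by simp
      finally have "1 \<le> \<psi> 0 * (\<kappa> * M\<^sup>2)" using k1 M by (simp add: field_simps)
      have "\<psi> t \<le> 2 * exp (- (\<kappa> - C - 1) * t)" by (rule decay[OF t0 tb])
      also have "\<dots> \<le> 2 * exp (- (\<kappa> - C - 1) * a)"
        using t k by simp
      also have "\<dots> = 2 * exp ((C + 1) * a) * exp (- \<kappa> * a) * 1"
        by (simp add: exp_add[symmetric] algebra_simps)
      also have "\<dots> \<le> 2 * exp ((C + 1) * a) * exp (- \<kappa> * a) * (\<psi> 0 * (\<kappa> * M\<^sup>2))"
        using \<open>1 \<le> \<psi> 0 * (\<kappa> * M\<^sup>2)\<close> by (intro mult_left_mono) auto
      also have "\<dots> = B" by (simp add: B_def A0_def mult_ac)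
      finally show ?thesis using pos[OF t0 tb] by simp
    qed
    have B0: "0 \<le> B" using A0 k1 \<psi>0 by (simp add: B_def)
    have D: "0 \<le> \<kappa> * exp (- \<kappa> * a) * \<psi> 0" using k1 \<psi>0 by simp
    have k3: "\<kappa> \<le> \<kappa> ^ 3" using k1 by (simp add: self_le_power)
    have "B \<le> A * \<kappa> ^ 3 * exp (- \<kappa> * a) * \<psi> 0"
      unfolding B_def using A A0 k1 k3 \<psi>0 by (intro mult_mono) auto
    hence b1: "\<bar>\<psi> a\<bar> \<le> A * \<kappa> ^ 3 * exp (- \<kappa> * a) * \<psi> 0"
      using \<psi>b[of a] X by simp
    have "\<bar>\<psi>' a\<bar> \<le> 2 * B / (X - a) + B * (LBINT t:{0..X}. \<bar>q t + \<kappa>\<^sup>2\<bar>)"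
      by (rule ac_on_derivative_bound[OF \<psi> \<psi>' q_plus_const_integrable _ X(1) \<psi>b]) (use a in auto)
    also have "\<dots> \<le> 2 * B / (X - a) + B * (Q X + \<kappa>\<^sup>2 * X)"
      using integral_abs_q_plus_const[of X "\<kappa>\<^sup>2"] X0 B0 by (intro add_left_mono mult_left_mono) (auto simp: Q_def)
    also have "\<dots> = B * (2 / (X - a) + Q X + \<kappa>\<^sup>2 * X)" by (simp add: algebra_simps)
    also have "\<dots> \<le> B * (\<kappa>\<^sup>2 * (2 / (X - a) + Q X + X))"
    proof (rule mult_left_mono[OF _ B0])
      have "1 \<le> \<kappa>\<^sup>2" using k1 by simp
      hence "1 * (2 / (X - a) + Q X) \<le> \<kappa>\<^sup>2 * (2 / (X - a) + Q X)"
        using X Q[of X] by (intro mult_right_mono) auto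
      thus "2 / (X - a) + Q X + \<kappa>\<^sup>2 * X \<le> \<kappa>\<^sup>2 * (2 / (X - a) + Q X + X)"
        by (simp add: distrib_left)
    qed
    also have "\<dots> = (A0 * (2 / (X - a) + Q X + X)) * (\<kappa> ^ 3 * exp (- \<kappa> * a) * \<psi> 0)"
      by (simp add: B_def power2_eq_square power3_eq_cube mult_ac)
    also have "\<dots> \<le> A * (\<kappa> ^ 3 * exp (- \<kappa> * a) * \<psi> 0)"
      using A k1 \<psi>0 by (intro mult_right_mono) auto
    finally have b2: "\<bar>\<psi>' a\<bar> \<le> A * \<kappa> ^ 3 * exp (- \<kappa> * a) * \<psi> 0" by (simp add: mult_ac)
    show "\<exists>\<psi> \<psi>'. (\<forall>X. ac_on X \<psi> \<psi>') \<and> (\<forall>X. ac_on X \<psi>' (\<lambda>x. (q x + \<kappa>\<^sup>2) * \<psi> x)) \<and> 0 < \<psi> 0 \<and>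
      m_function q b h (of_real (- (\<kappa>\<^sup>2))) = of_real (\<psi>' 0 / \<psi> 0) \<and>
      \<bar>\<psi> a\<bar> \<le> A * \<kappa> ^ 3 * exp (- \<kappa> * a) * \<psi> 0 \<and> \<bar>\<psi>' a\<bar> \<le> A * \<kappa> ^ 3 * exp (- \<kappa> * a) * \<psi> 0"
      using \<psi> \<psi>' \<psi>0 m b1 b2 by blast
  qed
  show ?thesis by (rule that[of A \<kappa>0]) (use A main in blast)+
qed

end

section \<open>Potentials agreeing on an initial interval\<close>

lemma soft_bigo_add:
  assumes "soft_bigo F f w" "soft_bigo F g w"
  shows "soft_bigo F (\<lambda>x. f x + g x) w"
  unfolding soft_bigo_def
proof (intro allI impI)
  fix \<epsilon> :: real assume "0 < \<epsilon>"
  hence lim: "((\<lambda>x. norm (f x) / norm (w x) powr (1 - \<epsilon>) + norm (g x) / norm (w x) powr (1 - \<epsilon>)) \<longlongrightarrow> 0) F"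
    using assms by (intro tendsto_add_zero) (auto simp: soft_bigo_def)
  have "norm (f x + g x) / norm (w x) powr (1 - \<epsilon>)
      \<le> norm (f x) / norm (w x) powr (1 - \<epsilon>) + norm (g x) / norm (w x) powr (1 - \<epsilon>)" for x
    unfolding add_divide_distrib[symmetric] by (intro divide_right_mono norm_triangle_ineq) simp
  thus "((\<lambda>x. norm (f x + g x) / norm (w x) powr (1 - \<epsilon>)) \<longlongrightarrow> 0) F"
    by (intro tendsto_sandwich[OF _ _ tendsto_const lim]) simp_all
qed

text \<open>Dividing by the power 1 - \<epsilon> leaves A \<kappa>^n e^(-c \<kappa>) with c = 2 a
  \<epsilon> > 0, which tends to 0 for every n.\<close>

lemma soft_bigo_polynomial_exp:
  fixes f :: "real \<Rightarrow> 'a::real_normed_vector"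
  assumes a: "0 < a" and f: "\<And>\<kappa>. \<kappa>0 \<le> \<kappa> \<Longrightarrow> norm (f \<kappa>) \<le> A * \<kappa> ^ n * exp (- 2 * \<kappa> * a)"
  shows "soft_bigo at_top f (\<lambda>\<kappa>. exp (- 2 * \<kappa> * a))"
  unfolding soft_bigo_def
proof (intro allI impI)
  fix \<epsilon> :: real assume \<epsilon>: "0 < \<epsilon>"
  define c where "c = 2 * a * \<epsilon>"
  have c: "0 < c" using a \<epsilon> by (simp add: c_def)
  have "LIM \<kappa> at_top. c * \<kappa> :> at_top"
    using c by (intro filterlim_tendsto_pos_mult_at_top[OF tendsto_const] filterlim_ident) auto
  hence "((\<lambda>\<kappa>. (c * \<kappa>) ^ n / exp (c * \<kappa>)) \<longlongrightarrow> 0) at_top"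
    by (rule filterlim_compose[OF tendsto_power_div_exp_0])
  hence lim: "((\<lambda>\<kappa>. (A / c ^ n) * ((c * \<kappa>) ^ n / exp (c * \<kappa>))) \<longlongrightarrow> 0) at_top"
    by (rule tendsto_mult_right_zero)
  show "((\<lambda>\<kappa>. norm (f \<kappa>) / norm (exp (- 2 * \<kappa> * a)) powr (1 - \<epsilon>)) \<longlongrightarrow> 0) at_top"
  proof (rule tendsto_sandwich[OF _ _ tendsto_const lim])
    show "eventually (\<lambda>\<kappa>. norm (f \<kappa>) / norm (exp (- 2 * \<kappa> * a)) powr (1 - \<epsilon>)
        \<le> (A / c ^ n) * ((c * \<kappa>) ^ n / exp (c * \<kappa>))) at_top"
      using eventually_ge_at_top[of \<kappa>0]
    proof eventually_elim
      case (elim \<kappa>)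
      have "norm (exp (- 2 * \<kappa> * a)) powr (1 - \<epsilon>) = exp (- 2 * \<kappa> * a * (1 - \<epsilon>))"
        by (simp add: powr_def)
      hence "norm (f \<kappa>) / norm (exp (- 2 * \<kappa> * a)) powr (1 - \<epsilon>)
          \<le> A * \<kappa> ^ n * exp (- 2 * \<kappa> * a) / exp (- 2 * \<kappa> * a * (1 - \<epsilon>))"
        using f[OF elim] by (simp add: divide_right_mono)
      also have "\<dots> = A * \<kappa> ^ n * exp (- (c * \<kappa>))"
      proof -
        have "exp (- 2 * \<kappa> * a) / exp (- 2 * \<kappa> * a * (1 - \<epsilon>)) = exp (- (c * \<kappa>))"
          unfolding exp_diff[symmetric] by (simp add: c_def algebra_simps)
        thus ?thesis by (metis times_divide_eq_right)
      qed
      also have "\<dots> = (A / c ^ n) * ((c * \<kappa>) ^ n / exp (c * \<kappa>))"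
        using c by (simp add: power_mult_distrib exp_minus divide_inverse)
      finally show ?case .
    qed
  qed auto
qed

text \<open>Each boundary value at a carries a factor \<kappa>^3 e^(-\<kappa> a), so W(a) is of
  order \<kappa>^6 e^(-2 \<kappa> a) relative to \<psi>1(0) \<psi>2(0). The right ends and their
  conditions may differ, which is what allows a comparison of a potential with its truncation on the
  half-line.\<close>

lemma m_function_difference_soft_bigo:
  fixes b1 b2 h1 h2 :: ereal
  assumes q1: "halfline_potential q1 C1" and q2: "halfline_potential q2 C2"
    and b1: "0 < b1" "b1 < \<infinity> \<Longrightarrow> h1 \<noteq> -\<infinity>" and b2: "0 < b2" "b2 < \<infinity> \<Longrightarrow> h2 \<noteq> -\<infinity>"
    and a: "0 < a" "ereal a < b1" "ereal a < b2"
    and eq: "AE x in lborel. x \<in> {0<..<a} \<longrightarrow> q1 x = q2 x"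
  shows "soft_bigo at_top
    (\<lambda>\<kappa>::real. m_function q1 b1 h1 (of_real (- (\<kappa>\<^sup>2))) - m_function q2 b2 h2 (of_real (- (\<kappa>\<^sup>2))))
    (\<lambda>\<kappa>::real. exp (- 2 * \<kappa> * a))"
proof -
  obtain A1 k1 where A1: "0 \<le> A1" and k1: "\<And>\<kappa>. k1 \<le> \<kappa> \<Longrightarrow> \<exists>\<psi> \<psi>'. (\<forall>X. ac_on X \<psi> \<psi>') \<and>
      (\<forall>X. ac_on X \<psi>' (\<lambda>x. (q1 x + \<kappa>\<^sup>2) * \<psi> x)) \<and> 0 < \<psi> 0 \<and>
      m_function q1 b1 h1 (of_real (- (\<kappa>\<^sup>2))) = of_real (\<psi>' 0 / \<psi> 0) \<and>
      \<bar>\<psi> a\<bar> \<le> A1 * \<kappa> ^ 3 * exp (- \<kappa> * a) * \<psi> 0 \<and> \<bar>\<psi>' a\<bar> \<le> A1 * \<kappa> ^ 3 * exp (- \<kappa> * a) * \<psi> 0"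
    by (rule halfline_potential.m_function_asymptotics[OF q1 b1 a(1,2)]) (blast+)?
  obtain A2 k2 where A2: "0 \<le> A2" and k2: "\<And>\<kappa>. k2 \<le> \<kappa> \<Longrightarrow> \<exists>\<psi> \<psi>'. (\<forall>X. ac_on X \<psi> \<psi>') \<and>
      (\<forall>X. ac_on X \<psi>' (\<lambda>x. (q2 x + \<kappa>\<^sup>2) * \<psi> x)) \<and> 0 < \<psi> 0 \<and>
      m_function q2 b2 h2 (of_real (- (\<kappa>\<^sup>2))) = of_real (\<psi>' 0 / \<psi> 0) \<and>
      \<bar>\<psi> a\<bar> \<le> A2 * \<kappa> ^ 3 * exp (- \<kappa> * a) * \<psi> 0 \<and> \<bar>\<psi>' a\<bar> \<le> A2 * \<kappa> ^ 3 * exp (- \<kappa> * a) * \<psi> 0"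
    by (rule halfline_potential.m_function_asymptotics[OF q2 b2 a(1,3)]) (blast+)?
  show ?thesis
  proof (rule soft_bigo_polynomial_exp[OF a(1)])
    fix \<kappa> assume "max k1 k2 \<le> \<kappa>"
    hence k: "k1 \<le> \<kappa>" "k2 \<le> \<kappa>" by auto
    define E where "E = \<kappa> ^ 3 * exp (- \<kappa> * a)"
    obtain \<psi>1 \<psi>1' where \<psi>1: "ac_on a \<psi>1 \<psi>1'" "ac_on a \<psi>1' (\<lambda>x. (q1 x + \<kappa>\<^sup>2) * \<psi>1 x)" "0 < \<psi>1 0"
      "m_function q1 b1 h1 (of_real (- (\<kappa>\<^sup>2))) = of_real (\<psi>1' 0 / \<psi>1 0)"
      "\<bar>\<psi>1 a\<bar> \<le> A1 * E * \<psi>1 0" "\<bar>\<psi>1' a\<bar> \<le> A1 * E * \<psi>1 0"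
      using k1[OF k(1)] unfolding E_def mult.assoc by blast
    obtain \<psi>2 \<psi>2' where \<psi>2: "ac_on a \<psi>2 \<psi>2'" "ac_on a \<psi>2' (\<lambda>x. (q2 x + \<kappa>\<^sup>2) * \<psi>2 x)" "0 < \<psi>2 0"
      "m_function q2 b2 h2 (of_real (- (\<kappa>\<^sup>2))) = of_real (\<psi>2' 0 / \<psi>2 0)"
      "\<bar>\<psi>2 a\<bar> \<le> A2 * E * \<psi>2 0" "\<bar>\<psi>2' a\<bar> \<le> A2 * E * \<psi>2 0"
      using k2[OF k(2)] unfolding E_def mult.assoc by blast
    define W where "W x = \<psi>1' x * \<psi>2 x - \<psi>1 x * \<psi>2' x" for x
    have "ac_on a W (\<lambda>x. ((q1 x + \<kappa>\<^sup>2) - (q2 x + \<kappa>\<^sup>2)) * \<psi>1 x * \<psi>2 x)"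
      unfolding W_def[abs_def] by (rule ac_on_wronskian[OF \<psi>1(1,2) \<psi>2(1,2)])
    hence "W a - W 0 = (LBINT t:{0..a}. ((q1 t + \<kappa>\<^sup>2) - (q2 t + \<kappa>\<^sup>2)) * \<psi>1 t * \<psi>2 t)"
      using ac_onD[of a W _ a] a by simp
    also have "\<dots> = 0"
      unfolding set_lebesgue_integral_def
    proof (rule integral_eq_zero_AE)
      show "AE t in lborel. indicator {0..a} t *\<^sub>R (((q1 t + \<kappa>\<^sup>2) - (q2 t + \<kappa>\<^sup>2)) * \<psi>1 t * \<psi>2 t) = 0"
        using eq AE_lborel_singleton[of 0] AE_lborel_singleton[of a]
        by eventually_elim (auto simp: indicator_def)
    qed
    finally have W: "W 0 = W a" by simp
    have "m_function q1 b1 h1 (of_real (- (\<kappa>\<^sup>2))) - m_function q2 b2 h2 (of_real (- (\<kappa>\<^sup>2)))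
        = of_real (W a / (\<psi>1 0 * \<psi>2 0))"
    proof -
      have "\<psi>1' 0 / \<psi>1 0 - \<psi>2' 0 / \<psi>2 0 = W 0 / (\<psi>1 0 * \<psi>2 0)"
        using \<psi>1(3) \<psi>2(3) by (simp add: W_def field_simps)
      thus ?thesis unfolding \<psi>1(4) \<psi>2(4) W of_real_diff[symmetric] by simp
    qed
    hence "norm (m_function q1 b1 h1 (of_real (- (\<kappa>\<^sup>2))) - m_function q2 b2 h2 (of_real (- (\<kappa>\<^sup>2))))
        = \<bar>W a\<bar> / (\<psi>1 0 * \<psi>2 0)"
      using \<psi>1(3) \<psi>2(3) by (simp only: norm_of_real) (simp add: abs_mult)
    also have "\<bar>W a\<bar> \<le> (A1 * E * \<psi>1 0) * (A2 * E * \<psi>2 0) + (A1 * E * \<psi>1 0) * (A2 * E * \<psi>2 0)"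
    proof -
      have "\<bar>W a\<bar> \<le> \<bar>\<psi>1' a\<bar> * \<bar>\<psi>2 a\<bar> + \<bar>\<psi>1 a\<bar> * \<bar>\<psi>2' a\<bar>"
        unfolding W_def abs_mult[symmetric] by linarith
      also have "\<dots> \<le> (A1 * E * \<psi>1 0) * (A2 * E * \<psi>2 0) + (A1 * E * \<psi>1 0) * (A2 * E * \<psi>2 0)"
        using \<psi>1(5,6) \<psi>2(5,6) order_trans[OF abs_ge_zero \<psi>1(5)]
        by (intro add_mono mult_mono) auto
      finally show ?thesis .
    qed
    also have "\<dots> / (\<psi>1 0 * \<psi>2 0) = 2 * A1 * A2 * E\<^sup>2"
      using \<psi>1(3) \<psi>2(3) by (simp add: field_simps power2_eq_square)
    also have "E\<^sup>2 = \<kappa> ^ 6 * exp (- 2 * \<kappa> * a)"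
      by (simp add: E_def power_mult_distrib exp_double[symmetric] mult.assoc flip: power_mult)
    finally show "norm (m_function q1 b1 h1 (of_real (- (\<kappa>\<^sup>2))) - m_function q2 b2 h2 (of_real (- (\<kappa>\<^sup>2))))
        \<le> (2 * A1 * A2) * \<kappa> ^ 6 * exp (- 2 * \<kappa> * a)"
      using \<psi>1(3) \<psi>2(3) by (simp add: divide_right_mono mult.assoc)
  qed
qed

section \<open>The Marchenko kernel and Jost solutions\<close>

lemma integral_exp_on_Icc:
  fixes c :: real
  assumes "c \<noteq> 0"
  shows "(LBINT r:{x..y}. exp (c * r)) = (if x \<le> y then (exp (c * y) - exp (c * x)) / c else 0)"
proof (cases "x \<le> y")
  case True
  have "(\<integral>r. exp (c * r) * indicator {x..y} r \<partial>lborel) = exp (c * y) / c - exp (c * x) / c"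
    using assms True
    by (intro integral_FTC_Icc_real[where F = "\<lambda>r. exp (c * r) / c"])
       (auto intro!: derivative_eq_intros continuous_intros)
  thus ?thesis using True by (simp add: set_lebesgue_integral_def mult.commute diff_divide_distrib)
qed (simp add: set_lebesgue_integral_def)

lemma integrable_exp_halfline:
  fixes c :: real
  assumes "c < 0"
  shows "integrable lborel (\<lambda>s. indicator {x..} s * exp (c * s))"
    and "(LBINT s. indicator {x..} s * exp (c * s)) = exp (c * x) / (- c)"
proof -
  have h: "((\<lambda>s. exp (c * s)) has_integral exp (c * x) / (- c)) {x..}"
    using has_integral_exp_minus_to_infinity[of "-c" x] assms by simp
  hence "(\<lambda>s. exp (c * s)) absolutely_integrable_on {x..}"
    by (intro nonnegative_absolutely_integrable_1) (auto simp: has_integral_integrable)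
  hence s: "set_integrable lborel {x..} (\<lambda>s. exp (c * s))"
    unfolding set_integrable_def by (subst (asm) integrable_completion) auto
  thus "integrable lborel (\<lambda>s. indicator {x..} s * exp (c * s))"
    by (simp add: set_integrable_def)
  show "(LBINT s. indicator {x..} s * exp (c * s)) = exp (c * x) / (- c)"
    using set_borel_integral_eq_integral(2)[OF s] integral_unique[OF h] by (simp add: set_lebesgue_integral_def)
qed

lemma (in pair_sigma_finite) integrable_product:
  fixes f :: "'a \<Rightarrow> real" and g :: "'b \<Rightarrow> real"
  assumes f: "integrable M1 f" and g: "integrable M2 g"
  shows "integrable (M1 \<Otimes>\<^sub>M M2) (\<lambda>(s,t). f s * g t)"
    and "(\<integral>(s,t). f s * g t \<partial>(M1 \<Otimes>\<^sub>M M2)) = (\<integral>s. f s \<partial>M1) * (\<integral>t. g t \<partial>M2)"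
proof -
  have [measurable]: "f \<in> borel_measurable M1" "g \<in> borel_measurable M2"
    using f g by (auto dest: borel_measurable_integrable)
  show i: "integrable (M1 \<Otimes>\<^sub>M M2) (\<lambda>(s,t). f s * g t)"
  proof (rule Fubini_integrable)
    show "integrable M1 (\<lambda>s. \<integral>t. norm (case (s, t) of (s, t) \<Rightarrow> f s * g t) \<partial>M2)"
      using f by (simp add: abs_mult)
    show "AE s in M1. integrable M2 (\<lambda>t. case (s, t) of (s, t) \<Rightarrow> f s * g t)"
      using g by simp
  qed measurable
  show "(\<integral>(s,t). f s * g t \<partial>(M1 \<Otimes>\<^sub>M M2)) = (\<integral>s. f s \<partial>M1) * (\<integral>t. g t \<partial>M2)"
    using integral_fst'[OF i] by simp
qed

lemma sigma_finite_lborel_pair: "sigma_finite_measure (lborel \<Otimes>\<^sub>M lborel :: (real \<times> real) measure)"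
  by (simp add: lborel_prod lborel.sigma_finite_measure_axioms)

lemma integral_power_max:
  assumes "0 \<le> N"
  shows "integrable lborel (\<lambda>s. indicator {0..r} s * (N * max s 0) ^ n)"
    and "(LBINT s. indicator {0..r} s * (N * max s 0) ^ n) = N ^ n * max r 0 ^ Suc n / real (Suc n)"
proof -
  have "continuous_on {0..r} (\<lambda>s. (N * max s 0) ^ n)" by (intro continuous_intros)
  from borel_integrable_atLeastAtMost'[OF this]
  show "integrable lborel (\<lambda>s. indicator {0..r} s * (N * max s 0) ^ n)"
    by (simp add: set_integrable_def)
  show "(LBINT s. indicator {0..r} s * (N * max s 0) ^ n) = N ^ n * max r 0 ^ Suc n / real (Suc n)"
  proof (cases "0 \<le> r")
    case True
    have "(\<integral>s. (N ^ n * s ^ n) * indicator {0..r} s \<partial>lborel)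
        = N ^ n * r ^ Suc n / real (Suc n) - N ^ n * 0 ^ Suc n / real (Suc n)"
      using True
      by (intro integral_FTC_Icc_real[where F = "\<lambda>s. N ^ n * s ^ Suc n / real (Suc n)"])
         (auto intro!: derivative_eq_intros continuous_intros simp del: of_nat_Suc power_Suc)
    moreover have "(LBINT s. indicator {0..r} s * (N * max s 0) ^ n) = (\<integral>s. (N ^ n * s ^ n) * indicator {0..r} s \<partial>lborel)"
      by (intro Bochner_Integration.integral_cong) (auto simp: indicator_def power_mult_distrib)
    ultimately show ?thesis using True by simp
  qed simp
qed

text \<open>The equation arises as follows: insert g(x) = 1 + integral_0^infinity B(x,r) e^(-2
  \<kappa> r) dr into g(x) = 1 + integral_x^infinity (1 - e^(-2 \<kappa> (t-x))) / (2 \<kappa>) q(t)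
  g(t) dt and compare Laplace transforms; \<kappa> drops out. In the Volterra iteration the
  integration over s in [0, r] yields the factorials, and the one over t only a factor N. The growth
  e^(N r) is harmless because \<kappa> is large.\<close>

lemma marchenko_kernel:
  fixes q :: "real \<Rightarrow> real"
  assumes q: "integrable lborel q" and N: "N = (LBINT t. \<bar>q t\<bar>)"
  obtains B :: "real \<times> real \<Rightarrow> real" where "B \<in> borel_measurable (lborel \<Otimes>\<^sub>M lborel)"
    and "\<And>x r. \<bar>B (x, r)\<bar> \<le> N * exp (N * max r 0)"
    and "\<And>x r. B (x, r) = (LBINT t. indicator {x+r..} t * q t) +
      (\<integral>(t, s). indicator {0..r} s * indicator {x+r-s..} t * q t * B (t, s) \<partial>(lborel \<Otimes>\<^sub>M lborel))"
proof -
  let ?M = "lborel \<Otimes>\<^sub>M lborel :: (real \<times> real) measure"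
  have [measurable]: "q \<in> borel_measurable borel"
    using q by (auto dest: borel_measurable_integrable)
  have N0: "0 \<le> N" unfolding N by simp
  define k where "k z y = (case z of (x, r) \<Rightarrow> case y of (t, s) \<Rightarrow>
    (if 0 \<le> s \<and> s \<le> r \<and> x + r - s \<le> t then q t else 0))" for z y :: "real \<times> real"
  define f0 where "f0 z = (case z of (x, r) \<Rightarrow> LBINT t. (if x + r \<le> t then q t else 0))" for z :: "real \<times> real"
  define w where "w z = N * max (snd z) 0" for z :: "real \<times> real"
  have k_abs: "\<bar>k (x, r) (t, s)\<bar> \<le> \<bar>q t\<bar> * indicator {0..r} s" for x r t s
    by (auto simp: k_def indicator_def)
  obtain B where Bm: "B \<in> borel_measurable ?M"
    and Bb: "\<And>z. \<bar>B z\<bar> \<le> N * exp (w z)"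
    and Beq: "\<And>z. B z = f0 z + (\<integral>y. k z y * B y \<partial>?M)"
  proof (rule volterra_solution[of ?M k f0 "\<lambda>_. N" w])
    show "sigma_finite_measure ?M" by (rule sigma_finite_lborel_pair)
    show "case_prod k \<in> borel_measurable (?M \<Otimes>\<^sub>M ?M)"
      unfolding k_def by measurable
    show "f0 \<in> borel_measurable ?M"
      unfolding f0_def by measurable
    show "w \<in> borel_measurable ?M"
      unfolding w_def by measurable
    show "\<bar>f0 z\<bar> \<le> N" for z
    proof (cases z)
      case (Pair x r)
      have "\<bar>f0 z\<bar> \<le> (LBINT t. \<bar>if x + r \<le> t then q t else 0\<bar>)"
        unfolding f0_def Pair by (simp add: integral_abs_bound)
      also have "\<dots> \<le> N"
        unfolding N
      proof (rule integral_mono)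
        show "integrable lborel (\<lambda>t. \<bar>if x + r \<le> t then q t else 0\<bar>)"
          by (rule Bochner_Integration.integrable_bound[OF q]) auto
      qed (use q in auto)
      finally show ?thesis .
    qed
    show "integrable ?M (\<lambda>y. k z y * (N * exp (w y)))" for z
    proof (cases z)
      case (Pair x r)
      have i1: "integrable lborel (\<lambda>s. indicator {0..r} s * (N * exp (N * max s 0)))"
        using borel_integrable_atLeastAtMost'[of 0 r "\<lambda>s. N * exp (N * max s 0)"]
        by (simp add: set_integrable_def continuous_intros)
      show ?thesis
      proof (rule Bochner_Integration.integrable_bound[OF lborel_pair.integrable_product(1)[OF q i1]])
        show "(\<lambda>y. k z y * (N * exp (w y))) \<in> borel_measurable ?M"
          unfolding k_def w_def Pair by measurable
        show "AE y in ?M. norm (k z y * (N * exp (w y)))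
            \<le> norm (case y of (t, s) \<Rightarrow> q t * (indicator {0..r} s * (N * exp (N * max s 0))))"
          using N0 by (intro AE_I2) (auto simp: k_def w_def Pair indicator_def abs_mult)
      qed
    qed
    show "(\<integral>y. \<bar>k z y\<bar> * (N * w y ^ n) \<partial>?M) \<le> N * w z ^ Suc n / real (Suc n)" for n z
    proof (cases z)
      case (Pair x r)
      have aq: "integrable lborel (\<lambda>t. \<bar>q t\<bar>)" using q by simp
      note pw = integral_power_max[OF N0, of r n]
      have ip: "integrable lborel (\<lambda>s. N * (indicator {0..r} s * (N * max s 0) ^ n))"
        using pw(1) by simp
      have "(\<integral>y. \<bar>k z y\<bar> * (N * w y ^ n) \<partial>?M)
          \<le> (\<integral>(t, s). \<bar>q t\<bar> * (N * (indicator {0..r} s * (N * max s 0) ^ n)) \<partial>?M)"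
      proof (rule integral_mono')
        show "integrable ?M (\<lambda>(t, s). \<bar>q t\<bar> * (N * (indicator {0..r} s * (N * max s 0) ^ n)))"
          by (rule lborel_pair.integrable_product(1)[OF aq ip])
        fix y :: "real \<times> real"
        obtain t s where y: "y = (t, s)" by (cases y)
        have nn: "0 \<le> N * w y ^ n" using N0 by (simp add: w_def)
        show "\<bar>k z y\<bar> * (N * w y ^ n) \<le> (case y of (t, s) \<Rightarrow> \<bar>q t\<bar> * (N * (indicator {0..r} s * (N * max s 0) ^ n)))"
          using mult_right_mono[OF k_abs[of x r t s] nn[unfolded y]] by (simp add: Pair y w_def mult_ac)
        show "0 \<le> (case y of (t, s) \<Rightarrow> \<bar>q t\<bar> * (N * (indicator {0..r} s * (N * max s 0) ^ n)))"
          using N0 by (auto simp: indicator_def y)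
      qed
      also have "\<dots> = N * (N * (N ^ n * max r 0 ^ Suc n / real (Suc n)))"
        using lborel_pair.integrable_product(2)[OF aq ip] pw(2) by (simp add: N[symmetric])
      also have "\<dots> = N * w z ^ Suc n / real (Suc n)"
        by (simp add: w_def Pair power_mult_distrib)
      finally show ?thesis .
    qed
  next
    fix B
    assume B: "B \<in> borel_measurable ?M"
      "\<And>z. z \<in> space ?M \<Longrightarrow> \<bar>B z\<bar> \<le> N * exp (w z)"
      "\<And>z. z \<in> space ?M \<Longrightarrow> B z = f0 z + (\<integral>y. k z y * B y \<partial>?M)"
    have sp: "z \<in> space ?M" for z by (simp add: space_pair_measure)
    show thesis by (rule that[OF B(1) B(2)[OF sp] B(3)[OF sp]])
  next
    show "0 \<le> N" by (rule N0)
    show "0 \<le> w z" for z using N0 by (simp add: w_def)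
    show "(\<lambda>_. N) \<in> borel_measurable ?M" by simp
  qed
  show ?thesis
  proof (rule that[OF Bm])
    show "\<bar>B (x, r)\<bar> \<le> N * exp (N * max r 0)" for x r
      using Bb[of "(x, r)"] by (simp add: w_def)
    show "B (x, r) = (LBINT t. indicator {x+r..} t * q t) +
      (\<integral>(t, s). indicator {0..r} s * indicator {x+r-s..} t * q t * B (t, s) \<partial>?M)" for x r
    proof -
      have "(\<lambda>y. k (x, r) y * B y) = (\<lambda>(t, s). indicator {0..r} s * indicator {x+r-s..} t * q t * B (t, s))"
        by (auto simp: k_def indicator_def fun_eq_iff)
      moreover have "f0 (x, r) = (LBINT t. indicator {x+r..} t * q t)"
        unfolding f0_def by (auto intro!: Bochner_Integration.integral_cong simp: indicator_def)
      ultimately show ?thesis using Beq[of "(x, r)"] by simp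
    qed
  qed
qed

lemma ac_on_tail_integral:
  assumes h: "integrable lborel h"
  shows "ac_on X (\<lambda>x. LBINT t. indicator {x..} t * h t) (\<lambda>x. - h x)"
proof (rule ac_onI)
  have s: "set_integrable lborel A h" if "A \<in> sets borel" for A
    using h that unfolding set_integrable_def by (intro integrable_mult_indicator) auto
  show "set_integrable lborel {0..X} (\<lambda>x. - h x)"
    using set_integrable_mult_right[OF s[of "{0..X}"], of "-1"] by simp
  fix x assume x: "x \<in> {0..X}"
  have "(LBINT t:{0..x} \<union> {x<..}. h t) = (LBINT t:{0..x}. h t) + (LBINT t:{x<..}. h t)"
    by (rule set_integral_Un[OF _ s s]) auto
  moreover have "{0..x} \<union> {x<..} = {0..}" using x by auto
  moreover have "(LBINT t:{x<..}. h t) = (LBINT t:{x..}. h t)"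
    unfolding set_lebesgue_integral_def
  proof (rule integral_cong_AE)
    show "AE t in lborel. indicator {x<..} t *\<^sub>R h t = indicator {x..} t *\<^sub>R h t"
      using AE_lborel_singleton[of x] by eventually_elim (auto simp: indicator_def)
  qed (use s[of "{x<..}"] s[of "{x..}"] in \<open>auto simp: set_integrable_def dest: borel_measurable_integrable\<close>)
  ultimately show "(LBINT t:{0..x}. - h t) = (LBINT t. indicator {x..} t * h t) - (LBINT t. indicator {0..} t * h t)"
    by (simp add: set_lebesgue_integral_def)
qed

section \<open>Jost solutions from the kernel\<close>

locale marchenko =
  fixes q :: "real \<Rightarrow> real" and N :: real and B :: "real \<times> real \<Rightarrow> real"
  assumes q: "integrable lborel q" and N: "N = (LBINT t. \<bar>q t\<bar>)"
    and B_measurable: "B \<in> borel_measurable (lborel \<Otimes>\<^sub>M lborel)"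
    and B_bound: "\<And>x r. \<bar>B (x, r)\<bar> \<le> N * exp (N * max r 0)"
    and B_eq: "\<And>x r. B (x, r) = (LBINT t. indicator {x+r..} t * q t) +
      (\<integral>(t, s). indicator {0..r} s * indicator {x+r-s..} t * q t * B (t, s) \<partial>(lborel \<Otimes>\<^sub>M lborel))"
begin

lemmas [measurable] = B_measurable

lemma q_measurable [measurable]: "q \<in> borel_measurable borel"
  using q by (auto dest: borel_measurable_integrable)

lemma N_nonneg: "0 \<le> N"
  unfolding N by simp

text \<open>The Laplace transform of the kernel at 2 \<kappa>, normalized such that
  \<open>exp (- \<kappa> * x) * (1 + jost_transform \<kappa> x)\<close> is the Jost
  solution.\<close>

definition jost_transform :: "real \<Rightarrow> real \<Rightarrow> real" where
  "jost_transform \<kappa> x = (LBINT r. indicator {0..} r * (B (x, r) * exp (- 2 * \<kappa> * r)))"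

lemma jost_transform_measurable [measurable]: "jost_transform \<kappa> \<in> borel_measurable borel"
  unfolding jost_transform_def by measurable

text \<open>For \<kappa> >= N + 1 the factor e^(-2 \<kappa> r) beats the growth e^(N s) and still
  leaves decay in s and in r separately. This product form majorizes the triple integrals to which
  Fubini's theorem is applied.\<close>

lemma kernel_exp_bound:
  assumes \<kappa>: "N + 1 \<le> \<kappa>" and s: "0 \<le> s" "s \<le> r"
  shows "\<bar>B (x, s)\<bar> * exp (- 2 * \<kappa> * r) \<le> N * (exp (- s) * exp (- r))"
proof -
  have "N * s + (- 2 * \<kappa> * r) \<le> - s + (- r)"
  proof -
    have "(N + 1) * r \<le> \<kappa> * r" using \<kappa> s by (intro mult_right_mono) auto
    moreover have "(N + 1) * s \<le> (N + 1) * r" using s N_nonneg by (intro mult_left_mono) auto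
    moreover have "r \<le> (N + 1) * r" using s N_nonneg by (simp add: distrib_right)
    ultimately show ?thesis by (simp add: distrib_right)
  qed
  hence "exp (N * s) * exp (- 2 * \<kappa> * r) \<le> exp (- s) * exp (- r)"
    unfolding exp_add[symmetric] by simp
  hence "N * (exp (N * s) * exp (- 2 * \<kappa> * r)) \<le> N * (exp (- s) * exp (- r))"
    using N_nonneg by (rule mult_left_mono)
  moreover have "\<bar>B (x, s)\<bar> * exp (- 2 * \<kappa> * r) \<le> N * exp (N * s) * exp (- 2 * \<kappa> * r)"
    using B_bound[of x s] s by (intro mult_right_mono) auto
  ultimately show ?thesis unfolding mult.assoc by (rule order_trans[rotated])
qed

lemma jost_transform_integrable:
  assumes \<kappa>: "N + 1 \<le> \<kappa>"
  shows "integrable lborel (\<lambda>r. indicator {0..} r * (B (x, r) * exp (- 2 * \<kappa> * r)))"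
proof (rule Bochner_Integration.integrable_bound)
  show "integrable lborel (\<lambda>r. N * (indicator {0..} r * exp (- 1 * r)))"
    by (intro integrable_mult_right integrable_exp_halfline) simp
  show "AE r in lborel. norm (indicator {0..} r * (B (x, r) * exp (- 2 * \<kappa> * r)))
      \<le> norm (N * (indicator {0..} r * exp (- 1 * r)))"
  proof (rule AE_I2)
    fix r :: real
    show "norm (indicator {0..} r * (B (x, r) * exp (- 2 * \<kappa> * r)))
      \<le> norm (N * (indicator {0..} r * exp (- 1 * r)))"
    proof (cases "0 \<le> r")
      case True
      have "N * (exp (- r) * exp (- r)) \<le> N * (exp (- r) * 1)"
        using True N_nonneg by (intro mult_left_mono) auto
      thus ?thesis
        using kernel_exp_bound[OF \<kappa> True order_refl, of x] True N_nonneg by (simp add: abs_mult)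
    qed simp
  qed
qed measurable

text \<open>The growth bound for B gives N / (2 \<kappa> - N), which is at most 1 for \<kappa> >= N
  + 1.\<close>

lemma jost_transform_bound:
  assumes \<kappa>: "N + 1 \<le> \<kappa>"
  shows "\<bar>jost_transform \<kappa> x\<bar> \<le> 1"
proof -
  have c: "N - 2 * \<kappa> < 0" using \<kappa> N_nonneg by simp
  have "\<bar>jost_transform \<kappa> x\<bar> \<le> (LBINT r. \<bar>indicator {0..} r * (B (x, r) * exp (- 2 * \<kappa> * r))\<bar>)"
    unfolding jost_transform_def by (rule integral_abs_bound)
  also have "\<dots> \<le> (LBINT r. N * (indicator {0..} r * exp ((N - 2 * \<kappa>) * r)))"
  proof (rule integral_mono)
    show "integrable lborel (\<lambda>r. \<bar>indicator {0..} r * (B (x, r) * exp (- 2 * \<kappa> * r))\<bar>)"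
      using jost_transform_integrable[OF \<kappa>] by (rule integrable_abs)
    show "integrable lborel (\<lambda>r. N * (indicator {0..} r * exp ((N - 2 * \<kappa>) * r)))"
      by (intro integrable_mult_right integrable_exp_halfline c)
    fix r :: real
    have "N * exp (N * r) * exp (- 2 * \<kappa> * r) = N * exp ((N - 2 * \<kappa>) * r)"
      by (simp add: exp_add[symmetric] algebra_simps)
    moreover have "\<bar>B (x, r)\<bar> * exp (- 2 * \<kappa> * r) \<le> N * exp (N * max r 0) * exp (- 2 * \<kappa> * r)"
      by (rule mult_right_mono[OF B_bound]) simp
    ultimately have B: "0 \<le> r \<Longrightarrow> \<bar>B (x, r)\<bar> * exp (- 2 * \<kappa> * r) \<le> N * exp ((N - 2 * \<kappa>) * r)"
      by (simp only: max_absorb1)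
    show "\<bar>indicator {0..} r * (B (x, r) * exp (- 2 * \<kappa> * r))\<bar> \<le> N * (indicator {0..} r * exp ((N - 2 * \<kappa>) * r))"
    proof (cases "0 \<le> r")
      case True
      thus ?thesis using B by (simp add: abs_mult)
    qed simp
  qed
  also have "\<dots> = N * (exp ((N - 2 * \<kappa>) * 0) / (- (N - 2 * \<kappa>)))"
    unfolding integral_mult_right_zero integrable_exp_halfline(2)[OF c] ..
  also have "\<dots> \<le> 1" using \<kappa> N_nonneg by (simp add: divide_le_eq)
  finally show ?thesis .
qed

text \<open>The Laplace transform in r of the equation for B. After exchanging integrals the
  variable r runs over an interval of length t - x, whose exponential integral produces the factor
  (1 - e^(-2 \<kappa> (t-x))) / (2 \<kappa>) in both terms.\<close>

lemma jost_equation: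
  assumes \<kappa>: "N + 1 \<le> \<kappa>"
  shows "1 + jost_transform \<kappa> x = 1 + (LBINT t. indicator {x..} t * (q t * ((1 - exp (- 2 * \<kappa> * (t - x))) / (2 * \<kappa>)) * (1 + jost_transform \<kappa> t)))"
proof -
  let ?M = "lborel \<Otimes>\<^sub>M lborel :: (real \<times> real) measure"
  interpret P: pair_sigma_finite ?M "lborel :: real measure"
    by (intro pair_sigma_finite.intro sigma_finite_lborel_pair lborel.sigma_finite_measure_axioms)
  have k1: "1 \<le> \<kappa>" using \<kappa> N_nonneg by simp
  define D where "D t = (1 - exp (- 2 * \<kappa> * (t - x))) / (2 * \<kappa>)" for t
  have [measurable]: "D \<in> borel_measurable borel" unfolding D_def by measurable
  have D01: "0 \<le> D t" "D t \<le> 1" if "x \<le> t" for t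
  proof -
    have e: "exp (- 2 * \<kappa> * (t - x)) \<le> 1" "0 < exp (- 2 * \<kappa> * (t - x))" using that k1 by simp_all
    show "0 \<le> D t" unfolding D_def using e(1) k1 by (intro divide_nonneg_pos) linarith+
    show "D t \<le> 1" unfolding D_def using e(2) k1 by (subst divide_le_eq_1_pos) linarith+
  qed
  \<comment> \<open>The constraints s <= r and x + r - s <= t mean that r lies in [s, t - x + s].
    The inhomogeneous term is the case s = 0; otherwise e^(-2 \<kappa> s) remains and rebuilds the
    transform of B at t.\<close>
  have Dint: "(LBINT r. indicator {s..t-x+s} r * exp (- 2 * \<kappa> * r)) = exp (- 2 * \<kappa> * s) * D t" if "x \<le> t" for s t
  proof -
    have "(LBINT r. indicator {s..t-x+s} r * exp (- 2 * \<kappa> * r))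
        = (exp (- 2 * \<kappa> * (t - x + s)) - exp (- 2 * \<kappa> * s)) / (- 2 * \<kappa>)"
      using integral_exp_on_Icc[of "- 2 * \<kappa>" s "t - x + s"] that k1 by (simp add: set_lebesgue_integral_def)
    also have "exp (- 2 * \<kappa> * (t - x + s)) = exp (- 2 * \<kappa> * s) * exp (- 2 * \<kappa> * (t - x))"
      unfolding exp_add[symmetric] by (simp add: algebra_simps)
    also have "(exp (- 2 * \<kappa> * s) * exp (- 2 * \<kappa> * (t - x)) - exp (- 2 * \<kappa> * s)) / (- 2 * \<kappa>) = exp (- 2 * \<kappa> * s) * D t"
      using k1 by (simp add: D_def field_simps)
    finally show ?thesis .
  qed
  define F where "F t r = indicator {0..} r * indicator {x+r..} t * q t * exp (- 2 * \<kappa> * r)" for t r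
  define G where "G y r = (case y of (t, s) \<Rightarrow> indicator {0..r} s * indicator {x+r-s..} t * q t * B (t, s) * exp (- 2 * \<kappa> * r))"
    for y :: "real \<times> real" and r
  have aq: "integrable lborel (\<lambda>t. \<bar>q t\<bar>)" using q by simp
  have ie: "integrable lborel (\<lambda>r::real. indicator {0..} r * exp (- 1 * r))" by (intro integrable_exp_halfline) simp
  have F_int: "integrable ?M (\<lambda>(t, r). F t r)"
  proof (rule Bochner_Integration.integrable_bound[OF lborel_pair.integrable_product(1)[OF aq ie]])
    show "(\<lambda>(t, r). F t r) \<in> borel_measurable ?M"
      unfolding F_def indicator_def of_bool_def atLeast_iff by measurable
    have "norm (F t r) \<le> norm (\<bar>q t\<bar> * (indicator {0..} r * exp (- 1 * r)))" for t r
    proof (cases "0 \<le> r")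
      case True
      have "r \<le> 2 * \<kappa> * r" using k1 True by (intro mult_le_cancel_right1[THEN iffD2]) auto
      hence "\<bar>q t\<bar> * exp (- 2 * \<kappa> * r) \<le> \<bar>q t\<bar> * exp (- r)" by (intro mult_left_mono) auto
      thus ?thesis using True by (auto simp: F_def abs_mult indicator_def)
    qed (simp add: F_def)
    thus "AE y in ?M. norm (case y of (t, r) \<Rightarrow> F t r) \<le> norm (case y of (t, r) \<Rightarrow> \<bar>q t\<bar> * (indicator {0..} r * exp (- 1 * r)))"
      by (intro AE_I2) auto
  qed
  have G_int: "integrable (?M \<Otimes>\<^sub>M lborel) (\<lambda>(y, r). G y r)"
  proof (rule Bochner_Integration.integrable_bound)
    show "integrable (?M \<Otimes>\<^sub>M lborel) (\<lambda>(y, r). (N * (case y of (t, s) \<Rightarrow> \<bar>q t\<bar> * (indicator {0..} s * exp (- 1 * s)))) * (indicator {0..} r * exp (- 1 * r)))"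
      by (intro P.integrable_product integrable_mult_right lborel_pair.integrable_product aq ie)
    show "(\<lambda>(y, r). G y r) \<in> borel_measurable (?M \<Otimes>\<^sub>M lborel)"
      unfolding G_def indicator_def of_bool_def atLeast_iff atLeastAtMost_iff by measurable
    have "norm (G (t, s) r) \<le> norm ((N * (\<bar>q t\<bar> * (indicator {0..} s * exp (- 1 * s)))) * (indicator {0..} r * exp (- 1 * r)))" for t s r
    proof (cases "0 \<le> s \<and> s \<le> r")
      case True
      have "\<bar>q t\<bar> * (\<bar>B (t, s)\<bar> * exp (- 2 * \<kappa> * r)) \<le> \<bar>q t\<bar> * (N * (exp (- s) * exp (- r)))"
        using kernel_exp_bound[OF \<kappa>] True by (intro mult_left_mono) auto
      thus ?thesis using True N_nonneg by (auto simp: G_def abs_mult indicator_def mult_ac)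
    qed (auto simp: G_def)
    thus "AE z in ?M \<Otimes>\<^sub>M lborel. norm (case z of (y, r) \<Rightarrow> G y r) \<le>
        norm (case z of (y, r) \<Rightarrow> (N * (case y of (t, s) \<Rightarrow> \<bar>q t\<bar> * (indicator {0..} s * exp (- 1 * s)))) * (indicator {0..} r * exp (- 1 * r)))"
      by (intro AE_I2) auto
  qed
  have Fr: "(LBINT r. F t r) = indicator {x..} t * (q t * D t)" for t
  proof -
    have "(LBINT r. F t r) = (LBINT r. (indicator {x..} t * q t) * (indicator {0..t-x+0} r * exp (- 2 * \<kappa> * r)))"
      by (intro Bochner_Integration.integral_cong) (auto simp: F_def indicator_def)
    also have "\<dots> = indicator {x..} t * (q t * D t)"
      unfolding integral_mult_right_zero using Dint[of t 0] by (cases "x \<le> t") auto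
    finally show ?thesis .
  qed
  have Gr: "(LBINT r. G (t, s) r) = (indicator {x..} t * (q t * D t)) * (indicator {0..} s * (B (t, s) * exp (- 2 * \<kappa> * s)))" for t s
  proof -
    have "(LBINT r. G (t, s) r) = (LBINT r. (indicator {x..} t * indicator {0..} s * q t * B (t, s)) * (indicator {s..t-x+s} r * exp (- 2 * \<kappa> * r)))"
      by (intro Bochner_Integration.integral_cong) (auto simp: G_def indicator_def)
    also have "\<dots> = (indicator {x..} t * (q t * D t)) * (indicator {0..} s * (B (t, s) * exp (- 2 * \<kappa> * s)))"
      unfolding integral_mult_right_zero using Dint[of t s] by (cases "x \<le> t") auto
    finally show ?thesis .
  qed
  have "jost_transform \<kappa> x = (LBINT r. (LBINT t. F t r) + (\<integral>y. G y r \<partial>?M))"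
    unfolding jost_transform_def
  proof (rule Bochner_Integration.integral_cong)
    fix r :: real
    show "indicator {0..} r * (B (x, r) * exp (- 2 * \<kappa> * r)) = (LBINT t. F t r) + (\<integral>y. G y r \<partial>?M)"
    proof (cases "0 \<le> r")
      case True
      have "(LBINT t. F t r) = exp (- 2 * \<kappa> * r) * (LBINT t. indicator {x+r..} t * q t)"
        unfolding integral_mult_right_zero[symmetric] using True
        by (intro Bochner_Integration.integral_cong) (auto simp: F_def)
      moreover have "(\<integral>y. G y r \<partial>?M) = exp (- 2 * \<kappa> * r) *
          (\<integral>(t, s). indicator {0..r} s * indicator {x+r-s..} t * q t * B (t, s) \<partial>?M)"
        unfolding integral_mult_right_zero[symmetric]
        by (intro Bochner_Integration.integral_cong) (auto simp: G_def)
      moreover have "indicator {0..} r * (B (x, r) * exp (- 2 * \<kappa> * r)) = exp (- 2 * \<kappa> * r) * B (x, r)"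
        using True by simp
      ultimately show ?thesis unfolding B_eq[of x r] by (simp add: distrib_left)
    qed (simp add: F_def G_def case_prod_beta)
  qed simp
  also have "\<dots> = (LBINT r. LBINT t. F t r) + (LBINT r. \<integral>y. G y r \<partial>?M)"
    by (rule Bochner_Integration.integral_add[OF lborel_pair.integrable_snd[OF F_int] P.integrable_snd[OF G_int]])
  also have "(LBINT r. LBINT t. F t r) = (LBINT t. indicator {x..} t * (q t * D t))"
    using lborel_pair.Fubini_integral[OF F_int] by (simp add: Fr)
  also have "(LBINT r. \<integral>y. G y r \<partial>?M) = (\<integral>y. (LBINT r. G y r) \<partial>?M)"
    by (rule P.Fubini_integral[OF G_int])
  also have "\<dots> = (\<integral>(t, s). (indicator {x..} t * (q t * D t)) * (indicator {0..} s * (B (t, s) * exp (- 2 * \<kappa> * s))) \<partial>?M)"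
    by (intro Bochner_Integration.integral_cong) (auto simp: Gr)
  also have "\<dots> = (LBINT t. LBINT s. (indicator {x..} t * (q t * D t)) * (indicator {0..} s * (B (t, s) * exp (- 2 * \<kappa> * s))))"
  proof (rule lborel_pair.integral_fst[symmetric])
    show "integrable ?M (\<lambda>(t, s). (indicator {x..} t * (q t * D t)) * (indicator {0..} s * (B (t, s) * exp (- 2 * \<kappa> * s))))"
      unfolding Gr[symmetric] using P.integrable_fst[OF G_int] by (simp add: case_prod_unfold)
  qed
  also have "\<dots> = (LBINT t. (indicator {x..} t * (q t * D t)) * jost_transform \<kappa> t)"
    by (simp add: jost_transform_def)
  also have "(LBINT t. indicator {x..} t * (q t * D t)) + \<dots>
      = (LBINT t. indicator {x..} t * (q t * D t) + (indicator {x..} t * (q t * D t)) * jost_transform \<kappa> t)"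
  proof (rule Bochner_Integration.integral_add[symmetric])
    have le: "norm (indicator {x..} t * (q t * D t)) \<le> norm (q t)" for t
      using D01[of t] mult_left_mono[of "\<bar>D t\<bar>" 1 "\<bar>q t\<bar>"] by (auto simp: indicator_def abs_mult)
    show "integrable lborel (\<lambda>t. indicator {x..} t * (q t * D t))"
      by (rule Bochner_Integration.integrable_bound[OF q]) (use le in auto)
    show "integrable lborel (\<lambda>t. indicator {x..} t * (q t * D t) * jost_transform \<kappa> t)"
    proof (rule Bochner_Integration.integrable_bound[OF q])
      have "norm (indicator {x..} t * (q t * D t) * jost_transform \<kappa> t) \<le> norm (q t) * 1" for t
        unfolding norm_mult[of "indicator {x..} t * (q t * D t)"] using jost_transform_bound[OF \<kappa>, of t]
        by (intro mult_mono le) auto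
      thus "AE t in lborel. norm (indicator {x..} t * (q t * D t) * jost_transform \<kappa> t) \<le> norm (q t)"
        by simp
    qed measurable
  qed
  also have "\<dots> = (LBINT t. indicator {x..} t * (q t * D t * (1 + jost_transform \<kappa> t)))"
    by (intro Bochner_Integration.integral_cong) (auto simp: algebra_simps)
  finally show ?thesis by (simp add: D_def)
qed

text \<open>To differentiate the integral equation, its kernel is separated into G0(x) - e^(2
  \<kappa> x) G1(x) with tail integrals G0, G1. Then g' = -e^(2 \<kappa> x) G1 has density 2
  \<kappa> g' + q g, so f = e^(-\<kappa> x) g solves the equation. Beyond a the tails are empty,
  hence g = 1 and g' = 0.\<close>

lemma jost_solution:
  assumes \<kappa>: "N + 1 \<le> \<kappa>" and supp: "\<And>t. a \<le> t \<Longrightarrow> q t = 0"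
  obtains f v where "\<And>X. ac_on X f v" "\<And>X. ac_on X v (\<lambda>x. (q x + \<kappa>\<^sup>2) * f x)"
    "\<And>x. f x = exp (- \<kappa> * x) * (1 + jost_transform \<kappa> x)"
    "\<And>x. a \<le> x \<Longrightarrow> f x = exp (- \<kappa> * x)" "\<And>x. a \<le> x \<Longrightarrow> v x = - \<kappa> * exp (- \<kappa> * x)"
proof -
  have k1: "1 \<le> \<kappa>" using \<kappa> N_nonneg by simp
  define g where "g x = 1 + jost_transform \<kappa> x" for x
  have [measurable]: "g \<in> borel_measurable borel" unfolding g_def by measurable
  have gb: "\<bar>g x\<bar> \<le> 2" for x
    using jost_transform_bound[OF \<kappa>, of x] by (auto simp: g_def abs_le_iff)
  define h0 where "h0 t = q t * g t" for t
  \<comment> \<open>The cut at 0 keeps the weight e^(-2 \<kappa> t) at most 1, so that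
    \<open>h1\<close> is integrable on the whole line; it does not affect tails starting at x >=
    0.\<close>
  define h1 where "h1 t = indicator {0..} t * (exp (- 2 * \<kappa> * t) * h0 t)" for t
  have h0: "integrable lborel h0"
  proof (rule Bochner_Integration.integrable_bound)
    show "integrable lborel (\<lambda>t. 2 * q t)" using q by simp
    show "AE t in lborel. norm (h0 t) \<le> norm (2 * q t)"
      using mult_left_mono[OF gb, of "\<bar>q _\<bar>"] by (intro AE_I2) (simp add: h0_def abs_mult mult.commute)
  qed (simp add: h0_def[abs_def])
  have [measurable]: "h0 \<in> borel_measurable borel" unfolding h0_def by measurable
  have h1: "integrable lborel h1"
  proof (rule Bochner_Integration.integrable_bound[OF h0])
    show "AE t in lborel. norm (h1 t) \<le> norm (h0 t)"
      using k1 by (intro AE_I2) (auto simp: h1_def indicator_def abs_mult intro!: mult_left_le_one_le)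
  qed (simp add: h1_def[abs_def])
  define G0 where "G0 x = (LBINT t. indicator {x..} t * h0 t)" for x
  define G1 where "G1 x = (LBINT t. indicator {x..} t * h1 t)" for x
  have G0: "ac_on X G0 (\<lambda>x. - h0 x)" and G1: "ac_on X G1 (\<lambda>x. - h1 x)" for X
    unfolding G0_def G1_def by (intro ac_on_tail_integral h0 h1)+
  have g_eq: "1 + (1 / (2 * \<kappa>)) * (G0 x - exp (2 * \<kappa> * x) * G1 x) = g x" if x: "0 \<le> x" for x
  proof -
    have i: "integrable lborel (\<lambda>t. indicator {x..} t * h0 t)" "integrable lborel (\<lambda>t. indicator {x..} t * h1 t)"
      using integrable_mult_indicator[OF _ h0, of "{x..}"] integrable_mult_indicator[OF _ h1, of "{x..}"] by auto
    have "(1 / (2 * \<kappa>)) * (G0 x - exp (2 * \<kappa> * x) * G1 x)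
        = (LBINT t. (1 / (2 * \<kappa>)) * (indicator {x..} t * h0 t - exp (2 * \<kappa> * x) * (indicator {x..} t * h1 t)))"
      unfolding G0_def G1_def integral_mult_right_zero
      using i by (subst Bochner_Integration.integral_diff) auto
    also have "\<dots> = (LBINT t. indicator {x..} t * (q t * ((1 - exp (- 2 * \<kappa> * (t - x))) / (2 * \<kappa>)) * g t))"
    proof (rule Bochner_Integration.integral_cong)
      fix t
      show "(1 / (2 * \<kappa>)) * (indicator {x..} t * h0 t - exp (2 * \<kappa> * x) * (indicator {x..} t * h1 t))
          = indicator {x..} t * (q t * ((1 - exp (- 2 * \<kappa> * (t - x))) / (2 * \<kappa>)) * g t)"
      proof (cases "x \<le> t")
        case True
        have "exp (- 2 * \<kappa> * (t - x)) = exp (2 * \<kappa> * x) * exp (- 2 * \<kappa> * t)"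
          unfolding exp_add[symmetric] by (simp add: algebra_simps)
        thus ?thesis using True x k1 by (simp add: h0_def h1_def field_simps)
      qed simp
    qed simp
    finally show ?thesis using jost_equation[OF \<kappa>, of x] by (simp add: g_def)
  qed
  define g' where "g' x = - (exp (2 * \<kappa> * x) * G1 x)" for x
  have g': "ac_on X g' (\<lambda>x. 2 * \<kappa> * g' x + q x * g x)" for X
  proof (rule ac_on_cong[OF ac_on_minus[OF ac_on_mult[OF ac_on_exp_linear[of X "2 * \<kappa>"] G1]]])
    fix x assume "x \<in> {0..X}"
    hence "exp (2 * \<kappa> * x) * h1 x = q x * g x"
      by (simp add: h1_def h0_def mult.assoc[symmetric] exp_add[symmetric])
    thus "- (2 * \<kappa> * exp (2 * \<kappa> * x) * G1 x + exp (2 * \<kappa> * x) * - h1 x) = 2 * \<kappa> * g' x + q x * g x"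
      by (simp add: g'_def)
  qed (simp add: g'_def)
  have g: "ac_on X g g'" for X
  proof (rule ac_on_cong[OF ac_on_add[OF ac_on_const[of X 1]
          ac_on_cmult[OF ac_on_diff[OF G0 ac_on_mult[OF ac_on_exp_linear[of X "2 * \<kappa>"] G1]], of "1 / (2 * \<kappa>)"]]])
    fix x assume x: "x \<in> {0..X}"
    show "1 + (1 / (2 * \<kappa>)) * (G0 x - exp (2 * \<kappa> * x) * G1 x) = g x" using g_eq x by simp
    have "exp (2 * \<kappa> * x) * h1 x = h0 x"
      using x by (simp add: h1_def mult.assoc[symmetric] exp_add[symmetric])
    thus "0 + (1 / (2 * \<kappa>)) * (- h0 x - (2 * \<kappa> * exp (2 * \<kappa> * x) * G1 x + exp (2 * \<kappa> * x) * - h1 x)) = g' x"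
      using k1 by (simp add: g'_def)
  qed
  define f where "f x = exp (- \<kappa> * x) * g x" for x
  define v where "v x = exp (- \<kappa> * x) * (g' x - \<kappa> * g x)" for x
  have G1a: "G1 x = 0" if "a \<le> x" for x
  proof -
    have "(\<lambda>t. indicator {x..} t * h1 t) = (\<lambda>t. 0)"
      using supp that by (auto simp: indicator_def h1_def h0_def)
    thus ?thesis by (simp add: G1_def)
  qed
  have ga: "g x = 1" if "a \<le> x" for x
  proof -
    have "(\<lambda>t. indicator {x..} t * (q t * ((1 - exp (- 2 * \<kappa> * (t - x))) / (2 * \<kappa>)) * (1 + jost_transform \<kappa> t))) = (\<lambda>t. 0)"
      using supp that by (auto simp: indicator_def)
    thus ?thesis using jost_equation[OF \<kappa>, of x] by (simp add: g_def)
  qed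
  show ?thesis
  proof (rule that[of f v])
    show "ac_on X f v" for X
      unfolding f_def by (rule ac_on_cong[OF ac_on_mult[OF ac_on_exp_linear[of X "- \<kappa>"] g]]) (auto simp: v_def algebra_simps)
    show "ac_on X v (\<lambda>x. (q x + \<kappa>\<^sup>2) * f x)" for X
      unfolding v_def
      by (rule ac_on_cong[OF ac_on_mult[OF ac_on_exp_linear[of X "- \<kappa>"] ac_on_diff[OF g' ac_on_cmult[OF g, where c = \<kappa>]]]])
         (auto simp: f_def power2_eq_square algebra_simps)
    show "f x = exp (- \<kappa> * x) * (1 + jost_transform \<kappa> x)" for x
      by (simp add: f_def g_def)
    show "f x = exp (- \<kappa> * x)" if "a \<le> x" for x using ga[OF that] by (simp add: f_def)
    show "v x = - \<kappa> * exp (- \<kappa> * x)" if "a \<le> x" for x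
      using ga[OF that] G1a[OF that] by (simp add: v_def g'_def)
  qed
qed

end

section \<open>Products of two Jost functions as one Laplace transform\<close>

lemma lborel_translate:
  fixes g :: "real \<Rightarrow> real"
  shows "integrable lborel g \<Longrightarrow> integrable lborel (\<lambda>r. g (r - s))"
    and "(LBINT r. g (r - s)) = (LBINT r. g r)"
  using lborel_integrable_real_affine[of g 1 "-s"] lborel_integral_real_affine[of 1 g "-s"]
  by (simp_all add: algebra_simps)

lemma integral_convolution:
  fixes f g :: "real \<Rightarrow> real"
  assumes f: "integrable lborel f" and g: "integrable lborel g"
  shows "integrable lborel (\<lambda>r. LBINT s. f s * g (r - s))"
    and "(LBINT r. LBINT s. f s * g (r - s)) = (LBINT s. f s) * (LBINT r. g r)"
proof -
  have [measurable]: "f \<in> borel_measurable borel" "g \<in> borel_measurable borel"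
    using f g by (auto dest: borel_measurable_integrable)
  have i: "integrable (lborel \<Otimes>\<^sub>M lborel) (\<lambda>(s, r). f s * g (r - s))"
  proof (rule lborel_pair.Fubini_integrable)
    show "integrable lborel (\<lambda>s. LBINT r. norm (case (s, r) of (s, r) \<Rightarrow> f s * g (r - s)))"
      using f by (simp add: abs_mult lborel_translate(2)[of "\<lambda>r. \<bar>g r\<bar>"])
    show "AE s in lborel. integrable lborel (\<lambda>r. case (s, r) of (s, r) \<Rightarrow> f s * g (r - s))"
      using lborel_translate(1)[OF g] by simp
  qed measurable
  show "integrable lborel (\<lambda>r. LBINT s. f s * g (r - s))"
    by (rule lborel_pair.integrable_snd[OF i])
  show "(LBINT r. LBINT s. f s * g (r - s)) = (LBINT s. f s) * (LBINT r. g r)"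
    using lborel_pair.Fubini_integral[OF i] by (simp add: lborel_translate(2))
qed

text \<open>Products of Laplace transforms are transforms of convolutions, so K = B1 + B2 + B1 * B2,
  with convolution in the second variable and x kept as a parameter.\<close>

lemma marchenko_product_kernel:
  assumes "marchenko q1 N1 B1" and "marchenko q2 N2 B2"
  obtains K :: "real \<times> real \<Rightarrow> real" and M c :: real
  where "K \<in> borel_measurable (lborel \<Otimes>\<^sub>M lborel)" "0 \<le> M" "N1 + 1 \<le> c" "N2 + 1 \<le> c"
    and "\<And>x r. 0 \<le> r \<Longrightarrow> \<bar>K (x, r)\<bar> \<le> M * exp (c * r)"
    and "\<And>\<kappa> x. c \<le> \<kappa> \<Longrightarrow> (1 + marchenko.jost_transform B1 \<kappa> x) * (1 + marchenko.jost_transform B2 \<kappa> x)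
      = 1 + (LBINT r. indicator {0..} r * (K (x, r) * exp (- 2 * \<kappa> * r)))"
proof -
  interpret m1: marchenko q1 N1 B1 by fact
  interpret m2: marchenko q2 N2 B2 by fact
  \<comment> \<open>The convolution has size r e^((N1 + N2) r); the additional 1 in the exponent
    absorbs the factor r.\<close>
  define c where "c = N1 + N2 + 1"
  have c: "1 \<le> c" "N1 + 1 \<le> c" "N2 + 1 \<le> c"
    using m1.N_nonneg m2.N_nonneg by (auto simp: c_def)
  define conv where "conv x r = (LBINT s. indicator {0..r} s * (B1 (x, s) * B2 (x, r - s)))" for x r
  define K where "K = (\<lambda>(x, r). B1 (x, r) + B2 (x, r) + conv x r)"
  define M where "M = N1 + N2 + N1 * N2"
  have [measurable]: "(\<lambda>(x, r). conv x r) \<in> borel_measurable (lborel \<Otimes>\<^sub>M lborel)"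
    unfolding conv_def indicator_def of_bool_def atLeastAtMost_iff by measurable
  have Km: "K \<in> borel_measurable (lborel \<Otimes>\<^sub>M lborel)"
    unfolding K_def by measurable
  have conv_bound: "\<bar>conv x r\<bar> \<le> N1 * N2 * exp (c * r)" if r: "0 \<le> r" for x r
  proof -
    have b: "\<bar>indicator {0..r} s * (B1 (x, s) * B2 (x, r - s))\<bar> \<le> N1 * N2 * exp ((c - 1) * r) * indicator {0..r} s" for s
    proof (cases "s \<in> {0..r}")
      case True
      have "\<bar>B1 (x, s)\<bar> * \<bar>B2 (x, r - s)\<bar> \<le> (N1 * exp (N1 * s)) * (N2 * exp (N2 * (r - s)))"
        using m1.B_bound[of x s] m2.B_bound[of x "r - s"] True m1.N_nonneg by (intro mult_mono) auto
      also have "\<dots> = N1 * N2 * exp (N1 * s + N2 * (r - s))"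
        by (simp add: exp_add)
      also have "\<dots> \<le> N1 * N2 * exp ((c - 1) * r)"
      proof -
        have "N1 * s \<le> N1 * r" "N2 * (r - s) \<le> N2 * r"
          using True m1.N_nonneg m2.N_nonneg by (auto intro!: mult_left_mono)
        hence "N1 * s + N2 * (r - s) \<le> (c - 1) * r" by (simp add: c_def distrib_right)
        thus ?thesis using m1.N_nonneg m2.N_nonneg by (intro mult_left_mono) auto
      qed
      finally show ?thesis using True by (simp add: abs_mult)
    qed auto
    have "\<bar>conv x r\<bar> \<le> (LBINT s. \<bar>indicator {0..r} s * (B1 (x, s) * B2 (x, r - s))\<bar>)"
      unfolding conv_def by (rule integral_abs_bound)
    also have "\<dots> \<le> (LBINT s. N1 * N2 * exp ((c - 1) * r) * indicator {0..r} s)"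
    proof (rule integral_mono'[OF _ b])
      have "integrable lborel (indicator {0..r} :: real \<Rightarrow> real)"
        using r by (intro integrable_real_indicator) auto
      thus "integrable lborel (\<lambda>s. N1 * N2 * exp ((c - 1) * r) * indicator {0..r} s)"
        by (rule integrable_mult_right)
    qed (use m1.N_nonneg m2.N_nonneg in auto)
    also have "\<dots> = N1 * N2 * (r * exp ((c - 1) * r))" using r by simp
    also have "\<dots> \<le> N1 * N2 * exp (c * r)"
    proof (rule mult_left_mono)
      have "r \<le> exp r" using exp_ge_add_one_self[of r] by linarith
      hence "r * exp ((c - 1) * r) \<le> exp r * exp ((c - 1) * r)" by (intro mult_right_mono) auto
      thus "r * exp ((c - 1) * r) \<le> exp (c * r)" by (simp add: exp_add[symmetric] algebra_simps)
    qed (use m1.N_nonneg m2.N_nonneg in auto)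
    finally show ?thesis .
  qed
  show ?thesis
  proof (rule that[OF Km _ c(2,3)])
    show "0 \<le> M" using m1.N_nonneg m2.N_nonneg by (simp add: M_def)
    show "\<bar>K (x, r)\<bar> \<le> M * exp (c * r)" if r: "0 \<le> r" for x r
    proof -
      have "N1 * r \<le> c * r" "N2 * r \<le> c * r" using c r by (auto intro!: mult_right_mono)
      hence "N1 * exp (N1 * r) \<le> N1 * exp (c * r)" "N2 * exp (N2 * r) \<le> N2 * exp (c * r)"
        using m1.N_nonneg m2.N_nonneg by (auto intro!: mult_left_mono)
      moreover have "\<bar>B1 (x, r)\<bar> \<le> N1 * exp (N1 * r)" "\<bar>B2 (x, r)\<bar> \<le> N2 * exp (N2 * r)"
        using m1.B_bound[of x r] m2.B_bound[of x r] r by (auto simp: max_absorb1)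
      moreover have "\<bar>K (x, r)\<bar> \<le> \<bar>B1 (x, r)\<bar> + \<bar>B2 (x, r)\<bar> + \<bar>conv x r\<bar>"
        unfolding K_def by simp
      ultimately show ?thesis
        using conv_bound[OF r, of x] unfolding M_def distrib_right by linarith
    qed
    fix \<kappa> x assume \<kappa>: "c \<le> \<kappa>"
    have k: "N1 + 1 \<le> \<kappa>" "N2 + 1 \<le> \<kappa>" using c \<kappa> by auto
    define b1 where "b1 s = indicator {0..} s * (B1 (x, s) * exp (- 2 * \<kappa> * s))" for s :: real
    define b2 where "b2 s = indicator {0..} s * (B2 (x, s) * exp (- 2 * \<kappa> * s))" for s :: real
    have i1: "integrable lborel b1" and i2: "integrable lborel b2"
      unfolding b1_def b2_def by (intro m1.jost_transform_integrable m2.jost_transform_integrable k)+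
    have j: "m1.jost_transform \<kappa> x = (LBINT s. b1 s)" "m2.jost_transform \<kappa> x = (LBINT s. b2 s)"
      by (simp_all add: m1.jost_transform_def m2.jost_transform_def b1_def b2_def)
    have cv: "(LBINT s. b1 s * b2 (r - s)) = indicator {0..} r * (conv x r * exp (- 2 * \<kappa> * r))" for r
    proof -
      have "(LBINT s. b1 s * b2 (r - s)) = (LBINT s. (indicator {0..r} s * (B1 (x, s) * B2 (x, r - s))) * exp (- 2 * \<kappa> * r))"
      proof (rule Bochner_Integration.integral_cong)
        fix s
        have "exp (- 2 * \<kappa> * s) * exp (- 2 * \<kappa> * (r - s)) = exp (- 2 * \<kappa> * r)"
          unfolding exp_add[symmetric] by (simp add: algebra_simps)
        thus "b1 s * b2 (r - s) = (indicator {0..r} s * (B1 (x, s) * B2 (x, r - s))) * exp (- 2 * \<kappa> * r)"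
          by (auto simp: b1_def b2_def indicator_def)
      qed simp
      also have "\<dots> = conv x r * exp (- 2 * \<kappa> * r)"
        unfolding conv_def by (rule integral_mult_left_zero)
      also have "\<dots> = indicator {0..} r * (conv x r * exp (- 2 * \<kappa> * r))"
        by (cases "0 \<le> r") (simp_all add: conv_def)
      finally show ?thesis .
    qed
    note conv12 = integral_convolution[OF i1 i2, unfolded cv]
    have "(LBINT r. indicator {0..} r * (K (x, r) * exp (- 2 * \<kappa> * r)))
        = (LBINT r. (b1 r + b2 r) + indicator {0..} r * (conv x r * exp (- 2 * \<kappa> * r)))"
      by (intro Bochner_Integration.integral_cong) (auto simp: K_def b1_def b2_def algebra_simps)
    also have "\<dots> = (LBINT r. b1 r) + (LBINT r. b2 r) + (LBINT r. b1 r) * (LBINT r. b2 r)"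
      using i1 i2 conv12 by simp
    finally show "(1 + m1.jost_transform \<kappa> x) * (1 + m2.jost_transform \<kappa> x)
        = 1 + (LBINT r. indicator {0..} r * (K (x, r) * exp (- 2 * \<kappa> * r)))"
      unfolding j by (simp add: algebra_simps)
  qed
qed

text \<open>Q(x) e^(-2 \<kappa> x) times the transform of K(x, r) is integrated along y = x + r.
  This gives the transform of R(y), the integral of Q(x) K(x, y - x) over x <= y, which depends only
  on Q over [0, y]; hence the Volterra bound for P - Q. The part with y > a is the error
  term.\<close>

lemma marchenko_product_laplace:
  assumes "marchenko q1 N1 B1" and "marchenko q2 N2 B2" and a: "0 < a"
    and Q: "integrable lborel Q" and supp: "\<And>t. t < 0 \<or> a \<le> t \<Longrightarrow> Q t = 0"
  obtains P M \<kappa>0 where "P \<in> borel_measurable borel" "set_integrable lborel {0..a} P" "0 \<le> M"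
    and "\<And>y. y \<in> {0..a} \<Longrightarrow> \<bar>P y - Q y\<bar> \<le> M * (LBINT x:{0..y}. \<bar>Q x\<bar>)"
    and "\<And>\<kappa>. \<kappa>0 \<le> \<kappa> \<Longrightarrow> \<bar>(LBINT y:{0..a}. P y * exp (- 2 * \<kappa> * y))
      - (LBINT x. Q x * exp (- 2 * \<kappa> * x) * ((1 + marchenko.jost_transform B1 \<kappa> x) * (1 + marchenko.jost_transform B2 \<kappa> x)))\<bar>
      \<le> M * exp (- 2 * \<kappa> * a)"
proof -
  obtain K M c where [measurable]: "K \<in> borel_measurable (lborel \<Otimes>\<^sub>M lborel)" and M: "0 \<le> M"
    and c: "N1 + 1 \<le> c" "N2 + 1 \<le> c" and Kb: "\<And>x r. 0 \<le> r \<Longrightarrow> \<bar>K (x, r)\<bar> \<le> M * exp (c * r)"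
    and Keq: "\<And>\<kappa> x. c \<le> \<kappa> \<Longrightarrow> (1 + marchenko.jost_transform B1 \<kappa> x) * (1 + marchenko.jost_transform B2 \<kappa> x)
      = 1 + (LBINT r. indicator {0..} r * (K (x, r) * exp (- 2 * \<kappa> * r)))"
    by (rule marchenko_product_kernel[OF assms(1,2)], rule that)
  have c1: "1 \<le> c" using c marchenko.N_nonneg[OF assms(1)] by simp
  have [measurable]: "Q \<in> borel_measurable borel" using Q by (auto dest: borel_measurable_integrable)
  have aQ: "integrable lborel (\<lambda>x. \<bar>Q x\<bar>)" using Q by simp
  define T where "T = (LBINT x. \<bar>Q x\<bar>)"
  have T: "0 \<le> T" by (simp add: T_def)
  define R where "R y = (LBINT x. indicator {..y} x * (Q x * K (x, y - x)))" for y
  define P where "P y = Q y + R y" for y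
  have Rm [measurable]: "R \<in> borel_measurable borel"
    unfolding R_def indicator_def of_bool_def atMost_iff by measurable
  have pointwise: "\<bar>indicator {..y} x * (Q x * K (x, y - x))\<bar> \<le> M * exp (c * y) * (indicator {0..y} x * \<bar>Q x\<bar>)" for x y
  proof (cases "x \<in> {0..y}")
    case True
    have "\<bar>K (x, y - x)\<bar> \<le> M * exp (c * (y - x))" using Kb[of "y - x" x] True by simp
    also have "\<dots> \<le> M * exp (c * y)" using True c1 M by (intro mult_left_mono) (auto simp: mult_left_mono)
    finally have "\<bar>Q x\<bar> * \<bar>K (x, y - x)\<bar> \<le> \<bar>Q x\<bar> * (M * exp (c * y))" by (rule mult_left_mono) simp
    thus ?thesis using True by (simp add: abs_mult mult_ac)
  next
    case False
    hence "y < x \<or> Q x = 0" using supp[of x] by auto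
    thus ?thesis using M by auto
  qed
  have iQ: "integrable lborel (\<lambda>x. indicator {0..y} x * \<bar>Q x\<bar>)" for y
    using integrable_mult_indicator[OF _ aQ, of "{0..y}"] by simp
  have Rb: "\<bar>R y\<bar> \<le> M * exp (c * y) * (LBINT x:{0..y}. \<bar>Q x\<bar>)" for y
  proof -
    have "\<bar>R y\<bar> \<le> (LBINT x. \<bar>indicator {..y} x * (Q x * K (x, y - x))\<bar>)"
      unfolding R_def by (rule integral_abs_bound)
    also have "\<dots> \<le> (LBINT x. M * exp (c * y) * (indicator {0..y} x * \<bar>Q x\<bar>))"
      by (rule integral_mono') (use iQ pointwise M in auto)
    finally show ?thesis by (simp add: set_lebesgue_integral_def)
  qed
  have QT: "(LBINT x:{0..y}. \<bar>Q x\<bar>) \<le> T" for y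
    unfolding T_def set_lebesgue_integral_def
    by (rule integral_mono') (use aQ in \<open>auto simp: indicator_def\<close>)
  have Rb': "\<bar>R y\<bar> \<le> T * M * exp (c * y)" for y
    using Rb[of y] mult_left_mono[OF QT, of "M * exp (c * y)" y] M by (simp add: mult_ac)
  have R0: "R y = 0" if "y < 0" for y
  proof -
    have "(\<lambda>x. indicator {..y} x * (Q x * K (x, y - x))) = (\<lambda>x. 0)"
      using supp that by (auto simp: indicator_def)
    thus ?thesis by (simp add: R_def)
  qed
  have Pint: "set_integrable lborel {0..a} P"
    unfolding P_def
  proof (rule set_integral_add)
    show "set_integrable lborel {0..a} Q"
      unfolding set_integrable_def using integrable_mult_indicator[OF _ Q, of "{0..a}"] by simp
    have "set_integrable lborel {0..a} (\<lambda>y. 1 * R y)"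
    proof (rule set_integrable_bounded[where M = "T * M * exp (c * a)"])
      show "set_integrable lborel {0..a} (\<lambda>y. 1 :: real)"
        by (intro borel_integrable_atLeastAtMost' continuous_on_const)
      fix y assume "y \<in> {0..a}"
      hence "exp (c * y) \<le> exp (c * a)" using c1 by (auto intro!: mult_left_mono)
      hence "T * M * exp (c * y) \<le> T * M * exp (c * a)" using T M by (intro mult_left_mono) auto
      thus "\<bar>R y\<bar> \<le> T * M * exp (c * a)" using Rb'[of y] by simp
    qed auto
    thus "set_integrable lborel {0..a} R" by simp
  qed
  \<comment> \<open>The first entry is the Volterra constant on [0, a], the second bounds the tail
    beyond a.\<close>
  define M' where "M' = max (M * exp (c * a)) (T * M * exp (c * a))"
  show ?thesis
  proof (rule that[OF _ Pint, of M' "c + 1"])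
    show "P \<in> borel_measurable borel" unfolding P_def by measurable
    show "0 \<le> M'" using M by (simp add: M'_def le_max_iff_disj)
    show "\<bar>P y - Q y\<bar> \<le> M' * (LBINT x:{0..y}. \<bar>Q x\<bar>)" if y: "y \<in> {0..a}" for y
    proof -
      have nn: "0 \<le> (LBINT x:{0..y}. \<bar>Q x\<bar>)"
        unfolding set_lebesgue_integral_def by (intro integral_nonneg_AE) auto
      have "exp (c * y) \<le> exp (c * a)" using c1 y by (auto intro!: mult_left_mono)
      hence "M * exp (c * y) \<le> M'"
        using mult_left_mono[of "exp (c * y)" "exp (c * a)" M] M by (simp add: M'_def)
      hence "M * exp (c * y) * (LBINT x:{0..y}. \<bar>Q x\<bar>) \<le> M' * (LBINT x:{0..y}. \<bar>Q x\<bar>)"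
        using nn by (rule mult_right_mono)
      thus ?thesis using Rb[of y] by (simp add: P_def)
    qed
    fix \<kappa> assume "c + 1 \<le> \<kappa>"
    hence "c \<le> \<kappa>" and \<kappa>: "c + 1 \<le> \<kappa>" by simp_all
    define E where "E y = exp (- 2 * \<kappa> * y)" for y
    have [measurable]: "E \<in> borel_measurable borel" unfolding E_def by measurable
    have EQ: "integrable lborel (\<lambda>x. Q x * E x)"
    proof (rule Bochner_Integration.integrable_bound[OF Q])
      show "AE x in lborel. norm (Q x * E x) \<le> norm (Q x)"
      proof (rule AE_I2)
        fix x
        show "norm (Q x * E x) \<le> norm (Q x)"
          using supp[of x] \<kappa> c1 by (cases "x < 0") (auto simp: E_def abs_mult intro!: mult_right_le_one_le)
      qed
    qed measurable
    define F where "F x y = indicator {x..} y * (Q x * K (x, y - x) * E y)" for x y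
    have F_int: "integrable (lborel \<Otimes>\<^sub>M lborel) (\<lambda>(x, y). F x y)"
    proof (rule Bochner_Integration.integrable_bound)
      show "integrable (lborel \<Otimes>\<^sub>M lborel) (\<lambda>(x, y). \<bar>Q x\<bar> * (M * (indicator {0..} y * exp (- 1 * y))))"
        by (intro lborel_pair.integrable_product aQ integrable_mult_right integrable_exp_halfline) simp
      show "(\<lambda>(x, y). F x y) \<in> borel_measurable (lborel \<Otimes>\<^sub>M lborel)"
        unfolding F_def indicator_def of_bool_def atLeast_iff by measurable
      have "norm (F x y) \<le> norm (\<bar>Q x\<bar> * (M * (indicator {0..} y * exp (- 1 * y))))" for x y
      proof (cases "0 \<le> x \<and> x \<le> y")
        case True
        hence xy: "0 \<le> x" "x \<le> y" "0 \<le> y" by auto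
        have "\<bar>K (x, y - x)\<bar> * E y \<le> (M * exp (c * (y - x))) * E y"
          using Kb[of "y - x" x] xy by (intro mult_right_mono) (auto simp: E_def)
        also have "\<dots> = M * exp (c * (y - x) + - 2 * \<kappa> * y)"
          unfolding E_def exp_add by (simp only: mult.assoc)
        also have "\<dots> \<le> M * exp (- 1 * y)"
        proof -
          have "c * (y - x) \<le> c * y" using xy c1 by (intro mult_left_mono) auto
          moreover have "(c + 1) * y \<le> (2 * \<kappa>) * y" using xy \<kappa> c1 by (intro mult_right_mono) auto
          ultimately have "c * (y - x) + - 2 * \<kappa> * y \<le> - 1 * y" by (simp add: distrib_right)
          thus ?thesis using M by (intro mult_left_mono) auto
        qed
        finally have "\<bar>Q x\<bar> * (\<bar>K (x, y - x)\<bar> * E y) \<le> \<bar>Q x\<bar> * (M * exp (- 1 * y))"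
          by (rule mult_left_mono) simp
        thus ?thesis using xy M by (simp add: F_def abs_mult E_def mult.assoc)
      next
        case False
        hence "y < x \<or> Q x = 0" using supp[of x] by auto
        thus ?thesis by (auto simp: F_def)
      qed
      thus "AE z in lborel \<Otimes>\<^sub>M lborel. norm (case z of (x, y) \<Rightarrow> F x y)
          \<le> norm (case z of (x, y) \<Rightarrow> \<bar>Q x\<bar> * (M * (indicator {0..} y * exp (- 1 * y))))"
        by (intro AE_I2) auto
    qed
    have Fy: "(LBINT y. F x y) = Q x * E x * (LBINT r. indicator {0..} r * (K (x, r) * E r))" for x
    proof -
      have "(LBINT y. F x y) = (LBINT y. (\<lambda>r. Q x * E x * (indicator {0..} r * (K (x, r) * E r))) (y - x))"
      proof (rule Bochner_Integration.integral_cong)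
        fix y
        have "E x * E (y - x) = E y"
          unfolding E_def exp_add[symmetric] by (simp add: algebra_simps)
        thus "F x y = (\<lambda>r. Q x * E x * (indicator {0..} r * (K (x, r) * E r))) (y - x)"
          by (auto simp: F_def indicator_def)
      qed simp
      also have "\<dots> = Q x * E x * (LBINT r. indicator {0..} r * (K (x, r) * E r))"
        using lborel_translate(2)[of "\<lambda>r. Q x * E x * (indicator {0..} r * (K (x, r) * E r))" x]
        unfolding integral_mult_right_zero .
      finally show ?thesis .
    qed
    have Fx: "(LBINT x. F x y) = R y * E y" for y
    proof -
      have "(LBINT x. F x y) = (LBINT x. (indicator {..y} x * (Q x * K (x, y - x))) * E y)"
        by (intro Bochner_Integration.integral_cong) (auto simp: F_def indicator_def)
      thus ?thesis by (simp add: R_def)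
    qed
    have RE: "integrable lborel (\<lambda>y. R y * E y)"
      using lborel_pair.integrable_snd[OF F_int] by (simp add: Fx)
    have FE: "integrable lborel (\<lambda>x. LBINT y. F x y)"
      using lborel_pair.integrable_fst[OF F_int] by simp
    have "(LBINT x. Q x * E x * ((1 + marchenko.jost_transform B1 \<kappa> x) * (1 + marchenko.jost_transform B2 \<kappa> x)))
        = (LBINT x. Q x * E x + (LBINT y. F x y))"
      unfolding Keq[OF \<open>c \<le> \<kappa>\<close>, folded E_def] Fy by (simp only: distrib_left mult_1_right)
    also have "\<dots> = (LBINT x. Q x * E x) + (LBINT x. LBINT y. F x y)"
      by (rule Bochner_Integration.integral_add[OF EQ FE])
    also have "(LBINT x. LBINT y. F x y) = (LBINT y. R y * E y)"
      using lborel_pair.Fubini_integral[OF F_int] by (simp add: Fx)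
    also have "(LBINT x. Q x * E x) + \<dots> = (LBINT y. Q y * E y + R y * E y)"
      by (rule Bochner_Integration.integral_add[OF EQ RE, symmetric])
    \<comment> \<open>For y < 0 both Q and R vanish, and Q vanishes from a on, so that only R
      contributes to the tail.\<close>
    also have "\<dots> = (LBINT y. indicator {0..a} y * (P y * E y) + indicator {a<..} y * (R y * E y))"
    proof (rule Bochner_Integration.integral_cong)
      fix y
      consider "y < 0" | "0 \<le> y" "y \<le> a" | "a < y" by linarith
      thus "Q y * E y + R y * E y = indicator {0..a} y * (P y * E y) + indicator {a<..} y * (R y * E y)"
        using supp[of y] R0[of y] a by cases (auto simp: P_def distrib_right)
    qed simp
    also have "\<dots> = (LBINT y. indicator {0..a} y * (P y * E y)) + (LBINT y. indicator {a<..} y * (R y * E y))"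
    proof (rule Bochner_Integration.integral_add)
      have "set_integrable lborel {0..a} (\<lambda>y. P y * E y)"
        unfolding E_def by (intro set_integrable_mult_continuous Pint continuous_intros)
      thus "integrable lborel (\<lambda>y. indicator {0..a} y * (P y * E y))" by (simp add: set_integrable_def)
      show "integrable lborel (\<lambda>y. indicator {a<..} y * (R y * E y))"
        using integrable_mult_indicator[OF _ RE, of "{a<..}"] by simp
    qed
    finally have eq: "(LBINT x. Q x * E x * ((1 + marchenko.jost_transform B1 \<kappa> x) * (1 + marchenko.jost_transform B2 \<kappa> x)))
      = (LBINT y:{0..a}. P y * E y) + (LBINT y. indicator {a<..} y * (R y * E y))"
      by (simp add: set_lebesgue_integral_def)
    \<comment> \<open>The tail is dominated by a multiple of e^((c - 2 \<kappa>) y) on [a,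
      infinity), whose integral costs a division by 2 \<kappa> - c >= 1.\<close>
    have neg: "c - 2 * \<kappa> < 0" using \<kappa> c1 by simp
    have "\<bar>LBINT y. indicator {a<..} y * (R y * E y)\<bar> \<le> (LBINT y. \<bar>indicator {a<..} y * (R y * E y)\<bar>)"
      by (rule integral_abs_bound)
    also have "\<dots> \<le> (LBINT y. T * M * (indicator {a..} y * exp ((c - 2 * \<kappa>) * y)))"
    proof (rule integral_mono')
      show "integrable lborel (\<lambda>y. T * M * (indicator {a..} y * exp ((c - 2 * \<kappa>) * y)))"
        by (intro integrable_mult_right integrable_exp_halfline neg)
      fix y
      have "\<bar>R y\<bar> * E y \<le> T * M * exp (c * y) * E y"
        using Rb'[of y] by (intro mult_right_mono) (auto simp: E_def)
      also have "\<dots> = T * M * exp ((c - 2 * \<kappa>) * y)"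
        by (simp add: E_def mult.assoc exp_add[symmetric] algebra_simps)
      finally show "\<bar>indicator {a<..} y * (R y * E y)\<bar> \<le> T * M * (indicator {a..} y * exp ((c - 2 * \<kappa>) * y))"
        using T M by (auto simp: indicator_def abs_mult E_def)
    qed (use T M in \<open>auto simp: indicator_def\<close>)
    also have "\<dots> = T * M * (exp ((c - 2 * \<kappa>) * a) / (- (c - 2 * \<kappa>)))"
      unfolding integral_mult_right_zero integrable_exp_halfline(2)[OF neg] ..
    also have "\<dots> \<le> T * M * (exp ((c - 2 * \<kappa>) * a) / 1)"
      using T M \<kappa> c1 by (intro mult_left_mono divide_left_mono) auto
    also have "\<dots> = T * M * exp (c * a) * exp (- 2 * \<kappa> * a)"
      by (simp add: mult.assoc exp_add[symmetric] algebra_simps)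
    also have "\<dots> \<le> M' * exp (- 2 * \<kappa> * a)"
      by (intro mult_right_mono) (auto simp: M'_def)
    finally show "\<bar>(LBINT y:{0..a}. P y * exp (- 2 * \<kappa> * y))
      - (LBINT x. Q x * exp (- 2 * \<kappa> * x) * ((1 + marchenko.jost_transform B1 \<kappa> x) * (1 + marchenko.jost_transform B2 \<kappa> x)))\<bar>
      \<le> M' * exp (- 2 * \<kappa> * a)"
      using eq unfolding E_def by linarith
  qed
qed

section \<open>The local uniqueness theorem\<close>

lemma marchenko_exists:
  assumes "integrable lborel q"
  obtains N B where "marchenko q N B"
proof -
  obtain B where "marchenko q (LBINT t. \<bar>q t\<bar>) B"
    by (rule marchenko_kernel[OF assms refl], rule that, rule marchenko.intro[OF assms refl])
  thus ?thesis by (rule that)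
qed

lemma integrable_imp_halfline_potential:
  assumes q: "integrable lborel q"
  shows "halfline_potential q (LBINT t. \<bar>q t\<bar>)"
proof
  show "q \<in> borel_measurable borel" using q by (auto dest: borel_measurable_integrable)
  show "set_integrable lborel {0..X} q" for X
    using integrable_mult_indicator[OF _ q, of "{0..X}"] by (simp add: set_integrable_def)
  show "(LBINT t:{x..x+1}. max (- q t) 0) \<le> (LBINT t. \<bar>q t\<bar>)" for x
    unfolding set_lebesgue_integral_def
    by (rule integral_mono') (use q in \<open>auto simp: indicator_def\<close>)
qed

text \<open>A Jost solution decays exponentially, hence is square integrable and a Weyl solution on
  the half-line; h is a dummy for infinite b. The bound 2 on f(0) will turn an estimate for the
  difference of m-functions into one for the Wronskian at 0.\<close>

lemma jost_m_function:
  assumes mar: "marchenko q N B" and a: "0 < a" and supp: "\<And>t. a \<le> t \<Longrightarrow> q t = 0"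
  obtains \<kappa>0 where "\<And>\<kappa>. \<kappa>0 \<le> \<kappa> \<Longrightarrow> \<exists>f v. ac_on a f v \<and> ac_on a v (\<lambda>x. (q x + \<kappa>\<^sup>2) * f x) \<and>
    (\<forall>x. f x = exp (- \<kappa> * x) * (1 + marchenko.jost_transform B \<kappa> x)) \<and>
    f a = exp (- \<kappa> * a) \<and> v a = - \<kappa> * exp (- \<kappa> * a) \<and> f 0 \<noteq> 0 \<and> \<bar>f 0\<bar> \<le> 2 \<and>
    m_function q \<infinity> h (of_real (- (\<kappa>\<^sup>2))) = of_real (v 0 / f 0)"
proof -
  interpret marchenko q N B by fact
  interpret halfline_potential q "LBINT t. \<bar>q t\<bar>"
    by (rule integrable_imp_halfline_potential[OF q])
  obtain k where k: "\<And>\<kappa> U V. k \<le> \<kappa> \<Longrightarrow> weyl_solution q \<infinity> h (of_real (- (\<kappa>\<^sup>2))) U V \<Longrightarrow>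
      U 0 \<noteq> 0 \<and> m_function q \<infinity> h (of_real (- (\<kappa>\<^sup>2))) = V 0 / U 0"
    by (rule m_function_asymptotics[of \<infinity> h a]) (use a in auto)
  show ?thesis
  proof (rule that[of "max k (N + 1)"])
    fix \<kappa> assume "max k (N + 1) \<le> \<kappa>"
    hence k\<kappa>: "k \<le> \<kappa>" and \<kappa>: "N + 1 \<le> \<kappa>" by auto
    have k1: "1 \<le> \<kappa>" using \<kappa> N_nonneg by simp
    obtain f v where f: "\<And>X. ac_on X f v" and v: "\<And>X. ac_on X v (\<lambda>x. (q x + \<kappa>\<^sup>2) * f x)"
      and fx: "\<And>x. f x = exp (- \<kappa> * x) * (1 + jost_transform \<kappa> x)"
      and fa: "\<And>x. a \<le> x \<Longrightarrow> f x = exp (- \<kappa> * x)" and va: "\<And>x. a \<le> x \<Longrightarrow> v x = - \<kappa> * exp (- \<kappa> * x)"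
      by (rule jost_solution[OF \<kappa> supp], assumption, rule that)
    have fb: "\<bar>f x\<bar> \<le> 2 * exp (- x)" if x: "0 \<le> x" for x
    proof -
      have "\<bar>1 + jost_transform \<kappa> x\<bar> \<le> 2"
        using jost_transform_bound[OF \<kappa>, of x] by linarith
      moreover have "exp (- \<kappa> * x) \<le> exp (- x)"
        using mult_right_mono[OF k1 x] by simp
      ultimately have "exp (- \<kappa> * x) * \<bar>1 + jost_transform \<kappa> x\<bar> \<le> exp (- x) * 2"
        by (intro mult_mono) auto
      thus ?thesis unfolding fx by (simp add: abs_mult)
    qed
    have "condition_at_right_end \<infinity> h (\<lambda>x. of_real (f x)) (\<lambda>x. of_real (v x))"
      using square_integrable_of_exp_decay[OF ac_on_continuous_halfline[OF f] fb]
      by (auto simp: condition_at_right_end_def intro!: exI[of _ 0])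
    moreover have "\<exists>x. 0 < x \<and> ereal x < \<infinity> \<and> complex_of_real (f x) \<noteq> 0"
      using fa[of a] a by (intro exI[of _ a]) auto
    ultimately have "weyl_solution q \<infinity> h (of_real (- (\<kappa>\<^sup>2))) (\<lambda>x. of_real (f x)) (\<lambda>x. of_real (v x))"
      using schroedinger_solution_of_real[OF f v] by (simp add: weyl_solution_def)
    from k[OF k\<kappa> this] have f0: "f 0 \<noteq> 0" and m: "m_function q \<infinity> h (of_real (- (\<kappa>\<^sup>2))) = of_real (v 0 / f 0)"
      by auto
    have f0': "\<bar>f 0\<bar> \<le> 2" using fb[of 0] by simp
    show "\<exists>f v. ac_on a f v \<and> ac_on a v (\<lambda>x. (q x + \<kappa>\<^sup>2) * f x) \<and>
      (\<forall>x. f x = exp (- \<kappa> * x) * (1 + jost_transform \<kappa> x)) \<and>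
      f a = exp (- \<kappa> * a) \<and> v a = - \<kappa> * exp (- \<kappa> * a) \<and> f 0 \<noteq> 0 \<and> \<bar>f 0\<bar> \<le> 2 \<and>
      m_function q \<infinity> h (of_real (- (\<kappa>\<^sup>2))) = of_real (v 0 / f 0)"
      by (intro exI[of _ f] exI[of _ v] conjI allI f v fx fa[OF order_refl] va[OF order_refl] f0 f0' m)
  qed
qed

text \<open>The hypothesis holds only almost everywhere, so it is integrated once: with Z the
  primitive of |Q| and Y that of Z, it becomes Z <= M Y at every point. Then Y e^(-M y) is
  nonincreasing from 0, so Y <= 0, Z <= 0, and the primitive of |Q| vanishes.\<close>

lemma gronwall_zero:
  fixes Q :: "real \<Rightarrow> real"
  assumes Q: "set_integrable lborel {0..a} Q" and [measurable]: "Q \<in> borel_measurable borel" and M: "0 \<le> M"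
    and bound: "AE y in lborel. y \<in> {0..a} \<longrightarrow> \<bar>Q y\<bar> \<le> M * (LBINT x:{0..y}. \<bar>Q x\<bar>)"
  shows "AE y in lborel. y \<in> {0..a} \<longrightarrow> Q y = 0"
proof -
  define Z where "Z y = 0 + (LBINT x:{0..y}. \<bar>Q x\<bar>)" for y
  have Z: "ac_on a Z (\<lambda>x. \<bar>Q x\<bar>)"
    unfolding Z_def by (rule ac_on_primitive[OF set_integrable_abs[OF Q]])
  have Zi: "set_integrable lborel {0..a} Z"
    by (rule borel_integrable_atLeastAtMost'[OF ac_on_continuous[OF Z]])
  define Y where "Y y = 0 + (LBINT x:{0..y}. Z x)" for y
  have Y: "ac_on a Y Z"
    unfolding Y_def by (rule ac_on_primitive[OF Zi])
  have ZY: "Z y \<le> M * Y y" if y: "y \<in> {0..a}" for y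
  proof -
    have s: "set_integrable lborel {0..y} g" if "set_integrable lborel {0..a} g" for g :: "real \<Rightarrow> real"
      using set_integrable_subset[OF that, of "{0..y}"] y by auto
    have "(LBINT x:{0..y}. \<bar>Q x\<bar>) \<le> (LBINT x:{0..y}. M * Z x)"
      unfolding set_lebesgue_integral_def
    proof (rule integral_mono_AE)
      show "AE x in lborel. indicator {0..y} x *\<^sub>R \<bar>Q x\<bar> \<le> indicator {0..y} x *\<^sub>R (M * Z x)"
        using bound by eventually_elim (use y in \<open>auto simp: indicator_def Z_def\<close>)
    qed (use s[OF set_integrable_abs[OF Q]] s[OF set_integrable_mult_right[OF Zi, of M]] in \<open>auto simp: set_integrable_def\<close>)
    thus ?thesis by (simp add: Z_def Y_def)
  qed
  have "Y y \<le> 0" if y: "y \<in> {0..a}" for y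
  proof -
    have "- (Y 0 * exp (- M * 0)) \<le> - (Y y * exp (- M * y))"
    proof (rule ac_on_mono[OF ac_on_minus[OF ac_on_mult[OF Y ac_on_exp_linear]]])
      fix t assume "t \<in> {0..y}"
      hence "0 \<le> (M * Y t - Z t) * exp (- M * t)" using ZY[of t] y by auto
      thus "0 \<le> - (Z t * exp (- M * t) + Y t * (- M * exp (- M * t)))"
        by (simp add: algebra_simps)
    qed (use y in auto)
    moreover have "Y 0 = 0" by (simp add: Y_def set_integral_at_point)
    ultimately show ?thesis by (simp add: mult_le_0_iff)
  qed
  hence Z0: "Z y \<le> 0" if "y \<in> {0..a}" for y
    using ZY[OF that] mult_left_mono[of "Y y" 0 M] M that by fastforce
  have "AE y in lborel. y \<in> {0..a} \<longrightarrow> \<bar>Q y\<bar> = 0"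
  proof (rule density_zero_of_primitive_zero)
    show "set_integrable lborel {0..a} (\<lambda>y. \<bar>Q y\<bar>)" by (rule set_integrable_abs[OF Q])
    fix y assume "y \<in> {0..a}"
    moreover have "0 \<le> (LBINT x:{0..y}. \<bar>Q x\<bar>)"
      unfolding set_lebesgue_integral_def by (intro integral_nonneg_AE) auto
    ultimately show "(LBINT x:{0..y}. \<bar>Q x\<bar>) = 0"
      using Z0[of y] by (simp add: Z_def)
  qed measurable
  thus ?thesis by simp
qed

lemma soft_bigo_exp_bound:
  fixes f :: "real \<Rightarrow> 'a::real_normed_vector"
  assumes f: "soft_bigo at_top f (\<lambda>\<kappa>. exp (- 2 * \<kappa> * a))" and a: "0 < a" and \<epsilon>: "0 < \<epsilon>"
  obtains \<kappa>0 where "\<And>\<kappa>. \<kappa>0 \<le> \<kappa> \<Longrightarrow> norm (f \<kappa>) \<le> exp (- 2 * \<kappa> * a) * exp (\<epsilon> * \<kappa>)"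
proof -
  \<comment> \<open>Chosen such that e^(-2 \<kappa> a (1 - \<delta>)) = e^(-2 \<kappa> a)
    e^(\<epsilon> \<kappa>).\<close>
  define \<delta> where "\<delta> = \<epsilon> / (2 * a)"
  have "((\<lambda>\<kappa>. norm (f \<kappa>) / norm (exp (- 2 * \<kappa> * a)) powr (1 - \<delta>)) \<longlongrightarrow> 0) at_top"
    using f a \<epsilon> by (simp add: soft_bigo_def \<delta>_def)
  hence "eventually (\<lambda>\<kappa>. norm (f \<kappa>) / norm (exp (- 2 * \<kappa> * a)) powr (1 - \<delta>) < 1) at_top"
    by (rule order_tendstoD) simp
  then obtain \<kappa>0 where k: "\<And>\<kappa>. \<kappa>0 \<le> \<kappa> \<Longrightarrow> norm (f \<kappa>) / norm (exp (- 2 * \<kappa> * a)) powr (1 - \<delta>) < 1"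
    by (auto simp: eventually_at_top_linorder)
  show ?thesis
  proof (rule that)
    fix \<kappa> assume "\<kappa>0 \<le> \<kappa>"
    have "norm (exp (- 2 * \<kappa> * a)) powr (1 - \<delta>) = exp (- 2 * \<kappa> * a * (1 - \<delta>))"
      by (simp add: powr_def)
    also have "- 2 * \<kappa> * a * (1 - \<delta>) = - 2 * \<kappa> * a + \<epsilon> * \<kappa>"
      using a by (simp add: \<delta>_def field_simps)
    finally show "norm (f \<kappa>) \<le> exp (- 2 * \<kappa> * a) * exp (\<epsilon> * \<kappa>)"
      using k[OF \<open>\<kappa>0 \<le> \<kappa>\<close>] unfolding exp_add[symmetric] by (simp add: divide_less_eq)
  qed
qed

lemma potentials_eq_of_m_function_soft_bigo:
  assumes q1: "integrable lborel q1" and q2: "integrable lborel q2" and a: "0 < a"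
    and supp1: "\<And>t. t < 0 \<or> a \<le> t \<Longrightarrow> q1 t = 0" and supp2: "\<And>t. t < 0 \<or> a \<le> t \<Longrightarrow> q2 t = 0"
    and m: "soft_bigo at_top
      (\<lambda>\<kappa>::real. m_function q1 \<infinity> h1 (of_real (- (\<kappa>\<^sup>2))) - m_function q2 \<infinity> h2 (of_real (- (\<kappa>\<^sup>2))))
      (\<lambda>\<kappa>::real. exp (- 2 * \<kappa> * a))"
  shows "AE x in lborel. x \<in> {0..a} \<longrightarrow> q1 x = q2 x"
proof -
  obtain N1 B1 where m1: "marchenko q1 N1 B1" by (rule marchenko_exists[OF q1])
  obtain N2 B2 where m2: "marchenko q2 N2 B2" by (rule marchenko_exists[OF q2])
  define Q where "Q x = q1 x - q2 x" for x
  define w where "w \<kappa> x = (1 + marchenko.jost_transform B1 \<kappa> x) * (1 + marchenko.jost_transform B2 \<kappa> x)" for \<kappa> x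
  have Q: "integrable lborel Q" using q1 q2 unfolding Q_def by simp
  have [measurable]: "Q \<in> borel_measurable borel" using Q by (auto dest: borel_measurable_integrable)
  have Qsupp: "Q t = 0" if "t < 0 \<or> a \<le> t" for t using supp1[OF that] supp2[OF that] by (simp add: Q_def)
  have sQ: "set_integrable lborel {0..a} Q"
    using integrable_mult_indicator[OF _ Q, of "{0..a}"] by (simp add: set_integrable_def)
  obtain k1 where k1: "\<And>\<kappa>. k1 \<le> \<kappa> \<Longrightarrow> \<exists>f v. ac_on a f v \<and> ac_on a v (\<lambda>x. (q1 x + \<kappa>\<^sup>2) * f x) \<and>
    (\<forall>x. f x = exp (- \<kappa> * x) * (1 + marchenko.jost_transform B1 \<kappa> x)) \<and>
    f a = exp (- \<kappa> * a) \<and> v a = - \<kappa> * exp (- \<kappa> * a) \<and> f 0 \<noteq> 0 \<and> \<bar>f 0\<bar> \<le> 2 \<and>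
    m_function q1 \<infinity> h1 (of_real (- (\<kappa>\<^sup>2))) = of_real (v 0 / f 0)"
    using jost_m_function[OF m1 a, of h1] supp1 by blast
  obtain k2 where k2: "\<And>\<kappa>. k2 \<le> \<kappa> \<Longrightarrow> \<exists>f v. ac_on a f v \<and> ac_on a v (\<lambda>x. (q2 x + \<kappa>\<^sup>2) * f x) \<and>
    (\<forall>x. f x = exp (- \<kappa> * x) * (1 + marchenko.jost_transform B2 \<kappa> x)) \<and>
    f a = exp (- \<kappa> * a) \<and> v a = - \<kappa> * exp (- \<kappa> * a) \<and> f 0 \<noteq> 0 \<and> \<bar>f 0\<bar> \<le> 2 \<and>
    m_function q2 \<infinity> h2 (of_real (- (\<kappa>\<^sup>2))) = of_real (v 0 / f 0)"
    using jost_m_function[OF m2 a, of h2] supp2 by blast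
  \<comment> \<open>The Wronskian identity on [0, a] divided by f1(0) f2(0); the factor 4 is the
    bound 2 for each of the two values at 0.\<close>
  have transform: "\<bar>LBINT x. Q x * exp (- 2 * \<kappa> * x) * w \<kappa> x\<bar>
      \<le> 4 * norm (m_function q1 \<infinity> h1 (of_real (- (\<kappa>\<^sup>2))) - m_function q2 \<infinity> h2 (of_real (- (\<kappa>\<^sup>2))))"
    if \<kappa>: "max k1 k2 \<le> \<kappa>" for \<kappa>
  proof -
    obtain f1 v1 where f1: "ac_on a f1 v1" "ac_on a v1 (\<lambda>x. (q1 x + \<kappa>\<^sup>2) * f1 x)"
      "\<And>x. f1 x = exp (- \<kappa> * x) * (1 + marchenko.jost_transform B1 \<kappa> x)"
      "f1 a = exp (- \<kappa> * a)" "v1 a = - \<kappa> * exp (- \<kappa> * a)" "f1 0 \<noteq> 0" "\<bar>f1 0\<bar> \<le> 2"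
      "m_function q1 \<infinity> h1 (of_real (- (\<kappa>\<^sup>2))) = of_real (v1 0 / f1 0)"
      using k1[of \<kappa>] \<kappa> by auto
    obtain f2 v2 where f2: "ac_on a f2 v2" "ac_on a v2 (\<lambda>x. (q2 x + \<kappa>\<^sup>2) * f2 x)"
      "\<And>x. f2 x = exp (- \<kappa> * x) * (1 + marchenko.jost_transform B2 \<kappa> x)"
      "f2 a = exp (- \<kappa> * a)" "v2 a = - \<kappa> * exp (- \<kappa> * a)" "f2 0 \<noteq> 0" "\<bar>f2 0\<bar> \<le> 2"
      "m_function q2 \<infinity> h2 (of_real (- (\<kappa>\<^sup>2))) = of_real (v2 0 / f2 0)"
      using k2[of \<kappa>] \<kappa> by auto
    define W where "W x = v1 x * f2 x - f1 x * v2 x" for x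
    have "ac_on a W (\<lambda>x. ((q1 x + \<kappa>\<^sup>2) - (q2 x + \<kappa>\<^sup>2)) * f1 x * f2 x)"
      unfolding W_def[abs_def] by (rule ac_on_wronskian[OF f1(1,2) f2(1,2)])
    from ac_onD[OF this, of a] a
    have "(LBINT x:{0..a}. ((q1 x + \<kappa>\<^sup>2) - (q2 x + \<kappa>\<^sup>2)) * f1 x * f2 x) = W a - W 0" by simp
    \<comment> \<open>Both Jost solutions have the same value and the same derivative at a.\<close>
    also have "W a = 0" by (simp add: W_def f1(4,5) f2(4,5))
    also have "(LBINT x:{0..a}. ((q1 x + \<kappa>\<^sup>2) - (q2 x + \<kappa>\<^sup>2)) * f1 x * f2 x) = (LBINT x. Q x * exp (- 2 * \<kappa> * x) * w \<kappa> x)"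
      unfolding set_lebesgue_integral_def
    proof (rule Bochner_Integration.integral_cong)
      fix x
      have "exp (- 2 * \<kappa> * x) = exp (- \<kappa> * x) * exp (- \<kappa> * x)"
        unfolding exp_add[symmetric] by simp
      moreover have "Q x = 0" if "x \<notin> {0..a}" using Qsupp[of x] that by auto
      ultimately show "indicator {0..a} x *\<^sub>R (((q1 x + \<kappa>\<^sup>2) - (q2 x + \<kappa>\<^sup>2)) * f1 x * f2 x) = Q x * exp (- 2 * \<kappa> * x) * w \<kappa> x"
        unfolding f1(3)[of x] f2(3)[of x] w_def by (cases "x \<in> {0..a}") (auto simp: Q_def mult_ac)
    qed simp
    finally have eq: "(LBINT x. Q x * exp (- 2 * \<kappa> * x) * w \<kappa> x) = - W 0" by simp
    have "v1 0 / f1 0 - v2 0 / f2 0 = W 0 / (f1 0 * f2 0)"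
      using f1(6) f2(6) by (simp add: W_def field_simps)
    hence "m_function q1 \<infinity> h1 (of_real (- (\<kappa>\<^sup>2))) - m_function q2 \<infinity> h2 (of_real (- (\<kappa>\<^sup>2)))
        = of_real (W 0 / (f1 0 * f2 0))"
      unfolding f1(8) f2(8) of_real_diff[symmetric] by simp
    hence "norm (m_function q1 \<infinity> h1 (of_real (- (\<kappa>\<^sup>2))) - m_function q2 \<infinity> h2 (of_real (- (\<kappa>\<^sup>2))))
        = \<bar>W 0\<bar> / (\<bar>f1 0\<bar> * \<bar>f2 0\<bar>)"
      by (simp only: norm_of_real) (simp add: abs_mult)
    moreover have "\<bar>W 0\<bar> / 4 \<le> \<bar>W 0\<bar> / (\<bar>f1 0\<bar> * \<bar>f2 0\<bar>)"
      using mult_mono[OF f1(7) f2(7)] f1(6) f2(6) by (intro divide_left_mono) auto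
    ultimately show ?thesis unfolding eq abs_minus_cancel by linarith
  qed
  obtain P M \<kappa>0 where P: "P \<in> borel_measurable borel" "set_integrable lborel {0..a} P" and M: "0 \<le> M"
    and PQ: "\<And>y. y \<in> {0..a} \<Longrightarrow> \<bar>P y - Q y\<bar> \<le> M * (LBINT x:{0..y}. \<bar>Q x\<bar>)"
    and PL: "\<And>\<kappa>. \<kappa>0 \<le> \<kappa> \<Longrightarrow> \<bar>(LBINT y:{0..a}. P y * exp (- 2 * \<kappa> * y))
      - (LBINT x. Q x * exp (- 2 * \<kappa> * x) * w \<kappa> x)\<bar> \<le> M * exp (- 2 * \<kappa> * a)"
    by (rule marchenko_product_laplace[OF m1 m2 a Q Qsupp, folded w_def], assumption, rule that)
  have "AE y in lborel. y \<in> {0..a} \<longrightarrow> P y = 0"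
  proof (rule laplace_uniqueness[OF P])
    fix \<epsilon> :: real assume \<epsilon>: "0 < \<epsilon>"
    obtain k3 where k3: "\<And>\<kappa>. k3 \<le> \<kappa> \<Longrightarrow>
      norm (m_function q1 \<infinity> h1 (of_real (- (\<kappa>\<^sup>2))) - m_function q2 \<infinity> h2 (of_real (- (\<kappa>\<^sup>2)))) \<le> exp (- 2 * \<kappa> * a) * exp (\<epsilon> * \<kappa>)"
      using soft_bigo_exp_bound[OF m a \<epsilon>] by blast
    show "\<exists>C \<kappa>0. \<forall>\<kappa>\<ge>\<kappa>0. \<bar>LBINT y:{0..a}. P y * exp (2 * \<kappa> * (a - y))\<bar> \<le> C * exp (\<epsilon> * \<kappa>)"
    proof (intro exI allI impI)
      fix \<kappa> assume "max (max (max k1 k2) k3) (max \<kappa>0 0) \<le> \<kappa>"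
      hence k: "max k1 k2 \<le> \<kappa>" "k3 \<le> \<kappa>" "\<kappa>0 \<le> \<kappa>" "0 \<le> \<kappa>" by auto
      have "\<bar>LBINT y:{0..a}. P y * exp (- 2 * \<kappa> * y)\<bar>
          \<le> 4 * (exp (- 2 * \<kappa> * a) * exp (\<epsilon> * \<kappa>)) + M * exp (- 2 * \<kappa> * a)"
        using transform[OF k(1)] k3[OF k(2)] PL[OF k(3)] by linarith
      also have "M * exp (- 2 * \<kappa> * a) \<le> M * (exp (- 2 * \<kappa> * a) * exp (\<epsilon> * \<kappa>))"
        using k(4) \<epsilon> M by (intro mult_left_mono) auto
      finally have b: "\<bar>LBINT y:{0..a}. P y * exp (- 2 * \<kappa> * y)\<bar> \<le> exp (- 2 * \<kappa> * a) * ((4 + M) * exp (\<epsilon> * \<kappa>))"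
        by (simp add: algebra_simps)
      have "exp (2 * \<kappa> * (a - y)) = exp (2 * \<kappa> * a) * exp (- 2 * \<kappa> * y)" for y
        unfolding exp_add[symmetric] by (simp add: algebra_simps)
      hence "(LBINT y:{0..a}. P y * exp (2 * \<kappa> * (a - y))) = exp (2 * \<kappa> * a) * (LBINT y:{0..a}. P y * exp (- 2 * \<kappa> * y))"
        by (simp only: set_integral_mult_right[symmetric] mult.left_commute)
      hence "\<bar>LBINT y:{0..a}. P y * exp (2 * \<kappa> * (a - y))\<bar> \<le> exp (2 * \<kappa> * a) * (exp (- 2 * \<kappa> * a) * ((4 + M) * exp (\<epsilon> * \<kappa>)))"
        using mult_left_mono[OF b, of "exp (2 * \<kappa> * a)"] by (simp add: abs_mult)
      also have "\<dots> = (4 + M) * exp (\<epsilon> * \<kappa>)"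
        by (simp add: mult.assoc[symmetric] exp_add[symmetric])
      finally show "\<bar>LBINT y:{0..a}. P y * exp (2 * \<kappa> * (a - y))\<bar> \<le> (4 + M) * exp (\<epsilon> * \<kappa>)" .
    qed
  qed
  \<comment> \<open>With P = 0 the Volterra bound for P - Q becomes the hypothesis of Gronwall's
    inequality for Q.\<close>
  hence "AE y in lborel. y \<in> {0..a} \<longrightarrow> \<bar>Q y\<bar> \<le> M * (LBINT x:{0..y}. \<bar>Q x\<bar>)"
    by eventually_elim (use PQ in force)
  from gronwall_zero[OF sQ \<open>Q \<in> borel_measurable borel\<close> M this] show ?thesis
    by (simp add: Q_def)
qed

section \<open>Reduction to Borel potentials and conclusion\<close>

text \<open>A potential is only Lebesgue measurable, and arbitrary outside (0, b). A Borel function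
  equal almost everywhere to its extension by zero does not change any solution, since q occurs in
  their definition only under an integral over a subset of (0, b); so the m-function is the same for
  every z.\<close>

lemma potential_borel_version:
  assumes pot: "is_potential q b h"
  obtains q' C where "halfline_potential q' C"
    and "AE x in lborel. 0 < x \<and> ereal x < b \<longrightarrow> q x = q' x"
    and "\<And>z. m_function q b h z = m_function q' b h z"
proof -
  define S where "S = {x. 0 < x \<and> ereal x < b}"
  have b: "0 < b" and qm: "(\<lambda>x. indicator S x * q x) \<in> borel_measurable lebesgue"
    using pot unfolding is_potential_def set_borel_measurable_def S_def real_scaleR_def by blast+
  obtain q' where [measurable]: "q' \<in> borel_measurable lborel" and ae: "AE x in lborel. indicator S x * q x = q' x"
    using completion_ex_borel_measurable_real[OF qm] by auto
  have ae': "AE x in lebesgue. indicator S x * q x = q' x"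
    by (rule AE_completion[OF ae])
  have q'm: "q' \<in> borel_measurable lebesgue" by (rule measurable_completion) measurable
  have transfer: "set_integrable lborel {y..x} q'"
    if "set_integrable lebesgue {y<..<x} q" "{y<..<x} \<subseteq> S" for x y
  proof -
    have "integrable lebesgue (\<lambda>t. indicator {y<..<x} t *\<^sub>R q' t)"
    proof (rule integrable_cong_AE_imp[OF that(1)[unfolded set_integrable_def]])
      show "(\<lambda>t. indicator {y<..<x} t *\<^sub>R q' t) \<in> borel_measurable lebesgue"
        by (rule measurable_completion) measurable
      show "AE t in lebesgue. indicator {y<..<x} t *\<^sub>R q t = indicator {y<..<x} t *\<^sub>R q' t"
        using ae' by eventually_elim (use that(2) in \<open>auto simp: indicator_def\<close>)
    qed
    hence "integrable lborel (\<lambda>t. indicator {y<..<x} t *\<^sub>R q' t)"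
      by (subst (asm) integrable_completion) measurable
    hence "integrable lborel (\<lambda>t. indicator {y..x} t *\<^sub>R q' t)"
    proof (rule integrable_cong_AE_imp)
      show "AE t in lborel. indicator {y<..<x} t *\<^sub>R q' t = indicator {y..x} t *\<^sub>R q' t"
        using AE_lborel_singleton[of x] AE_lborel_singleton[of y]
        by eventually_elim (auto simp: indicator_def)
    qed measurable
    thus ?thesis by (simp add: set_integrable_def)
  qed
  have "\<exists>C. halfline_potential q' C"
  proof (cases "b < \<infinity>")
    case True
    then obtain r where br: "b = ereal r" using b by (cases b) auto
    have "set_integrable lborel {0..r} q'"
      using pot True by (intro transfer) (auto simp: is_potential_def S_def br)
    \<comment> \<open>Outside (0, r) the Borel version vanishes almost everywhere.\<close>
    hence "integrable lborel q'"
      unfolding set_integrable_def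
    proof (rule integrable_cong_AE_imp)
      show "AE t in lborel. indicator {0..r} t *\<^sub>R q' t = q' t"
        using ae
      proof eventually_elim
        case (elim t)
        thus ?case by (cases "t \<in> {0..r}") (auto simp: S_def br)
      qed
    qed measurable
    thus ?thesis using integrable_imp_halfline_potential by blast
  next
    case False
    hence binf: "b = \<infinity>" by simp
    have loc: "\<And>y. 0 \<le> y \<Longrightarrow> set_integrable lebesgue {y<..<y+1} q"
      using pot binf by (simp add: is_potential_def)
    obtain C where C: "\<And>y. 0 < y \<Longrightarrow> (LINT x:{y<..<y+1}|lebesgue. max (- q x) 0) \<le> C"
      using pot binf by (auto simp: is_potential_def)
    have loc': "set_integrable lborel {y..y+1} q'" if "0 \<le> y" for y
      using that by (intro transfer loc) (auto simp: S_def binf)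
    have int_nat: "set_integrable lborel {0..real n} q'" for n
    proof (induction n)
      case 0
      show ?case using set_integrable_subset[OF loc'[of 0], of "{0..real 0}"] by simp
    next
      case (Suc n)
      have "set_integrable lborel ({0..real n} \<union> {real n..real n + 1}) q'"
        by (intro set_integrable_Un Suc loc') auto
      moreover have "{0..real n} \<union> {real n..real n + 1} = {0..real (Suc n)}" by auto
      ultimately show ?case by simp
    qed
    have int: "set_integrable lborel {0..X} q'" for X
      using set_integrable_subset[OF int_nat[of "nat \<lceil>X\<rceil>"], of "{0..X}"] by (auto simp: le_nat_iff intro: order_trans[OF _ real_nat_ceiling_ge])
    \<comment> \<open>The definition of a potential bounds these integrals for y > 0 only, the
      locale also at y = 0; the integral over [0, 1] is therefore added to the maximum.\<close>
    have "(LBINT t:{y..y+1}. max (- q' t) 0) \<le> max C (LBINT t:{0..1}. max (- q' t) 0)" if y: "0 \<le> y" for y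
    proof (cases "y = 0")
      case False
      have "set_integrable lborel {y..y+1} (\<lambda>t. max (- q' t) 0)"
        unfolding set_integrable_def
        by (rule Bochner_Integration.integrable_bound[OF loc'[OF y, unfolded set_integrable_def]])
           (auto simp: indicator_def)
      hence "(LBINT t:{y..y+1}. max (- q' t) 0) = (LINT t:{y<..<y+1}|lebesgue. max (- q' t) 0)"
        by (rule lebesgue_integral_open_interval[symmetric])
      also have "\<dots> = (LINT t:{y<..<y+1}|lebesgue. max (- q t) 0)"
        unfolding set_lebesgue_integral_def
      proof (rule integral_cong_AE)
        have eq: "(\<lambda>t. indicator {y<..<y+1} t *\<^sub>R max (- q t) 0) = (\<lambda>t. indicator {y<..<y+1} t *\<^sub>R max (- (indicator S t * q t)) 0)"
          using y by (auto simp: indicator_def S_def binf)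
        show "(\<lambda>t. indicator {y<..<y+1} t *\<^sub>R max (- q t) 0) \<in> borel_measurable lebesgue"
          unfolding eq
          by (intro borel_measurable_scaleR borel_measurable_indicator borel_measurable_max borel_measurable_uminus qm)
             (auto intro: sets_completionI_sets)
        show "(\<lambda>t. indicator {y<..<y+1} t *\<^sub>R max (- q' t) 0) \<in> borel_measurable lebesgue"
          by (rule measurable_completion) measurable
        show "AE t in lebesgue. indicator {y<..<y+1} t *\<^sub>R max (- q' t) 0 = indicator {y<..<y+1} t *\<^sub>R max (- q t) 0"
          using ae' by eventually_elim (use y in \<open>auto simp: indicator_def S_def binf\<close>)
      qed
      also have "\<dots> \<le> C" using C[of y] False y by simp
      finally show ?thesis by simp
    qed simp
    with int show ?thesis by (intro exI) (unfold_locales, auto)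
  qed
  then obtain C where hp: "halfline_potential q' C" by auto
  have integral_eq: "(LINT t:{0<..<x}|lebesgue. (of_real (q t) - z) * u t) = (LINT t:{0<..<x}|lebesgue. (of_real (q' t) - z) * u t)"
    if d: "\<forall>x\<in>{x. 0 \<le> x \<and> ereal x \<le> b}. (u has_vector_derivative v x) (at x within {x. 0 \<le> x \<and> ereal x \<le> b})"
      and x: "0 \<le> x" "ereal x \<le> b" for u v :: "real \<Rightarrow> complex" and x :: real and z
  proof -
    have sub: "{0<..<x} \<subseteq> {x. 0 \<le> x \<and> ereal x \<le> b}"
      by (auto intro: order_trans[OF _ x(2)])
    have "continuous_on {x. 0 \<le> x \<and> ereal x \<le> b} u"
      unfolding continuous_on_eq_continuous_within using d has_vector_derivative_continuous by blast
    hence "(\<lambda>t. indicator {0<..<x} t *\<^sub>R u t) \<in> borel_measurable borel"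
      using continuous_on_subset[OF _ sub] by (intro borel_measurable_continuous_on_indicator) auto
    hence um: "(\<lambda>t. indicator {0<..<x} t *\<^sub>R u t) \<in> borel_measurable lebesgue"
      by (simp add: measurable_completion)
    have S: "t \<in> S" if "t \<in> {0<..<x}" for t
      using that less_le_trans[of "ereal t" "ereal x" b] x by (auto simp: S_def)
    have eq: "indicator {0<..<x} t *\<^sub>R ((of_real (p t) - z) * u t) = (of_real (p t) - z) * (indicator {0<..<x} t *\<^sub>R u t)"
      for t and p :: "real \<Rightarrow> real" by simp
    have eq': "(of_real (q t) - z) * (indicator {0<..<x} t *\<^sub>R u t) = (of_real (indicator S t * q t) - z) * (indicator {0<..<x} t *\<^sub>R u t)" for t
      using S[of t] by (cases "t \<in> {0<..<x}") auto
    show ?thesis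
      unfolding set_lebesgue_integral_def eq eq'
    proof (rule integral_cong_AE)
      show "(\<lambda>t. (of_real (indicator S t * q t) - z) * (indicator {0<..<x} t *\<^sub>R u t)) \<in> borel_measurable lebesgue"
        by (intro borel_measurable_times borel_measurable_diff borel_measurable_const um
            measurable_compose[OF qm borel_measurable_of_real])
      show "(\<lambda>t. (of_real (q' t) - z) * (indicator {0<..<x} t *\<^sub>R u t)) \<in> borel_measurable lebesgue"
        by (intro borel_measurable_times borel_measurable_diff borel_measurable_const um
            measurable_compose[OF q'm borel_measurable_of_real])
      show "AE t in lebesgue. (of_real (indicator S t * q t) - z) * (indicator {0<..<x} t *\<^sub>R u t)
          = (of_real (q' t) - z) * (indicator {0<..<x} t *\<^sub>R u t)"
        using ae' by eventually_elim simp
    qed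
  qed
  have "schroedinger_solution q b z u v \<longleftrightarrow> schroedinger_solution q' b z u v" for z u v
    unfolding schroedinger_solution_def Let_def
    by (intro conj_cong refl ball_cong) (use integral_eq in auto)
  hence "m_function q b h z = m_function q' b h z" for z
    by (simp add: m_function_def weyl_solution_def)
  moreover have "AE x in lborel. 0 < x \<and> ereal x < b \<longrightarrow> q x = q' x"
    using ae by eventually_elim (auto simp: S_def)
  ultimately show ?thesis using hp by (intro that)
qed

theorem theorem1p2:
  fixes q\<^sub>1 q\<^sub>2 :: "real \<Rightarrow> real" and b\<^sub>1 b\<^sub>2 h\<^sub>1 h\<^sub>2 :: ereal and a :: real
  assumes "is_potential q\<^sub>1 b\<^sub>1 h\<^sub>1"
    and "is_potential q\<^sub>2 b\<^sub>2 h\<^sub>2"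
    and "0 < a" and "ereal a < min b\<^sub>1 b\<^sub>2"
  shows "(AE x in lebesgue. x \<in> {0<..<a} \<longrightarrow> q\<^sub>1 x = q\<^sub>2 x) \<longleftrightarrow>
         soft_bigo at_top
           (\<lambda>\<kappa>::real. m_function q\<^sub>1 b\<^sub>1 h\<^sub>1 (of_real (- (\<kappa>\<^sup>2))) - m_function q\<^sub>2 b\<^sub>2 h\<^sub>2 (of_real (- (\<kappa>\<^sup>2))))
           (\<lambda>\<kappa>::real. exp (- 2 * \<kappa> * a))"
proof -
  note a = \<open>0 < a\<close>
  have ab: "ereal a < b\<^sub>1" "ereal a < b\<^sub>2" using assms(4) by auto
  have b: "0 < b\<^sub>1" "0 < b\<^sub>2" and h: "b\<^sub>1 < \<infinity> \<Longrightarrow> h\<^sub>1 \<noteq> -\<infinity>" "b\<^sub>2 < \<infinity> \<Longrightarrow> h\<^sub>2 \<noteq> -\<infinity>"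
    using assms(1,2) unfolding is_potential_def by presburger+
  obtain p\<^sub>1 C\<^sub>1 where p\<^sub>1: "halfline_potential p\<^sub>1 C\<^sub>1" "AE x in lborel. 0 < x \<and> ereal x < b\<^sub>1 \<longrightarrow> q\<^sub>1 x = p\<^sub>1 x"
    and m\<^sub>1: "\<And>z. m_function q\<^sub>1 b\<^sub>1 h\<^sub>1 z = m_function p\<^sub>1 b\<^sub>1 h\<^sub>1 z"
    by (rule potential_borel_version[OF assms(1)], rule that)
  obtain p\<^sub>2 C\<^sub>2 where p\<^sub>2: "halfline_potential p\<^sub>2 C\<^sub>2" "AE x in lborel. 0 < x \<and> ereal x < b\<^sub>2 \<longrightarrow> q\<^sub>2 x = p\<^sub>2 x"
    and m\<^sub>2: "\<And>z. m_function q\<^sub>2 b\<^sub>2 h\<^sub>2 z = m_function p\<^sub>2 b\<^sub>2 h\<^sub>2 z"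
    by (rule potential_borel_version[OF assms(2)], rule that)
  have qp: "AE x in lborel. x \<in> {0<..<a} \<longrightarrow> q\<^sub>1 x = p\<^sub>1 x \<and> q\<^sub>2 x = p\<^sub>2 x"
    using p\<^sub>1(2) p\<^sub>2(2)
  proof eventually_elim
    case (elim x)
    thus ?case using less_trans[OF _ ab(1), of "ereal x"] less_trans[OF _ ab(2), of "ereal x"] by auto
  qed
  show ?thesis
    unfolding AE_completion_iff m\<^sub>1 m\<^sub>2
  proof
    assume "AE x in lborel. x \<in> {0<..<a} \<longrightarrow> q\<^sub>1 x = q\<^sub>2 x"
    with qp have eq: "AE x in lborel. x \<in> {0<..<a} \<longrightarrow> p\<^sub>1 x = p\<^sub>2 x"
      by eventually_elim auto
    show "soft_bigo at_top
           (\<lambda>\<kappa>::real. m_function p\<^sub>1 b\<^sub>1 h\<^sub>1 (of_real (- (\<kappa>\<^sup>2))) - m_function p\<^sub>2 b\<^sub>2 h\<^sub>2 (of_real (- (\<kappa>\<^sup>2))))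
           (\<lambda>\<kappa>::real. exp (- 2 * \<kappa> * a))"
      by (rule m_function_difference_soft_bigo[OF p\<^sub>1(1) p\<^sub>2(1) b(1) h(1) b(2) h(2) a ab eq])
  next
    assume soft: "soft_bigo at_top
           (\<lambda>\<kappa>::real. m_function p\<^sub>1 b\<^sub>1 h\<^sub>1 (of_real (- (\<kappa>\<^sup>2))) - m_function p\<^sub>2 b\<^sub>2 h\<^sub>2 (of_real (- (\<kappa>\<^sup>2))))
           (\<lambda>\<kappa>::real. exp (- 2 * \<kappa> * a))"
    \<comment> \<open>Truncations to (0, a), regarded as integrable potentials on the half-line. The
      value 0 given below for h is a dummy.\<close>
    define t\<^sub>1 where "t\<^sub>1 x = indicator {0<..<a} x * p\<^sub>1 x" for x
    define t\<^sub>2 where "t\<^sub>2 x = indicator {0<..<a} x * p\<^sub>2 x" for x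
    have trunc: "integrable lborel (\<lambda>x. indicator {0<..<a} x * p x)" if "halfline_potential p C" for p C
    proof -
      have "set_integrable lborel {0<..<a} p"
        by (rule set_integrable_subset[OF halfline_potential.q_integrable[OF that, of a]]) auto
      thus ?thesis by (simp add: set_integrable_def)
    qed
    have t: "integrable lborel t\<^sub>1" "integrable lborel t\<^sub>2"
      unfolding t\<^sub>1_def t\<^sub>2_def using trunc p\<^sub>1(1) p\<^sub>2(1) by blast+
    note ht = integrable_imp_halfline_potential[OF t(1)] integrable_imp_halfline_potential[OF t(2)]
    \<comment> \<open>The direct half, applied to a potential and its own truncation: they agree on
      (0, a), though their right ends differ.\<close>
    have s1: "soft_bigo at_top (\<lambda>\<kappa>::real. m_function t\<^sub>1 \<infinity> 0 (of_real (- (\<kappa>\<^sup>2))) - m_function p\<^sub>1 b\<^sub>1 h\<^sub>1 (of_real (- (\<kappa>\<^sup>2))))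
        (\<lambda>\<kappa>::real. exp (- 2 * \<kappa> * a))"
      by (rule m_function_difference_soft_bigo[OF ht(1) p\<^sub>1(1)]) (use b h a ab in \<open>auto simp: t\<^sub>1_def\<close>)
    have s2: "soft_bigo at_top (\<lambda>\<kappa>::real. m_function p\<^sub>2 b\<^sub>2 h\<^sub>2 (of_real (- (\<kappa>\<^sup>2))) - m_function t\<^sub>2 \<infinity> 0 (of_real (- (\<kappa>\<^sup>2))))
        (\<lambda>\<kappa>::real. exp (- 2 * \<kappa> * a))"
      by (rule m_function_difference_soft_bigo[OF p\<^sub>2(1) ht(2)]) (use b h a ab in \<open>auto simp: t\<^sub>2_def\<close>)
    have "soft_bigo at_top (\<lambda>\<kappa>::real. m_function t\<^sub>1 \<infinity> 0 (of_real (- (\<kappa>\<^sup>2))) - m_function t\<^sub>2 \<infinity> 0 (of_real (- (\<kappa>\<^sup>2))))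
        (\<lambda>\<kappa>::real. exp (- 2 * \<kappa> * a))"
      using soft_bigo_add[OF soft_bigo_add[OF s1 soft] s2] by simp
    hence "AE x in lborel. x \<in> {0..a} \<longrightarrow> t\<^sub>1 x = t\<^sub>2 x"
      by (rule potentials_eq_of_m_function_soft_bigo[OF t a, rotated 2]) (auto simp: t\<^sub>1_def t\<^sub>2_def)
    with qp show "AE x in lborel. x \<in> {0<..<a} \<longrightarrow> q\<^sub>1 x = q\<^sub>2 x"
      by eventually_elim (auto simp: t\<^sub>1_def t\<^sub>2_def)
  qed
qed

end
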